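(* Let $n=2$, let $\Omega$ be the unit disc in $\mathbb R^2$, and let $Q=\Omega\times(-1,0)$. There exist functions $f:Q\to\mathbb R^2$ and $g:Q\to\mathbb R$ satisfying $$f\in L_2(Q),\qquad g\in W^{1,0}_2(Q),\qquad \partial_t g\in L_2(-1,0;W^{-1}_2(\Omega)),$$ $$\int_\Omega g(x,t)\,dx=0\ \text{ for a.e. } t\in(-1,0),\qquad g(\cdot,-1)=0,\qquad g|_{\partial\Omega\times(-1,0)}=0,$$ and there exists a pair $(v,p)$ (with $v:Q\to\mathbb R^2$, $p:Q\to\mathbb R$) such that $$v\in C([-1,0];L_2(\Omega))\cap W^{1,0}_2(Q),\qquad p\in L_2(Q),\qquad \partial_t v\in L_2(-1,0;W^{-1}_2(\Omega)),$$ the equations $$\partial_t v-\Delta v+\nabla p=f,\qquad \operatorname{div}v=g$$ hold in $Q$ in the sense of distributions, and $v|_{t=-1}=0$, $v|_{\partial\Omega\times(-1,0)}=0$ in the sense of traces, but $$v\notin W^{2,1}_2(Q),\qquad \nabla p\notin L_2(Q).$$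
   Context: $\nabla$, $\Delta$, $\operatorname{div}$ act in the spatial variable $x$. $W^{1,0}_2(Q)=L_2(-1,0;W^1_2(\Omega))=\{u\in L_2(Q):\nabla u\in L_2(Q)\}$; $W^{2,1}_2(Q)=\{u\in W^{1,0}_2(Q):\nabla^2u,\ \partial_tu\in L_2(Q)\}$ (for scalar or vector-valued functions). $\overset{\circ}{W}{}^1_2(\Omega)=\{u\in W^1_2(\Omega):u|_{\partial\Omega}=0\}$, and $W^{-1}_2(\Omega)$ is the dual space of $\overset{\circ}{W}{}^1_2(\Omega)$. *)

theory Defs
  imports "HOL-Analysis.Analysis"
begin

section \<open>Test functions and distributions\<close>

definition dir_deriv :: "'a::euclidean_space \<Rightarrow> ('a \<Rightarrow> real) \<Rightarrow> 'a \<Rightarrow> real" where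
  "dir_deriv b \<phi> x = frechet_derivative \<phi> (at x) b"

primrec Ck :: "nat \<Rightarrow> ('a::euclidean_space \<Rightarrow> real) \<Rightarrow> bool" where
  "Ck 0 \<phi> \<longleftrightarrow> continuous_on UNIV \<phi>"
| "Ck (Suc k) \<phi> \<longleftrightarrow> (\<forall>x. \<phi> differentiable at x) \<and> (\<forall>b\<in>Basis. Ck k (dir_deriv b \<phi>))"

definition test_functions :: "'a::euclidean_space set \<Rightarrow> ('a \<Rightarrow> real) set" where
  "test_functions U =
     {\<phi>. (\<forall>k. Ck k \<phi>) \<and> compact (closure {x. \<phi> x \<noteq> 0}) \<and> closure {x. \<phi> x \<noteq> 0} \<subseteq> U}"

text \<open>Distributions on \<open>U\<close> are represented by functionals that are only ever evaluated on
  \<open>test_functions U\<close>.\<close>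

type_synonym 'a distribution = "('a \<Rightarrow> real) \<Rightarrow> real"

definition regular_distr :: "'a::euclidean_space set \<Rightarrow> ('a \<Rightarrow> real) \<Rightarrow> 'a distribution" where
  "regular_distr U u \<phi> = (LINT x|lebesgue_on U. u x * \<phi> x)"

definition distr_deriv :: "'a::euclidean_space \<Rightarrow> 'a distribution \<Rightarrow> 'a distribution" where
  "distr_deriv b T \<phi> = - T (dir_deriv b \<phi>)"

definition distr_eq :: "'a::euclidean_space set \<Rightarrow> 'a distribution \<Rightarrow> 'a distribution \<Rightarrow> bool" where
  "distr_eq U S T \<longleftrightarrow> (\<forall>\<phi>\<in>test_functions U. S \<phi> = T \<phi>)"


section \<open>Square-integrable functions\<close>

text \<open>Here and below, function spaces are sets of representatives; functions that agree almost
  everywhere are not identified.\<close>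

definition space_L2 :: "'a measure \<Rightarrow> ('a \<Rightarrow> real) set" where
  "space_L2 M = {u \<in> borel_measurable M. integrable M (\<lambda>x. (u x)\<^sup>2)}"

definition norm_L2 :: "'a measure \<Rightarrow> ('a \<Rightarrow> real) \<Rightarrow> real" where
  "norm_L2 M u = sqrt (LINT x|M. (u x)\<^sup>2)"

definition distr_in_L2 :: "'a::euclidean_space set \<Rightarrow> 'a distribution \<Rightarrow> bool" where
  "distr_in_L2 U T \<longleftrightarrow> (\<exists>w\<in>space_L2 (lebesgue_on U). distr_eq U T (regular_distr U w))"

text \<open>Membership of a vector field in a space of scalar functions, componentwise.\<close>

definition components_in :: "('a \<Rightarrow> real) set \<Rightarrow> ('a \<Rightarrow> real ^ 2) set" where
  "components_in X = {v. \<forall>k. (\<lambda>z. v z $ k) \<in> X}"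


section \<open>Sobolev spaces on the unit disc\<close>

definition Omega :: "(real ^ 2) set" where
  "Omega = ball 0 1"

definition W12 :: "(real ^ 2 \<Rightarrow> real) set" where
  "W12 = {u \<in> space_L2 (lebesgue_on Omega).
            \<forall>i. distr_in_L2 Omega (distr_deriv (axis i 1) (regular_distr Omega u))}"

text \<open>The weak derivative is unique up to null sets, so the choice below does not influence
  the norm.\<close>

definition weak_deriv :: "2 \<Rightarrow> (real ^ 2 \<Rightarrow> real) \<Rightarrow> real ^ 2 \<Rightarrow> real" where
  "weak_deriv i u = (SOME w. w \<in> space_L2 (lebesgue_on Omega) \<and>
     distr_eq Omega (distr_deriv (axis i 1) (regular_distr Omega u)) (regular_distr Omega w))"

definition norm_W12 :: "(real ^ 2 \<Rightarrow> real) \<Rightarrow> real" where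
  "norm_W12 u = sqrt ((norm_L2 (lebesgue_on Omega) u)\<^sup>2
                      + (\<Sum>i\<in>UNIV. (norm_L2 (lebesgue_on Omega) (weak_deriv i u))\<^sup>2))"

text \<open>Arc length on the unit circle, the boundary of the disc.\<close>

definition circle_measure :: "(real ^ 2) measure" where
  "circle_measure = distr (lebesgue_on {0..2 * pi}) borel (\<lambda>\<theta>. vector [cos \<theta>, sin \<theta>])"

text \<open>The trace operator is the continuous extension of \<open>u \<mapsto> u|\<partial>\<Omega>\<close> from the functions that are
  continuously differentiable up to the boundary to \<open>W12\<close>; its graph is the closure of the graph
  of the restriction map.\<close>

definition has_trace :: "(real ^ 2 \<Rightarrow> real) \<Rightarrow> (real ^ 2 \<Rightarrow> real) \<Rightarrow> bool" where
  "has_trace u w \<longleftrightarrow> u \<in> W12 \<and> w \<in> space_L2 circle_measure \<and>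
     (\<exists>U. (\<forall>k. Ck 1 (U k)) \<and>
          (\<lambda>k. norm_W12 (\<lambda>x. U k x - u x)) \<longlonglongrightarrow> 0 \<and>
          (\<lambda>k. norm_L2 circle_measure (\<lambda>x. U k x - w x)) \<longlonglongrightarrow> 0)"

definition W12_0 :: "(real ^ 2 \<Rightarrow> real) set" where
  "W12_0 = {u \<in> W12. has_trace u (\<lambda>x. 0)}"


section \<open>The dual space and square-integrable functions with values in it\<close>

text \<open>An element of the dual space is a functional of which only the values on \<open>W12_0\<close> matter.
  Linearity and boundedness force equal values on functions that agree almost everywhere.\<close>

definition W_minus1 :: "((real ^ 2 \<Rightarrow> real) \<Rightarrow> real) set" where
  "W_minus1 = {l. (\<forall>u\<in>W12_0. \<forall>w\<in>W12_0. l (\<lambda>x. u x + w x) = l u + l w) \<and>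
                  (\<forall>c. \<forall>u\<in>W12_0. l (\<lambda>x. c * u x) = c * l u) \<and>
                  (\<exists>C. \<forall>u\<in>W12_0. \<bar>l u\<bar> \<le> C * norm_W12 u)}"

definition norm_W_minus1 :: "((real ^ 2 \<Rightarrow> real) \<Rightarrow> real) \<Rightarrow> real" where
  "norm_W_minus1 l = (SUP u\<in>{u \<in> W12_0. norm_W12 u \<le> 1}. \<bar>l u\<bar>)"

definition Tint :: "real set" where
  "Tint = {-1<..<0}"

text \<open>The Bochner space of strongly measurable, square-integrable functions on the time interval
  with values in \<open>W_minus1\<close>.\<close>

definition L2_W_minus1 :: "(real \<Rightarrow> (real ^ 2 \<Rightarrow> real) \<Rightarrow> real) set" where
  "L2_W_minus1 = {h. (\<forall>t\<in>Tint. h t \<in> W_minus1) \<and>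
     (\<exists>s. (\<forall>k. simple_function (lebesgue_on Tint) (s k)) \<and>
          (\<forall>k. \<forall>t\<in>Tint. s k t \<in> W_minus1) \<and>
          (AE t in lebesgue_on Tint. (\<lambda>k. norm_W_minus1 (\<lambda>u. s k t u - h t u)) \<longlonglongrightarrow> 0)) \<and>
     integrable (lebesgue_on Tint) (\<lambda>t. (norm_W_minus1 (h t))\<^sup>2)}"


section \<open>Function spaces on the space-time cylinder\<close>

definition Qcyl :: "((real ^ 2) \<times> real) set" where
  "Qcyl = Omega \<times> Tint"

definition e_x :: "2 \<Rightarrow> (real ^ 2) \<times> real" where
  "e_x i = (axis i 1, 0)"

definition e_t :: "(real ^ 2) \<times> real" where
  "e_t = (0, 1)"

definition grad_in_L2 :: "((real ^ 2) \<times> real \<Rightarrow> real) \<Rightarrow> bool" where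
  "grad_in_L2 u \<longleftrightarrow> (\<forall>i. distr_in_L2 Qcyl (distr_deriv (e_x i) (regular_distr Qcyl u)))"

definition W10_2 :: "((real ^ 2) \<times> real \<Rightarrow> real) set" where
  "W10_2 = {u \<in> space_L2 (lebesgue_on Qcyl). grad_in_L2 u}"

definition W21_2 :: "((real ^ 2) \<times> real \<Rightarrow> real) set" where
  "W21_2 = {u \<in> W10_2.
     (\<forall>i j. distr_in_L2 Qcyl (distr_deriv (e_x i) (distr_deriv (e_x j) (regular_distr Qcyl u)))) \<and>
     distr_in_L2 Qcyl (distr_deriv e_t (regular_distr Qcyl u))}"

text \<open>Functions whose distributional time derivative belongs to \<open>L2_W_minus1\<close>.\<close>

definition dt_in_L2_W_minus1 :: "((real ^ 2) \<times> real \<Rightarrow> real) set" where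
  "dt_in_L2_W_minus1 = {u. \<exists>h\<in>L2_W_minus1.
     distr_eq Qcyl (distr_deriv e_t (regular_distr Qcyl u))
                   (\<lambda>\<phi>. LINT t|lebesgue_on Tint. h t (\<lambda>x. \<phi> (x, t)))}"

text \<open>\<open>W\<close> is the continuous representative of \<open>u\<close> as a function from the closed time interval to
  \<open>L\<^sub>2(\<Omega>)\<close>.  Values at the initial time are values of this representative.\<close>

definition is_C_L2_rep ::
    "((real ^ 2) \<times> real \<Rightarrow> real) \<Rightarrow> (real \<Rightarrow> real ^ 2 \<Rightarrow> real) \<Rightarrow> bool" where
  "is_C_L2_rep u W \<longleftrightarrow>
     (\<forall>t\<in>{-1..0}. W t \<in> space_L2 (lebesgue_on Omega)) \<and>
     (\<forall>t0\<in>{-1..0}. ((\<lambda>t. norm_L2 (lebesgue_on Omega) (\<lambda>x. W t x - W t0 x)) \<longlongrightarrow> 0)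
                      (at t0 within {-1..0})) \<and>
     (AE t in lebesgue_on Tint. AE x in lebesgue_on Omega. u (x, t) = W t x)"

definition C_L2 :: "((real ^ 2) \<times> real \<Rightarrow> real) set" where
  "C_L2 = {u. \<exists>W. is_C_L2_rep u W}"

definition zero_initial_value :: "((real ^ 2) \<times> real \<Rightarrow> real) set" where
  "zero_initial_value =
     {u. \<exists>W. is_C_L2_rep u W \<and> (AE x in lebesgue_on Omega. W (-1) x = 0)}"

text \<open>The trace on the lateral boundary of an element of \<open>W10_2\<close>, which is
  \<open>L\<^sub>2\<close> in time with values in \<open>W12\<close>, is taken at almost every time.\<close>

definition zero_lateral_trace :: "((real ^ 2) \<times> real \<Rightarrow> real) set" where
  "zero_lateral_trace = {u. AE t in lebesgue_on Tint. has_trace (\<lambda>x. u (x, t)) (\<lambda>x. 0)}"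


section \<open>The Stokes system in the sense of distributions\<close>

definition momentum_eq ::
    "((real ^ 2) \<times> real \<Rightarrow> real ^ 2) \<Rightarrow> ((real ^ 2) \<times> real \<Rightarrow> real) \<Rightarrow>
     ((real ^ 2) \<times> real \<Rightarrow> real ^ 2) \<Rightarrow> bool" where
  "momentum_eq v p f \<longleftrightarrow> (\<forall>k.
     let vk = regular_distr Qcyl (\<lambda>z. v z $ k) in
     distr_eq Qcyl
       (\<lambda>\<phi>. distr_deriv e_t vk \<phi>
            - (\<Sum>j\<in>UNIV. distr_deriv (e_x j) (distr_deriv (e_x j) vk) \<phi>)
            + distr_deriv (e_x k) (regular_distr Qcyl p) \<phi>)
       (regular_distr Qcyl (\<lambda>z. f z $ k)))"

definition divergence_eq ::
    "((real ^ 2) \<times> real \<Rightarrow> real ^ 2) \<Rightarrow> ((real ^ 2) \<times> real \<Rightarrow> real) \<Rightarrow> bool" where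
  "divergence_eq v g \<longleftrightarrow>
     distr_eq Qcyl
       (\<lambda>\<phi>. \<Sum>k\<in>UNIV. distr_deriv (e_x k) (regular_distr Qcyl (\<lambda>z. v z $ k)) \<phi>)
       (regular_distr Qcyl g)"

end

theory Submission
  imports Defs
begin

text \<open>If \<open>v\<close> were in \<open>W21_2\<close>, then \<open>\<partial>\<^sub>t g = div \<partial>\<^sub>t v\<close> with \<open>\<partial>\<^sub>t v\<close>
  square integrable and without normal component on the circle, so \<open>\<partial>\<^sub>t g\<close> would be controlled by
  testing with all of \<open>W12\<close>.  The hypothesis on \<open>\<partial>\<^sub>t g\<close> only concerns test functions that vanish on
  the circle.  The example lives in this gap: its divergence sits in a thin layer at the boundary,
  where functions with zero trace are small, while the harmonic functions seen by the pressure
  are not.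

  Put \<open>N = n + 1\<close>, \<open>M = N\<^sup>3\<close>, \<open>\<Phi> = Re z\<^sup>N\<close> and \<open>\<zeta> = (1 - |x|\<^sup>2\<^sup>M)\<^sup>2\<close>.  The polynomial field \<open>V = \<zeta> \<nabla>\<Phi>\<close> vanishes
  on the circle and is close to the gradient of \<open>\<Phi>\<close> away from a layer of width about \<open>1 / M\<close>.  As \<open>\<Phi>\<close> is
  harmonic, \<open>div V = \<nabla>\<zeta> \<cdot> \<nabla>\<Phi>\<close>, which vanishes on the circle too.  For a function \<open>\<alpha>\<close> of time let
  \<open>v = \<alpha> V\<close> and \<open>p = - \<alpha>' \<Phi>\<close>.  The main parts of \<open>\<partial>\<^sub>t v\<close> and \<open>\<nabla>p\<close> cancel and leave
  \<open>f = \<alpha>' (\<zeta> - 1) \<nabla>\<Phi> - \<alpha> \<Delta>V\<close>.  The square norms over the disc are of the following order: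
  \<open>1 / N\<close> for \<open>\<Phi>\<close>, \<open>N\<^sup>2 / M = 1 / N\<close> for \<open>(\<zeta> - 1) \<nabla>\<Phi>\<close>, but \<open>N\<close> for \<open>\<nabla>\<Phi>\<close>.  If \<open>\<integral> \<alpha>'\<^sup>2\<close> is a constant times
  \<open>1 / N\<close>, then \<open>p\<close> and the first part of \<open>f\<close> contribute about \<open>1 / N\<^sup>2\<close>, which is summable, and \<open>\<nabla>p\<close> contributes a
  constant, which is not (\<open>pressure_gradient_norm\<close>, \<open>pressure_gradient_not_L2\<close>).  Terms with \<open>\<alpha>\<close> instead
  of \<open>\<alpha>'\<close> are harmless, because shortening the pulse makes \<open>\<alpha>\<close> small without changing \<open>\<integral> \<alpha>'\<^sup>2\<close>
  (\<open>summable_pulse\<close>).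

  The time derivatives of \<open>v\<close> and \<open>g\<close> are estimated in the dual norm with the radial field \<open>x\<close>.  If
  \<open>h = div (W x)\<close>, then \<open>\<integral> h u = - \<integral> W x \<cdot> \<nabla>u\<close> for \<open>u\<close> with zero trace, so the dual norm of \<open>h\<close> is at
  most \<open>2 \<parallel>W\<parallel>\<close> (\<open>W12_0_dual_estimate\<close>).  The components of \<open>V\<close> and \<open>div V\<close> are sums of homogeneous
  polynomials, and \<open>W\<close> arises by dividing the part of degree \<open>d\<close> by \<open>d + 2\<close>
  (\<open>radial_mix_homogeneous_divergence\<close>); its square norm is again of order \<open>1 / N\<close>.  The divergence
  theorem for the field \<open>W x\<close> also gives the mean value of \<open>g\<close> and the moments of \<open>|x|\<close>.

  The pulses for different \<open>n\<close> have disjoint supports in time that accumulate only at \<open>t = 0\<close>, so a test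
  function on the open cylinder meets finitely many of them and the equations hold classically on its
  support.  Finally \<open>v\<close> is not in \<open>W21_2\<close>, since the momentum equation would then express \<open>\<nabla>p\<close> by
  square-integrable functions.

  Two facts of analysis are needed on the way: uniqueness of weak derivatives, as the Sobolev norm is
  defined through an arbitrary choice of them, and the divergence theorem on the disc for radial fields.\<close>

section \<open>Smooth functions\<close>

lemma dir_deriv_eq:
  assumes "(f has_derivative D) (at x)"
  shows "dir_deriv b f x = D b"
  using frechet_derivative_at[OF assms] by (simp add: dir_deriv_def)

text \<open>The functions \<open>exp (- 1 / t) / t\<^sup>m\<close>, extended by zero: their linear span is closed under
  differentiation.\<close>

definition flat_exp :: "nat \<Rightarrow> real \<Rightarrow> real" where
  "flat_exp m t = (if t > 0 then exp (- inverse t) * inverse t ^ m else 0)"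

lemma flat_exp_tendsto_0: "((flat_exp m) \<longlongrightarrow> 0) (at_right 0)"
proof -
  have "((\<lambda>y::real. y ^ m / exp y) \<longlongrightarrow> 0) at_top"
    by (rule tendsto_power_div_exp_0)
  then have "((\<lambda>t::real. inverse t ^ m / exp (inverse t)) \<longlongrightarrow> 0) (at_right 0)"
    using filterlim_inverse_at_top_right by (rule filterlim_compose)
  moreover have "\<forall>\<^sub>F t in at_right 0. inverse t ^ m / exp (inverse t) = flat_exp m t"
    by (rule eventually_at_rightI[of 0 1]) (auto simp: flat_exp_def exp_minus field_simps)
  ultimately show ?thesis by (rule Lim_transform_eventually)
qed

lemma flat_exp_deriv:
  "(flat_exp m has_real_derivative flat_exp (m + 2) t - real m * flat_exp (m + 1) t) (at t)"
proof -
  consider "t > 0" | "t < 0" | "t = 0" by linarith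
  then show ?thesis
  proof cases
    case 1
    have "((\<lambda>t. exp (- inverse t) * inverse t ^ m) has_real_derivative
        flat_exp (m + 2) t - real m * flat_exp (m + 1) t) (at t)"
      using 1 by (auto intro!: derivative_eq_intros simp: flat_exp_def field_simps power2_eq_square)
        (cases m; simp add: field_simps)
    then show ?thesis
      by (rule DERIV_cong_ev[THEN iffD1, rotated -1])
        (use 1 in \<open>auto simp: flat_exp_def eventually_nhds intro!: exI[of _ "{0<..}"]\<close>)
  next
    case 2
    have "((\<lambda>t. 0) has_real_derivative flat_exp (m + 2) t - real m * flat_exp (m + 1) t) (at t)"
      using 2 by (auto simp: flat_exp_def)
    then show ?thesis
      by (rule DERIV_cong_ev[THEN iffD1, rotated -1])
        (use 2 in \<open>auto simp: flat_exp_def eventually_nhds intro!: exI[of _ "{..<0}"]\<close>)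
  next
    case 3
    have "((\<lambda>h. flat_exp m h / h) \<longlongrightarrow> 0) (at_right 0)"
    proof (rule Lim_transform_eventually[OF flat_exp_tendsto_0[of "m + 1"]])
      show "\<forall>\<^sub>F h in at_right 0. flat_exp (m + 1) h = flat_exp m h / h"
        by (rule eventually_at_rightI[of 0 1]) (auto simp: flat_exp_def field_simps)
    qed
    moreover have "((\<lambda>h. flat_exp m h / h) \<longlongrightarrow> 0) (at_left 0)"
    proof (rule Lim_transform_eventually[OF tendsto_const])
      show "\<forall>\<^sub>F h in at_left 0. 0 = flat_exp m h / h"
        by (rule eventually_at_leftI[of "-1"]) (auto simp: flat_exp_def)
    qed
    ultimately have "((\<lambda>h. flat_exp m h / h) \<longlongrightarrow> 0) (at 0)"
      by (simp add: filterlim_split_at)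
    then show ?thesis using 3 by (simp add: DERIV_def flat_exp_def)
  qed
qed

text \<open>An algebra of functions that is closed under directional derivatives. Infinite
  differentiability of a member then needs no bookkeeping of orders: it follows from closure
  alone. The exponential is included to turn bump functions into approximations of indicators.\<close>

inductive_set smooth_alg :: "('a::euclidean_space \<Rightarrow> real) set" where
  const: "(\<lambda>x. c) \<in> smooth_alg"
| coord: "(\<lambda>x. x \<bullet> b) \<in> smooth_alg"
| flat: "(\<lambda>x. flat_exp m (x \<bullet> b + c)) \<in> smooth_alg"
| add: "f \<in> smooth_alg \<Longrightarrow> g \<in> smooth_alg \<Longrightarrow> (\<lambda>x. f x + g x) \<in> smooth_alg"
| mult: "f \<in> smooth_alg \<Longrightarrow> g \<in> smooth_alg \<Longrightarrow> (\<lambda>x. f x * g x) \<in> smooth_alg"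
| exp: "f \<in> smooth_alg \<Longrightarrow> (\<lambda>x. exp (f x)) \<in> smooth_alg"

lemma smooth_alg_uminus: "f \<in> smooth_alg \<Longrightarrow> (\<lambda>x. - f x) \<in> smooth_alg"
  using smooth_alg.mult[OF smooth_alg.const[of "-1"]] by simp

lemma smooth_alg_diff:
  "f \<in> smooth_alg \<Longrightarrow> g \<in> smooth_alg \<Longrightarrow> (\<lambda>x. f x - g x) \<in> smooth_alg"
  using smooth_alg.add[OF _ smooth_alg_uminus] by fastforce

lemma smooth_alg_power: "f \<in> smooth_alg \<Longrightarrow> (\<lambda>x. f x ^ n) \<in> smooth_alg"
  by (induction n) (auto intro: smooth_alg.intros)

lemma smooth_alg_prod:
  "(\<And>i. i \<in> A \<Longrightarrow> f i \<in> smooth_alg) \<Longrightarrow> (\<lambda>x. \<Prod>i\<in>A. f i x) \<in> smooth_alg"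
  by (induction A rule: infinite_finite_induct) (auto intro: smooth_alg.intros)

lemma smooth_alg_has_derivative:
  assumes "f \<in> smooth_alg"
  shows "\<exists>D. (\<forall>x. (f has_derivative D x) (at x)) \<and> (\<forall>b. (\<lambda>x. D x b) \<in> smooth_alg)"
  using assms
proof induction
  case (const c)
  then show ?case
    by (intro exI[of _ "\<lambda>x y. 0"]) (auto intro: smooth_alg.const)
next
  case (coord b)
  then show ?case
    by (intro exI[of _ "\<lambda>x y. y \<bullet> b"]) (auto intro!: derivative_eq_intros smooth_alg.const)
next
  case (flat m b c)
  let ?d = "\<lambda>t. flat_exp (m + 2) t - real m * flat_exp (m + 1) t"
  have "((\<lambda>x. flat_exp m (x \<bullet> b + c)) has_derivative (\<lambda>y. (y \<bullet> b) * ?d (x \<bullet> b + c))) (at x)" for x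
  proof -
    have "((\<lambda>x. x \<bullet> b + c) has_derivative (\<lambda>y. y \<bullet> b)) (at x)"
      by (auto intro!: derivative_eq_intros)
    from has_derivative_compose[OF this
        flat_exp_deriv[of m "x \<bullet> b + c", unfolded has_field_derivative_def]]
    show ?thesis by (simp add: mult.commute)
  qed
  then show ?case
    by (intro exI[of _ "\<lambda>x y. (y \<bullet> b) * ?d (x \<bullet> b + c)"])
      (auto intro!: smooth_alg.mult smooth_alg_diff smooth_alg.const smooth_alg.flat)
next
  case (add f g)
  then obtain D E where
    "\<forall>x. (f has_derivative D x) (at x)" "\<forall>b. (\<lambda>x. D x b) \<in> smooth_alg"
    "\<forall>x. (g has_derivative E x) (at x)" "\<forall>b. (\<lambda>x. E x b) \<in> smooth_alg" by blast
  then show ?case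
    by (intro exI[of _ "\<lambda>x y. D x y + E x y"]) (auto intro!: smooth_alg.add has_derivative_add)
next
  case (mult f g)
  then obtain D E where
    "\<forall>x. (f has_derivative D x) (at x)" "\<forall>b. (\<lambda>x. D x b) \<in> smooth_alg"
    "\<forall>x. (g has_derivative E x) (at x)" "\<forall>b. (\<lambda>x. E x b) \<in> smooth_alg" by blast
  then show ?case using mult
    by (intro exI[of _ "\<lambda>x y. f x * E x y + D x y * g x"])
      (auto intro!: smooth_alg.add smooth_alg.mult has_derivative_mult)
next
  case (exp f)
  then obtain D where
    "\<forall>x. (f has_derivative D x) (at x)" "\<forall>b. (\<lambda>x. D x b) \<in> smooth_alg" by blast
  then show ?case using exp
    by (intro exI[of _ "\<lambda>x y. D x y * exp (f x)"])
      (auto intro!: smooth_alg.mult smooth_alg.exp derivative_eq_intros)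
qed

lemma smooth_alg_dir_deriv: "f \<in> smooth_alg \<Longrightarrow> dir_deriv b f \<in> smooth_alg"
  by (metis (no_types, lifting) ext dir_deriv_eq smooth_alg_has_derivative)

lemma smooth_alg_Ck:
  assumes "f \<in> smooth_alg"
  shows "Ck k f"
  using assms
proof (induction k arbitrary: f)
  case 0
  from smooth_alg_has_derivative[OF 0] have "\<And>x. isCont f x"
    by (meson has_derivative_continuous)
  then show ?case by (simp add: continuous_at_imp_continuous_on)
next
  case (Suc k)
  from smooth_alg_has_derivative[OF Suc.prems] have "\<And>x. f differentiable at x"
    by (meson differentiable_def)
  with Suc.IH[OF smooth_alg_dir_deriv[OF Suc.prems]] show ?case by simp
qed

lemma Ck_Suc_imp_Ck: "Ck (Suc k) f \<Longrightarrow> Ck k f"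
proof (induction k arbitrary: f)
  case 0
  then have "\<And>x. isCont f x" by (simp add: differentiable_imp_continuous_within)
  then show ?case by (simp add: continuous_at_imp_continuous_on)
qed simp

section \<open>Integration by parts against test functions\<close>

lemma Ck_1_iff:
  "Ck 1 f \<longleftrightarrow> (\<forall>x. f differentiable at x) \<and> (\<forall>b\<in>Basis. continuous_on UNIV (dir_deriv b f))"
  by simp

lemma has_derivative_dir_deriv:
  assumes "f differentiable at x"
  obtains D where "(f has_derivative D) (at x)" "\<And>b. dir_deriv b f x = D b"
  using assms dir_deriv_eq unfolding differentiable_def by metis

lemma dir_deriv_mult:
  assumes "f differentiable at x" "g differentiable at x"
  shows "dir_deriv b (\<lambda>x. f x * g x) x = f x * dir_deriv b g x + dir_deriv b f x * g x"
proof -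
  obtain D E where "(f has_derivative D) (at x)" "(g has_derivative E) (at x)"
    and *: "\<And>b. dir_deriv b f x = D b" "\<And>b. dir_deriv b g x = E b"
    using assms by (metis has_derivative_dir_deriv)
  then have "((\<lambda>x. f x * g x) has_derivative (\<lambda>y. f x * E y + D y * g x)) (at x)"
    by (intro has_derivative_mult)
  from dir_deriv_eq[OF this] show ?thesis by (simp add: *)
qed

lemma dir_deriv_line:
  assumes "\<And>x. f differentiable at x"
  shows "((\<lambda>h. f (x + h *\<^sub>R b)) has_real_derivative dir_deriv b f (x + h *\<^sub>R b)) (at h)"
proof -
  obtain D where D: "(f has_derivative D) (at (x + h *\<^sub>R b))"
    and *: "dir_deriv b f (x + h *\<^sub>R b) = D b"
    using assms has_derivative_dir_deriv by metis
  have "((\<lambda>h. x + h *\<^sub>R b) has_derivative (\<lambda>k. k *\<^sub>R b)) (at h)"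
    by (auto intro!: derivative_eq_intros)
  from has_derivative_compose[OF this D]
  have "((\<lambda>h. f (x + h *\<^sub>R b)) has_derivative (\<lambda>k. D (k *\<^sub>R b))) (at h)" .
  moreover have "(\<lambda>k. D (k *\<^sub>R b)) = (*) (D b)"
    using linear_scale[OF has_derivative_linear[OF D]] by auto
  ultimately show ?thesis by (simp add: has_field_derivative_def *)
qed

lemma dir_deriv_outside:
  assumes "closed K" "\<And>x. x \<notin> K \<Longrightarrow> f x = 0" "x \<notin> K"
  shows "dir_deriv b f x = 0"
proof -
  have "((\<lambda>x. 0) has_derivative (\<lambda>y. 0)) (at x)" by simp
  then have "(f has_derivative (\<lambda>y. 0)) (at x)"
    by (rule has_derivative_transform_within_open[of _ _ _ _ "- K"]) (use assms in auto)
  from dir_deriv_eq[OF this] show ?thesis .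
qed

lemma integrable_compact_support:
  fixes f :: "'a::euclidean_space \<Rightarrow> real"
  assumes "continuous_on UNIV f" "compact K" "\<And>x. x \<notin> K \<Longrightarrow> f x = 0"
  shows "integrable lborel f"
proof -
  have "integrable lborel (\<lambda>x. indicator K x *\<^sub>R f x)"
    by (rule borel_integrable_compact[OF assms(2)])
      (rule continuous_on_subset[OF assms(1)], simp)
  also have "(\<lambda>x. indicator K x *\<^sub>R f x) = f"
    using assms(3) by (intro ext) (auto simp: indicator_def split: split_of_bool)
  finally show ?thesis .
qed

text \<open>Translation does not change the integral, so the difference quotients of \<open>f\<close> in direction \<open>b\<close>
  have integral zero; they converge boundedly to the derivative on a fixed ball.\<close>

lemma integral_dir_deriv_eq_0:
  fixes f :: "'a::euclidean_space \<Rightarrow> real"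
  assumes diff: "\<And>x. f differentiable at x" and cont: "continuous_on UNIV (dir_deriv b f)"
    and K: "compact K" "\<And>x. x \<notin> K \<Longrightarrow> f x = 0"
  shows "(LINT x|lborel. dir_deriv b f x) = 0"
proof -
  let ?d = "dir_deriv b f"
  \<comment> \<open>the steps of the difference quotients\<close>
  define s where "s n = inverse (real (Suc n))" for n
  have s: "s n > 0" "s n \<le> 1" for n by (auto simp: s_def field_simps)
  have cf: "continuous_on UNIV f"
    by (simp add: continuous_at_imp_continuous_on diff differentiable_imp_continuous_within)
  have d0: "?d x = 0" if "x \<notin> K" for x
    using dir_deriv_outside[OF compact_imp_closed[OF K(1)] K(2) that] .
  obtain C where C: "\<And>x. \<bar>?d x\<bar> \<le> C"
  proof -
    have "compact (?d ` K)"
      by (rule compact_continuous_image) (use cont K continuous_on_subset in blast)+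
    then obtain C where "\<forall>x\<in>K. \<bar>?d x\<bar> \<le> C"
      by (auto dest!: compact_imp_bounded simp: bounded_iff)
    then have "\<bar>?d x\<bar> \<le> max C 0" for x using d0[of x] by (cases "x \<in> K") force+
    then show ?thesis using that by blast
  qed
  obtain R where R: "\<forall>x\<in>K. norm x \<le> R"
    using compact_imp_bounded[OF K(1)] by (auto simp: bounded_iff)
  define q where "q n x = (f (x + s n *\<^sub>R b) - f x) / s n" for n x
  have int_f: "integrable lborel f"
    using cf K by (rule integrable_compact_support)
  have q0: "(LINT x|lborel. q n x) = 0" for n
  proof -
    have shift: "integrable lborel (\<lambda>x. f (x + s n *\<^sub>R b))"
      "(LINT x|lborel. f (x + s n *\<^sub>R b)) = (LINT x|lborel. f x)"
    proof -
      have [measurable]: "f \<in> borel_measurable borel"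
        using cf by (rule borel_measurable_continuous_onI)
      show "integrable lborel (\<lambda>x. f (x + s n *\<^sub>R b))"
        using int_f integrable_distr_eq[of "(+) (s n *\<^sub>R b)" lborel borel f]
        by (simp add: lborel_distr_plus add.commute)
      show "(LINT x|lborel. f (x + s n *\<^sub>R b)) = (LINT x|lborel. f x)"
        using integral_distr[of "(+) (s n *\<^sub>R b)" lborel borel f]
        by (simp add: lborel_distr_plus add.commute)
    qed
    show ?thesis unfolding q_def
      by (simp add: Bochner_Integration.integral_diff[OF shift(1) int_f] shift(2))
  qed
  have "(\<lambda>n. LINT x|lborel. q n x) \<longlonglongrightarrow> (LINT x|lborel. ?d x)"
  proof (rule integral_dominated_convergence[where w =
      "\<lambda>x. C * indicator (cball 0 (R + norm b)) x"])
    show "?d \<in> borel_measurable lborel"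
      using borel_measurable_continuous_onI[OF cont] by simp
    have "continuous_on UNIV (q n)" for n
      unfolding q_def using s[of n]
      by (auto intro!: continuous_intros continuous_on_compose2[OF cf])
    then show "q n \<in> borel_measurable lborel" for n
      using borel_measurable_continuous_onI by auto
    show "integrable lborel (\<lambda>x. C * indicator (cball 0 (R + norm b)) x :: real)"
      by (intro integrable_mult_right integrable_real_indicator)
        (simp_all add: emeasure_bounded_finite[simplified])
    show "AE x in lborel. (\<lambda>n. q n x) \<longlonglongrightarrow> ?d x"
    proof (rule AE_I2)
      fix x
      have "s \<longlonglongrightarrow> 0" unfolding s_def by (rule LIMSEQ_inverse_real_of_nat)
      then have "filterlim s (at 0) sequentially"
        using less_imp_neq[OF s(1)] by (intro filterlim_atI always_eventually allI) (assumption,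
            metis)
      moreover have "((\<lambda>h. (f (x + h *\<^sub>R b) - f x) / h) \<longlongrightarrow> ?d x) (at 0)"
        using dir_deriv_line[OF diff, of x b 0] by (simp add: DERIV_def)
      ultimately show "(\<lambda>n. q n x) \<longlonglongrightarrow> ?d x"
        unfolding q_def by (rule filterlim_compose[rotated])
    qed
    show "AE x in lborel. norm (q n x) \<le> C * indicator (cball 0 (R + norm b)) x" for n
    proof (rule AE_I2)
      fix x
      have "\<bar>q n x\<bar> \<le> C"
      proof -
        have "\<exists>z. 0 < z \<and> z < s n \<and>
            f (x + s n *\<^sub>R b) - f (x + 0 *\<^sub>R b) = (s n - 0) * ?d (x + z *\<^sub>R b)"
          by (rule MVT2) (use s dir_deriv_line[OF diff] in auto)
        then obtain z where "f (x + s n *\<^sub>R b) - f x = s n * ?d (x + z *\<^sub>R b)" by auto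
        then have "q n x = ?d (x + z *\<^sub>R b)" using s(1)[of n] by (simp add: q_def)
        then show ?thesis using C by simp
      qed
      moreover have "q n x = 0" if "norm x > R + norm b"
      proof -
        have "norm (s n *\<^sub>R b) \<le> norm b"
          using s[of n] by (simp add: mult_left_le_one_le)
        then have "norm (x + s n *\<^sub>R b) > R" using that norm_diff_ineq[of x "s n *\<^sub>R b"] by linarith
        moreover have "norm x > R" using that norm_ge_zero[of b] by linarith
        ultimately have "x \<notin> K" "x + s n *\<^sub>R b \<notin> K" using R by force+
        then show ?thesis using K(2) by (simp add: q_def)
      qed
      moreover have "C \<ge> 0" using C[of 0] by linarith
      ultimately show "norm (q n x) \<le> C * indicator (cball 0 (R + norm b)) x"
        by (auto simp: indicator_def)
    qed
  qed
  then show ?thesis by (simp add: q0 LIMSEQ_const_iff)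
qed

lemma test_functionD:
  assumes "\<phi> \<in> test_functions U"
  shows "Ck k \<phi>" "\<phi> differentiable at x" "continuous_on UNIV \<phi>"
    "b \<in> Basis \<Longrightarrow> continuous_on UNIV (dir_deriv b \<phi>)"
    "b \<in> Basis \<Longrightarrow> dir_deriv b \<phi> \<in> test_functions U"
proof -
  let ?K = "closure {x. \<phi> x \<noteq> 0}"
  have Ck: "Ck k \<phi>" for k using assms by (simp add: test_functions_def)
  show "Ck k \<phi>" by (rule Ck)
  show "\<phi> differentiable at x" using Ck[of "Suc 0"] by simp
  show "continuous_on UNIV \<phi>" using Ck[of 0] by simp
  show "b \<in> Basis \<Longrightarrow> continuous_on UNIV (dir_deriv b \<phi>)" using Ck[of "Suc 0"] by simp
  have K: "compact ?K" "?K \<subseteq> U" using assms by (auto simp: test_functions_def)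
  have "\<phi> x = 0" if "x \<notin> ?K" for x
    using that closure_subset[of "{x. \<phi> x \<noteq> 0}"] by auto
  then have "dir_deriv b \<phi> x = 0" if "x \<notin> ?K" for x b
    by (rule dir_deriv_outside[OF closed_closure _ that])
  then have sub: "closure {x. dir_deriv b \<phi> x \<noteq> 0} \<subseteq> ?K" for b
    by (intro closure_minimal) auto
  have Ck': "b \<in> Basis \<Longrightarrow> Ck k (dir_deriv b \<phi>)" for k b using Ck[of "Suc k"] by simp
  show "b \<in> Basis \<Longrightarrow> dir_deriv b \<phi> \<in> test_functions U"
  proof -
    assume b: "b \<in> Basis"
    have "closure {x. dir_deriv b \<phi> x \<noteq> 0} = ?K \<inter> closure {x. dir_deriv b \<phi> x \<noteq> 0}"
      using sub by blast
    then have "compact (closure {x. dir_deriv b \<phi> x \<noteq> 0})"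
      using compact_Int_closed[OF K(1) closed_closure] by metis
    then show ?thesis
      unfolding test_functions_def using Ck'[OF b] order_trans[OF sub K(2)] by blast
  qed
qed

lemma test_function_support:
  assumes "\<phi> \<in> test_functions U"
  obtains K where "compact K" "K \<subseteq> U" "\<And>x. x \<notin> K \<Longrightarrow> \<phi> x = 0"
proof
  show "compact (closure {x. \<phi> x \<noteq> 0})" "closure {x. \<phi> x \<noteq> 0} \<subseteq> U"
    using assms by (auto simp: test_functions_def)
  show "\<phi> x = 0" if "x \<notin> closure {x. \<phi> x \<noteq> 0}" for x
    using that closure_subset[of "{x. \<phi> x \<noteq> 0}"] by auto
qed

lemma regular_distr_eq_lborel:
  assumes "open U" "\<phi> \<in> test_functions U" "F \<in> borel_measurable borel"
  shows "regular_distr U F \<phi> = (LINT x|lborel. F x * \<phi> x)"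
proof -
  have [measurable]: "\<phi> \<in> borel_measurable borel" "F \<in> borel_measurable borel"
    using test_functionD(3)[OF assms(2)] assms(3) by (auto intro: borel_measurable_continuous_onI)
  obtain K where K: "K \<subseteq> U" "\<And>x. x \<notin> K \<Longrightarrow> \<phi> x = 0"
    using test_function_support[OF assms(2)] by metis
  have "regular_distr U F \<phi> = (LINT x|lebesgue. indicator U x *\<^sub>R (F x * \<phi> x))"
    unfolding regular_distr_def using assms(1) by (subst integral_restrict_space) auto
  also have "\<dots> = (LINT x|lebesgue. F x * \<phi> x)"
    by (rule Bochner_Integration.integral_cong)
      (use K in \<open>auto simp: indicator_def\<close>)
  also have "\<dots> = (LINT x|lborel. F x * \<phi> x)"
    by (rule integral_completion) auto
  finally show ?thesis .
qed

lemma integrable_mult_test_function: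
  assumes "\<phi> \<in> test_functions U" "continuous_on UNIV F"
  shows "integrable lborel (\<lambda>x. F x * \<phi> x)"
proof -
  obtain K where K: "compact K" "\<And>x. x \<notin> K \<Longrightarrow> \<phi> x = 0"
    using test_function_support[OF assms(1)] by metis
  have "continuous_on UNIV (\<lambda>x. F x * \<phi> x)"
    using test_functionD(3)[OF assms(1)] assms(2) by (rule continuous_on_mult[rotated])
  then show ?thesis by (rule integrable_compact_support[OF _ K(1)]) (simp add: K(2))
qed

text \<open>The product of \<open>F\<close> with a test function has compact support, and its derivative integrates to
  zero.\<close>

lemma distr_deriv_C1:
  assumes "open U" "\<phi> \<in> test_functions U" "b \<in> Basis" "Ck 1 F"
  shows "distr_deriv b (regular_distr U F) \<phi> = regular_distr U (dir_deriv b F) \<phi>"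
proof -
  note \<phi> = test_functionD[OF assms(2)]
  have F: "\<And>x. F differentiable at x" "continuous_on UNIV (dir_deriv b F)"
    using assms(3,4) by (auto simp: Ck_1_iff)
  then have cF: "continuous_on UNIV F"
    by (simp add: continuous_at_imp_continuous_on differentiable_imp_continuous_within)
  obtain K where K: "compact K" "\<And>x. x \<notin> K \<Longrightarrow> \<phi> x = 0"
    using test_function_support[OF assms(2)] by metis
  have dm: "dir_deriv b (\<lambda>x. F x * \<phi> x) = (\<lambda>x. F x * dir_deriv b \<phi> x + dir_deriv b F x * \<phi> x)"
    using dir_deriv_mult F(1) \<phi>(2) by blast
  have "(LINT x|lborel. dir_deriv b (\<lambda>x. F x * \<phi> x) x) = 0"
  proof (rule integral_dir_deriv_eq_0[OF _ _ K(1)])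
    show "(\<lambda>x. F x * \<phi> x) differentiable at x" for x using F(1) \<phi>(2) by simp
    show "continuous_on UNIV (dir_deriv b (\<lambda>x. F x * \<phi> x))"
      unfolding dm using F(2) cF \<phi>(3) \<phi>(4)[OF assms(3)] by (intro continuous_intros)
  qed (use K(2) in simp)
  moreover have "integrable lborel (\<lambda>x. F x * dir_deriv b \<phi> x)"
    "integrable lborel (\<lambda>x. dir_deriv b F x * \<phi> x)"
    using integrable_mult_test_function[OF \<phi>(5)[OF assms(3)] cF]
      integrable_mult_test_function[OF assms(2) F(2)] by auto
  ultimately have "- (LINT x|lborel. F x * dir_deriv b \<phi> x) =
      (LINT x|lborel. dir_deriv b F x * \<phi> x)"
    by (simp add: dm)
  then show ?thesis
    unfolding distr_deriv_def
    using regular_distr_eq_lborel[OF assms(1) assms(2), of "dir_deriv b F"]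
      regular_distr_eq_lborel[OF assms(1) \<phi>(5)[OF assms(3)], of F] F(2) cF
    by (simp add: borel_measurable_continuous_onI)
qed

section \<open>The fundamental lemma of the calculus of variations\<close>

definition box_bump :: "'a::euclidean_space \<Rightarrow> 'a \<Rightarrow> 'a \<Rightarrow> real" where
  "box_bump a b x = (\<Prod>i\<in>Basis. flat_exp 0 (x \<bullet> i + - (a \<bullet> i)) * flat_exp 0 (x \<bullet> - i + b \<bullet> i))"

lemma flat_exp_0_nonneg: "flat_exp 0 t \<ge> 0"
  by (simp add: flat_exp_def)

lemma box_bump_smooth: "box_bump a b \<in> smooth_alg"
  unfolding box_bump_def[abs_def] by (intro smooth_alg_prod smooth_alg.mult smooth_alg.flat)

lemma box_bump_nonneg: "box_bump a b x \<ge> 0"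
  by (auto simp: box_bump_def intro!: prod_nonneg mult_nonneg_nonneg flat_exp_0_nonneg)

lemma box_bump_eq_0_iff: "box_bump a b x = 0 \<longleftrightarrow> x \<notin> box a b"
proof -
  have "flat_exp 0 (x \<bullet> i + - (a \<bullet> i)) * flat_exp 0 (x \<bullet> - i + b \<bullet> i) = 0 \<longleftrightarrow>
      \<not> (a \<bullet> i < x \<bullet> i \<and> x \<bullet> i < b \<bullet> i)" for i
    by (auto simp: flat_exp_def)
  then show ?thesis by (simp add: box_bump_def mem_box)
qed

text \<open>Composing a bump that is positive exactly on the box with \<open>1 - exp (- n y)\<close> gives test
  functions that increase to the indicator of the box as \<open>n\<close> grows.\<close>

lemma box_indicator_approx_test_function:
  assumes "cbox a b \<subseteq> U"
  shows "(\<lambda>x. 1 - exp (- (real n * box_bump a b x))) \<in> test_functions U"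
proof -
  let ?f = "\<lambda>x. 1 - exp (- (real n * box_bump a b x))"
  have "?f \<in> smooth_alg"
    by (intro smooth_alg_diff smooth_alg.const smooth_alg.exp smooth_alg_uminus smooth_alg.mult
        box_bump_smooth)
  moreover have "{x. ?f x \<noteq> 0} \<subseteq> box a b"
    using box_bump_eq_0_iff[of a b] by auto
  then have "closure {x. ?f x \<noteq> 0} \<subseteq> cbox a b"
    by (meson box_subset_cbox closed_cbox closure_minimal order_trans)
  moreover from this have "compact (closure {x. ?f x \<noteq> 0})"
    by (meson bounded_cbox bounded_subset closed_closure compact_eq_bounded_closed)
  ultimately show ?thesis using assms by (auto simp: test_functions_def smooth_alg_Ck)
qed

lemma integral_box_eq_0_if_orthogonal_test_functions:
  fixes U :: "'a::euclidean_space set"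
  assumes U: "open U" and int: "integrable (lebesgue_on U) w"
    and orth: "\<And>\<phi>. \<phi> \<in> test_functions U \<Longrightarrow> regular_distr U w \<phi> = 0"
    and box: "cbox a b \<subseteq> U"
  shows "(LINT x|lebesgue_on U. indicator (box a b) x * w x) = 0"
proof -
  let ?f = "\<lambda>n x. 1 - exp (- (real n * box_bump a b x))"
  have t: "?f n \<in> test_functions U" for n by (rule box_indicator_approx_test_function[OF box])
  have [measurable]: "w \<in> borel_measurable (lebesgue_on U)" using int by auto
  have fm[measurable]: "?f n \<in> borel_measurable (lebesgue_on U)" for n
    using test_functionD(3)[OF t, of n]
    by (intro measurable_restrict_space1 measurable_completion) (auto intro:
        borel_measurable_continuous_onI)
  have [measurable]: "box a b \<in> sets (lebesgue_on U)"
    using box box_subset_cbox[of a b] U by (subst sets_restrict_space_iff) auto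
  have "(\<lambda>n. LINT x|lebesgue_on U. w x * ?f n x)
      \<longlonglongrightarrow> (LINT x|lebesgue_on U. indicator (box a b) x * w x)"
  proof (rule integral_dominated_convergence[where w = "\<lambda>x. \<bar>w x\<bar>"])
    show "AE x in lebesgue_on U. (\<lambda>n. w x * ?f n x) \<longlonglongrightarrow> indicator (box a b) x * w x"
    proof (rule AE_I2)
      fix x
      have "(\<lambda>n. ?f n x) \<longlonglongrightarrow> indicator (box a b) x"
      proof (cases "x \<in> box a b")
        case True
        then have "box_bump a b x > 0"
          using box_bump_eq_0_iff[of a b x] box_bump_nonneg[of a b x] by force
        then have "(\<lambda>n. exp (- (real n * box_bump a b x))) \<longlonglongrightarrow> 0"
          by (intro filterlim_compose[OF exp_at_bot] filterlim_uminus_at_top[THEN iffD1]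
              filterlim_at_top_mult_tendsto_pos[OF tendsto_const] filterlim_real_sequentially)
        from tendsto_diff[OF tendsto_const[of 1] this] show ?thesis using True by simp
      next
        case False
        then show ?thesis using box_bump_eq_0_iff[of a b x] by simp
      qed
      from tendsto_mult[OF tendsto_const[of "w x"] this]
      show "(\<lambda>n. w x * ?f n x) \<longlonglongrightarrow> indicator (box a b) x * w x"
        by (simp add: mult.commute)
    qed
    show "AE x in lebesgue_on U. norm (w x * ?f n x) \<le> \<bar>w x\<bar>" for n
    proof (rule AE_I2)
      fix x
      have "real n * box_bump a b x \<ge> 0" using box_bump_nonneg[of a b x] by simp
      then have "\<bar>?f n x\<bar> \<le> 1" by (simp add: abs_le_iff order_trans[OF _ exp_ge_zero])
      then show "norm (w x * ?f n x) \<le> \<bar>w x\<bar>" by (simp add: abs_mult mult_left_le)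
    qed
    show "integrable (lebesgue_on U) (\<lambda>x. \<bar>w x\<bar>)" using int by simp
    show "(\<lambda>x. indicator (box a b) x * w x) \<in> borel_measurable (lebesgue_on U)" by measurable
    show "(\<lambda>x. w x * ?f n x) \<in> borel_measurable (lebesgue_on U)" for n
      using fm[of n] by measurable
  qed
  moreover have "(LINT x|lebesgue_on U. w x * ?f n x) = 0" for n
    using orth[OF t] by (simp add: regular_distr_def)
  ultimately show ?thesis by (simp add: LIMSEQ_const_iff)
qed

text \<open>Boxes are stable under intersection and generate the Borel sets, so the integral of \<open>w\<close>
  vanishes over every Borel set, in particular where \<open>w\<close> is positive and where it is negative.\<close>

lemma AE_eq_0_if_integral_box_eq_0:
  fixes w :: "'a::euclidean_space \<Rightarrow> real"
  assumes int: "integrable lebesgue w"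
    and 0: "\<And>c d. (LINT x|lebesgue. indicator (box c d) x * w x) = 0"
  shows "AE x in lebesgue. w x = 0"
proof -
  have ind: "integrable lebesgue (\<lambda>x. indicator A x * w x)" if "A \<in> sets borel" for A
    using integrable_mult_indicator[of A lebesgue w] int that by simp
  have all: "(LINT x|lebesgue. indicator A x * w x) = 0" if "A \<in> sets borel" for A
  proof -
    have "Int_stable (range (\<lambda>(a, b). box a b :: 'a set))"
      by (auto simp: Int_stable_def box_Int_box)
    moreover have "range (\<lambda>(a, b). box a b :: 'a set) \<subseteq> Pow UNIV" by simp
    moreover have "A \<in> sigma_sets UNIV (range (\<lambda>(a, b). box a b :: 'a set))"
      using that unfolding borel_eq_box by simp
    ultimately show ?thesis
    proof (induction rule: sigma_sets_induct_disjoint)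
      case (basic A)
      then show ?case using 0 by auto
    next
      case empty
      then show ?case by simp
    next
      case (compl A)
      then have A: "A \<in> sets borel" by (simp add: borel_eq_box)
      have U: "(LINT x|lebesgue. w x) = 0"
      proof -
        have "(\<lambda>n. LINT x|lebesgue. indicator (box (- (real n *\<^sub>R One)) (real n *\<^sub>R One)) x * w x)
            \<longlonglongrightarrow> (LINT x|lebesgue. w x)"
        proof (rule integral_dominated_convergence[where w = "\<lambda>x. \<bar>w x\<bar>"])
          show "AE x in lebesgue.
              (\<lambda>n. indicator (box (- (real n *\<^sub>R One)) (real n *\<^sub>R One)) x * w x) \<longlonglongrightarrow> w x"
          proof (rule AE_I2)
            fix x :: 'a
            obtain m where m: "x \<in> box (- (real m *\<^sub>R One)) (real m *\<^sub>R One)"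
              using UN_box_eq_UNIV[where 'a='a] by auto
            have "x \<in> box (- (real n *\<^sub>R One)) (real n *\<^sub>R One)" if "m \<le> n" for n
              using m that by (force simp: mem_box)
            then have "\<forall>\<^sub>F n in sequentially.
                w x = indicator (box (- (real n *\<^sub>R One)) (real n *\<^sub>R One)) x * w x"
              by (auto simp: eventually_sequentially indicator_def)
            then show "(\<lambda>n. indicator (box (- (real n *\<^sub>R One)) (real n *\<^sub>R One)) x * w x)
                \<longlonglongrightarrow> w x"
              by (rule Lim_transform_eventually[OF tendsto_const])
          qed
        qed (use int ind in \<open>auto simp: indicator_def\<close>)
        then show ?thesis by (simp add: 0 LIMSEQ_const_iff)
      qed
      have "(LINT x|lebesgue. indicator (UNIV - A) x * w x) =
          (LINT x|lebesgue. w x - indicator A x * w x)"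
        by (rule Bochner_Integration.integral_cong) (auto simp: indicator_def)
      also have "\<dots> = 0" using int ind[OF A] U compl by simp
      finally show ?case .
    next
      case (union F)
      then have F: "F i \<in> sets borel" for i by (simp add: borel_eq_box image_subset_iff)
      have UF: "(\<Union>i. F i) \<in> sets borel" using F by auto
      have "(LINT x|lebesgue. indicator (\<Union>i. F i) x * w x) = (LINT x:(\<Union>i. F i)|lebesgue. w x)"
        by (simp add: set_lebesgue_integral_def)
      also have "\<dots> = (\<Sum>i. LINT x:(F i)|lebesgue. w x)"
      proof (rule lebesgue_integral_countable_add)
        show "F i \<in> sets lebesgue" for i using F by simp
        show "F i \<inter> F j = {}" if "i \<noteq> j" for i j
          using union.hyps that by (auto simp: disjoint_family_on_def)
        show "set_integrable lebesgue (\<Union>i. F i) w"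
          using ind[OF UF] by (simp add: set_integrable_def)
      qed
      also have "\<dots> = 0" using union.IH by (simp add: set_lebesgue_integral_def)
      finally show ?case .
    qed
  qed
  obtain v where v: "v \<in> borel_measurable lborel" "AE x in lborel. w x = v x"
    using completion_ex_borel_measurable_real[of w lborel] int by blast
  have wv: "AE x in lebesgue. w x = v x" using v(2) by (rule AE_completion)
  have [measurable]: "v \<in> borel_measurable borel" using v(1) by simp
  have "integrable lebesgue v"
    using v(1) wv by (intro integrable_cong_AE_imp[OF int measurable_completion]) (auto simp:
        eq_commute)
  then have iv: "integrable lborel v" by (simp add: integrable_completion)
  have v0: "(LINT x|lborel. indicator A x * v x) = 0" if [measurable]: "A \<in> sets borel" for A
  proof -
    have "(LINT x|lborel. indicator A x * v x) = (LINT x|lebesgue. indicator A x * v x)"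
      by (rule integral_completion[symmetric]) simp
    also have "\<dots> = (LINT x|lebesgue. indicator A x * w x)"
    proof (rule integral_cong_AE)
      show "(\<lambda>x. indicator A x * v x) \<in> borel_measurable lebesgue"
        by (rule measurable_completion) simp
      show "(\<lambda>x. indicator A x * w x) \<in> borel_measurable lebesgue"
        using ind[OF that] by (rule borel_measurable_integrable)
      show "AE x in lebesgue. indicator A x * v x = indicator A x * w x"
        using wv by eventually_elim simp
    qed
    finally show ?thesis using all[OF that] by simp
  qed
  have iv': "integrable lborel (\<lambda>x. indicator A x * v x)" if "A \<in> sets borel" for A
    using integrable_mult_indicator[of A lborel v] iv that by simp
  have "AE x in lborel. indicator {x. v x > 0} x * v x = 0"
    using v0[of "{x. v x > 0}"] iv'[of "{x. v x > 0}"]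
    by (subst integral_nonneg_eq_0_iff_AE[symmetric]) (auto simp: indicator_def)
  moreover have "AE x in lborel. - (indicator {x. v x < 0} x * v x) = 0"
    using v0[of "{x. v x < 0}"] iv'[of "{x. v x < 0}"]
    by (subst integral_nonneg_eq_0_iff_AE[symmetric]) (auto simp: indicator_def)
  ultimately have "AE x in lborel. v x = 0"
    by eventually_elim (auto simp: indicator_def split: if_splits)
  then have "AE x in lebesgue. v x = 0" by (rule AE_completion)
  with wv show ?thesis by eventually_elim simp
qed

text \<open>The set \<open>U\<close> is a countable union of closed boxes, and on each of them the previous lemma
  applies: indicators of smaller boxes are limits of test functions.\<close>

lemma AE_eq_0_if_orthogonal_test_functions:
  fixes U :: "'a::euclidean_space set"
  assumes U: "open U" and int: "integrable (lebesgue_on U) w"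
    and orth: "\<And>\<phi>. \<phi> \<in> test_functions U \<Longrightarrow> regular_distr U w \<phi> = 0"
  shows "AE x in lebesgue_on U. w x = 0"
proof -
  have Um: "U \<inter> space lebesgue \<in> sets lebesgue" using U by auto
  have int': "integrable lebesgue (\<lambda>x. indicator U x * w x)"
    using int integrable_restrict_space[OF Um, of w] by simp
  have local: "AE x in lebesgue. x \<in> cbox a b \<longrightarrow> w x = 0" if ab: "cbox a b \<subseteq> U" for a b
  proof -
    have sub: "box a b \<subseteq> U" using ab box_subset_cbox by blast
    have "AE x in lebesgue. indicator (box a b) x * (indicator U x * w x) = 0"
    proof (rule AE_eq_0_if_integral_box_eq_0)
      show "integrable lebesgue (\<lambda>x. indicator (box a b) x * (indicator U x * w x))"
        using integrable_mult_indicator[of "box a b" lebesgue "\<lambda>x. indicator U x *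
            w x"] int' by simp
      fix c d :: 'a
      obtain c' d' where c'd': "box c d \<inter> box a b = box c' d'" using box_Int_box by blast
      have "\<exists>p q. box c d \<inter> box a b = box p q \<and> cbox p q \<subseteq> U"
      proof (cases "box c d \<inter> box a b = {}")
        case True
        obtain i :: 'a where "i \<in> Basis" using nonempty_Basis by blast
        then have "box One 0 = ({} :: 'a set)" "cbox One 0 = ({} :: 'a set)"
          unfolding box_eq_empty by (auto intro!: bexI[of _ i])
        with True show ?thesis by (intro exI[of _ One] exI[of _ 0]) simp
      next
        case False
        then have "cbox c' d' = closure (box c' d')" using c'd' by (simp add: closure_box)
        also have "\<dots> \<subseteq> closure (box a b)" by (rule closure_mono) (use c'd' in blast)
        also have "\<dots> \<subseteq> cbox a b" by (intro closure_minimal box_subset_cbox closed_cbox)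
        finally show ?thesis using ab c'd' by blast
      qed
      then obtain p q where pq: "box c d \<inter> box a b = box p q" "cbox p q \<subseteq> U" by blast
      have "(LINT x|lebesgue. indicator (box c d) x * (indicator (box a b) x * (indicator U x *
          w x)))
          = (LINT x|lebesgue. indicator U x *\<^sub>R (indicator (box p q) x * w x))"
        unfolding pq(1)[symmetric]
        by (rule Bochner_Integration.integral_cong) (auto simp: indicator_def)
      also have "\<dots> = (LINT x|lebesgue_on U. indicator (box p q) x * w x)"
        by (rule integral_restrict_space[OF Um, symmetric])
      also have "\<dots> = 0"
        using integral_box_eq_0_if_orthogonal_test_functions[OF U int orth pq(2)] by simp
      finally show "(LINT x|lebesgue. indicator (box c d) x *
          (indicator (box a b) x * (indicator U x * w x))) = 0" .
    qed
    moreover have "AE x in lebesgue. x \<notin> cbox a b - box a b"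
      using negligible_frontier_interval[of a b] by (intro AE_not_in) (simp add:
          negligible_iff_null_sets)
    ultimately show ?thesis
      by eventually_elim (use sub in \<open>auto simp: indicator_def split: if_splits\<close>)
  qed
  obtain D where D: "countable D" "D \<subseteq> Pow U" "\<And>X. X \<in> D \<Longrightarrow> \<exists>a b. X = cbox a b"
      "\<Union>D = U"
    using open_countable_Union_open_cbox[OF U] by auto
  have "AE x in lebesgue. \<forall>X\<in>D. x \<in> X \<longrightarrow> w x = 0"
  proof (subst AE_ball_countable[OF D(1)], intro ballI)
    fix X assume "X \<in> D"
    with D(2,3) obtain a b where "X = cbox a b" "cbox a b \<subseteq> U" by blast
    with local[of a b] show "AE x in lebesgue. x \<in> X \<longrightarrow> w x = 0" by simp
  qed
  then have "AE x in lebesgue. x \<in> U \<longrightarrow> w x = 0"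
    by eventually_elim (use D(4) in blast)
  then show ?thesis using Um by (subst AE_restrict_space_iff) auto
qed

section \<open>Square-integrable functions\<close>

lemma space_L2_mult_integrable:
  assumes "f \<in> space_L2 M" "g \<in> space_L2 M"
  shows "integrable M (\<lambda>x. f x * g x)"
proof (rule Bochner_Integration.integrable_bound)
  show "integrable M (\<lambda>x. (f x)\<^sup>2 + (g x)\<^sup>2)"
    using assms by (auto simp: space_L2_def)
  show "(\<lambda>x. f x * g x) \<in> borel_measurable M"
    using assms by (auto simp: space_L2_def)
  show "AE x in M. norm (f x * g x) \<le> norm ((f x)\<^sup>2 + (g x)\<^sup>2)"
  proof (rule AE_I2)
    fix x
    have "2 * (\<bar>f x\<bar> * \<bar>g x\<bar>) \<le> \<bar>f x\<bar>\<^sup>2 + \<bar>g x\<bar>\<^sup>2"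
      using sum_squares_bound[of "\<bar>f x\<bar>" "\<bar>g x\<bar>"] by (simp add: mult.assoc)
    moreover have "0 \<le> \<bar>f x\<bar> * \<bar>g x\<bar>" by simp
    ultimately have "\<bar>f x\<bar> * \<bar>g x\<bar> \<le> (f x)\<^sup>2 + (g x)\<^sup>2"
      unfolding power2_abs by linarith
    then show "norm (f x * g x) \<le> norm ((f x)\<^sup>2 + (g x)\<^sup>2)"
      by (simp add: abs_mult)
  qed
qed

lemma space_L2_add:
  assumes "f \<in> space_L2 M" "g \<in> space_L2 M"
  shows "(\<lambda>x. f x + g x) \<in> space_L2 M"
proof -
  have "integrable M (\<lambda>x. (f x)\<^sup>2 + (g x)\<^sup>2 + 2 * (f x * g x))"
    using assms space_L2_mult_integrable[OF assms] by (auto simp: space_L2_def)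
  also have "(\<lambda>x. (f x)\<^sup>2 + (g x)\<^sup>2 + 2 * (f x * g x)) = (\<lambda>x. (f x + g x)\<^sup>2)"
    by (simp add: power2_sum mult.assoc)
  finally show ?thesis using assms by (auto simp: space_L2_def)
qed

lemma space_L2_cmult: "f \<in> space_L2 M \<Longrightarrow> (\<lambda>x. c * f x) \<in> space_L2 M"
  by (auto simp: space_L2_def power_mult_distrib)

lemma space_L2_diff:
  "f \<in> space_L2 M \<Longrightarrow> g \<in> space_L2 M \<Longrightarrow> (\<lambda>x. f x - g x) \<in> space_L2 M"
  using space_L2_add[OF _ space_L2_cmult[of g M "-1"]] by fastforce

lemma space_L2_0: "(\<lambda>x. 0) \<in> space_L2 M"
  by (simp add: space_L2_def)

lemma space_L2_sum:
  "(\<And>i. i \<in> A \<Longrightarrow> f i \<in> space_L2 M) \<Longrightarrow> (\<lambda>x. \<Sum>i\<in>A. f i x) \<in> space_L2 M"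
  by (induction A rule: infinite_finite_induct) (auto intro: space_L2_add space_L2_0)

lemma norm_L2_nonneg [simp]: "norm_L2 M f \<ge> 0"
  by (simp add: norm_L2_def)

lemma norm_L2_power2: "(norm_L2 M f)\<^sup>2 = (LINT x|M. (f x)\<^sup>2)"
  by (simp add: norm_L2_def)

lemma norm_L2_cmult: "norm_L2 M (\<lambda>x. c * f x) = \<bar>c\<bar> * norm_L2 M f"
  by (simp add: norm_L2_def power_mult_distrib real_sqrt_mult)

lemma norm_L2_cong_AE:
  assumes "f \<in> borel_measurable M" "g \<in> borel_measurable M" "AE x in M. f x = g x"
  shows "norm_L2 M f = norm_L2 M g"
  unfolding norm_L2_def using assms
  by (intro arg_cong[of _ _ sqrt] integral_cong_AE) (auto elim: eventually_mono)

text \<open>The discriminant argument for the quadratic polynomial \<open>\<integral> (t f + g)\<^sup>2\<close> in \<open>t\<close>.\<close>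

lemma L2_Cauchy_Schwarz:
  assumes f: "f \<in> space_L2 M" and g: "g \<in> space_L2 M"
  shows "\<bar>LINT x|M. f x * g x\<bar> \<le> norm_L2 M f * norm_L2 M g"
proof -
  define A B C where "A = (LINT x|M. (f x)\<^sup>2)" and "B = (LINT x|M. (g x)\<^sup>2)"
    and "C = (LINT x|M. f x * g x)"
  have AB: "A \<ge> 0" "B \<ge> 0" by (auto simp: A_def B_def)
  have quad: "0 \<le> t\<^sup>2 * A + 2 * t * C + B" for t
  proof -
    have "0 \<le> (LINT x|M. (t * f x + g x)\<^sup>2)" by simp
    also have "(\<lambda>x. (t * f x + g x)\<^sup>2) = (\<lambda>x. t\<^sup>2 * (f x)\<^sup>2 + 2 * t * (f x * g x) + (g x)\<^sup>2)"
      by (auto simp: power2_eq_square algebra_simps)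
    also have "(LINT x|M. t\<^sup>2 * (f x)\<^sup>2 + 2 * t * (f x * g x) + (g x)\<^sup>2) = t\<^sup>2 * A + 2 * t * C + B"
      using f g space_L2_mult_integrable[OF f g] by (simp add: space_L2_def A_def B_def C_def)
    finally show ?thesis .
  qed
  have "C\<^sup>2 \<le> A * B"
  proof (cases "A = 0")
    case True
    have "C = 0"
    proof (rule ccontr)
      assume "C \<noteq> 0"
      then show False using quad[of "- (B + 1) / (2 * C)"] True by (simp add: field_simps)
    qed
    then show ?thesis using AB by simp
  next
    case False
    then have "A > 0" using AB by simp
    then show ?thesis using quad[of "- C / A"] by (simp add: field_simps power2_eq_square)
  qed
  then have "\<bar>C\<bar> \<le> sqrt (A * B)" by (metis real_sqrt_abs real_sqrt_le_mono)
  then show ?thesis by (simp add: A_def B_def C_def norm_L2_def real_sqrt_mult)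
qed

lemma norm_L2_triangle:
  assumes f: "f \<in> space_L2 M" and g: "g \<in> space_L2 M"
  shows "norm_L2 M (\<lambda>x. f x + g x) \<le> norm_L2 M f + norm_L2 M g"
proof (rule power2_le_imp_le)
  have "(norm_L2 M (\<lambda>x. f x + g x))\<^sup>2 = (LINT x|M. (f x)\<^sup>2 + (g x)\<^sup>2 + 2 * (f x * g x))"
    unfolding norm_L2_power2 by (simp add: power2_sum mult.assoc)
  also have "\<dots> = (norm_L2 M f)\<^sup>2 + (norm_L2 M g)\<^sup>2 + 2 * (LINT x|M. f x * g x)"
    using f g space_L2_mult_integrable[OF f g] by (simp add: space_L2_def norm_L2_power2)
  also have "\<dots> \<le> (norm_L2 M f + norm_L2 M g)\<^sup>2"
    using L2_Cauchy_Schwarz[OF f g] by (simp add: power2_sum)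
  finally show "(norm_L2 M (\<lambda>x. f x + g x))\<^sup>2 \<le> (norm_L2 M f + norm_L2 M g)\<^sup>2" .
qed simp

lemma norm_L2_sum:
  assumes "finite A" "\<And>i. i \<in> A \<Longrightarrow> f i \<in> space_L2 M"
  shows "norm_L2 M (\<lambda>x. \<Sum>i\<in>A. f i x) \<le> (\<Sum>i\<in>A. norm_L2 M (f i))"
  using assms
proof (induction A)
  case empty
  then show ?case by (simp add: norm_L2_def)
next
  case (insert i A)
  have "norm_L2 M (\<lambda>x. f i x + (\<Sum>i\<in>A. f i x)) \<le> norm_L2 M (f i) + norm_L2 M (\<lambda>x. \<Sum>i\<in>A. f i x)"
    using insert.prems by (intro norm_L2_triangle space_L2_sum) auto
  also have "\<dots> \<le> norm_L2 M (f i) + (\<Sum>i\<in>A. norm_L2 M (f i))"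
    using insert.IH insert.prems by auto
  finally show ?case using insert.hyps by simp
qed

lemma space_L2_bounded:
  assumes "finite_measure M" "f \<in> borel_measurable M" "\<And>x. x \<in> space M \<Longrightarrow> \<bar>f x\<bar> \<le> C"
  shows "f \<in> space_L2 M"
proof -
  have "integrable M (\<lambda>x. (f x)\<^sup>2)"
  proof (rule finite_measure.integrable_const_bound[OF assms(1), of _ "C\<^sup>2"])
    show "AE x in M. norm ((f x)\<^sup>2) \<le> C\<^sup>2"
      by (rule AE_I2) (use assms(3) in \<open>simp add: abs_le_square_iff[symmetric] order_trans[OF _
          abs_ge_self]\<close>)
  qed (use assms(2) in simp)
  then show ?thesis using assms(2) by (simp add: space_L2_def)
qed

lemma continuous_measurable_lebesgue_on:
  "continuous_on UNIV (f :: 'a::euclidean_space \<Rightarrow> real) \<Longrightarrow> f \<in> borel_measurable (lebesgue_on S)"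
  by (intro measurable_restrict_space1 measurable_completion) (auto intro:
      borel_measurable_continuous_onI)

lemma space_L2_continuous:
  fixes S :: "'a::euclidean_space set"
  assumes "continuous_on UNIV f" "bounded S" "S \<in> sets lebesgue"
  shows "f \<in> space_L2 (lebesgue_on S)"
proof -
  have "compact (f ` closure S)"
    using assms(1,2) by (intro compact_continuous_image) (auto intro: continuous_on_subset)
  then obtain C where "\<forall>x\<in>closure S. \<bar>f x\<bar> \<le> C"
    by (auto dest!: compact_imp_bounded simp: bounded_iff)
  then have "\<bar>f x\<bar> \<le> C" if "x \<in> S" for x
    using that closure_subset[of S] by auto
  moreover have "finite_measure (lebesgue_on S)"
    by (intro finite_measure_lebesgue_on bounded_set_imp_lmeasurable assms)
  ultimately show ?thesis
    using space_L2_bounded[OF _ continuous_measurable_lebesgue_on[OF assms(1)], of S C] by simp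
qed

lemma space_L2_integrable:
  assumes "finite_measure M" "f \<in> space_L2 M"
  shows "integrable M f"
proof -
  interpret finite_measure M by fact
  have "integrable M (\<lambda>x. f x * 1)"
    by (rule space_L2_mult_integrable[OF assms(2) space_L2_bounded[OF assms(1), of _ 1]]) auto
  then show ?thesis by simp
qed

lemma test_function_L2:
  assumes "\<phi> \<in> test_functions U" "U \<in> sets lebesgue"
  shows "\<phi> \<in> space_L2 (lebesgue_on U)"
proof -
  have \<phi>: "continuous_on UNIV \<phi>" using test_functionD[OF assms(1)] by blast
  have "integrable lborel (\<lambda>x. \<phi> x * \<phi> x)"
    using integrable_mult_test_function[OF assms(1) \<phi>] .
  then have "integrable lebesgue (\<lambda>x. indicator U x *\<^sub>R (\<phi> x)\<^sup>2)"
    using assms(2) by (intro integrable_mult_indicator) (auto simp: power2_eq_square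
        integrable_completion)
  then have "integrable (lebesgue_on U) (\<lambda>x. (\<phi> x)\<^sup>2)"
    using assms(2) by (subst integrable_restrict_space) auto
  then show ?thesis using continuous_measurable_lebesgue_on[OF \<phi>] by (simp add: space_L2_def)
qed

lemma regular_distr_add:
  assumes "u \<in> space_L2 (lebesgue_on U)" "w \<in> space_L2 (lebesgue_on U)" "\<phi> \<in> test_functions U"
    "U \<in> sets lebesgue"
  shows "regular_distr U (\<lambda>x. u x + w x) \<phi> = regular_distr U u \<phi> + regular_distr U w \<phi>"
  using space_L2_mult_integrable[OF assms(1) test_function_L2[OF assms(3,4)]]
    space_L2_mult_integrable[OF assms(2) test_function_L2[OF assms(3,4)]]
  by (simp add: regular_distr_def distrib_right)

lemma regular_distr_cmult: "regular_distr U (\<lambda>x. c * u x) \<phi> = c * regular_distr U u \<phi>"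
  by (simp add: regular_distr_def mult.assoc)

lemma regular_distr_diff:
  assumes "u \<in> space_L2 (lebesgue_on U)" "w \<in> space_L2 (lebesgue_on U)" "\<phi> \<in> test_functions U"
    "U \<in> sets lebesgue"
  shows "regular_distr U (\<lambda>x. u x - w x) \<phi> = regular_distr U u \<phi> - regular_distr U w \<phi>"
  using space_L2_mult_integrable[OF assms(1) test_function_L2[OF assms(3,4)]]
    space_L2_mult_integrable[OF assms(2) test_function_L2[OF assms(3,4)]]
  by (simp add: regular_distr_def left_diff_distrib)

lemma regular_distr_unique:
  assumes U: "open U" "bounded U" and w: "u \<in> space_L2 (lebesgue_on U)" "w \<in> space_L2 (lebesgue_on
      U)"
    and eq: "\<And>\<phi>. \<phi> \<in> test_functions U \<Longrightarrow> regular_distr U u \<phi> = regular_distr U w \<phi>"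
  shows "AE x in lebesgue_on U. u x = w x"
proof -
  have Um: "U \<in> sets lebesgue" using U(1) by simp
  have fin: "finite_measure (lebesgue_on U)"
    using U by (intro finite_measure_lebesgue_on) (auto intro: bounded_set_imp_lmeasurable)
  have "AE x in lebesgue_on U. u x - w x = 0"
  proof (rule AE_eq_0_if_orthogonal_test_functions[OF U(1)])
    show "integrable (lebesgue_on U) (\<lambda>x. u x - w x)"
      using fin w by (intro space_L2_integrable space_L2_diff)
    show "regular_distr U (\<lambda>x. u x - w x) \<phi> = 0" if "\<phi> \<in> test_functions U" for \<phi>
      using regular_distr_diff[OF w that Um] eq[OF that] by simp
  qed
  then show ?thesis by simp
qed

section \<open>Weak derivatives on the disc\<close>

lemma Omega_open: "open Omega" and Omega_bounded: "bounded Omega"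
  and Omega_measurable: "Omega \<in> sets lebesgue" "Omega \<in> sets borel"
  and finite_measure_Omega: "finite_measure (lebesgue_on Omega)"
  by (auto simp: Omega_def intro!: finite_measure_lebesgue_on lmeasurable_ball)

lemma axis_Basis [simp]: "axis i (1::real) \<in> Basis"
  by (rule axis_in_Basis_iff[THEN iffD2]) simp

lemma Ck_1_continuous: "Ck 1 F \<Longrightarrow> continuous_on UNIV F"
  using Ck_Suc_imp_Ck[of 0 F] by simp

lemma space_L2_Omega: "continuous_on UNIV F \<Longrightarrow> F \<in> space_L2 (lebesgue_on Omega)"
  by (intro space_L2_continuous Omega_bounded Omega_measurable)

text \<open>The property by which \<open>weak_deriv\<close> selects its value.\<close>

definition is_weak_deriv :: "2 \<Rightarrow> (real ^ 2 \<Rightarrow> real) \<Rightarrow> (real ^ 2 \<Rightarrow> real) \<Rightarrow> bool" where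
  "is_weak_deriv i u w \<longleftrightarrow> w \<in> space_L2 (lebesgue_on Omega) \<and>
     distr_eq Omega (distr_deriv (axis i 1) (regular_distr Omega u)) (regular_distr Omega w)"

lemma is_weak_deriv_unique:
  assumes "is_weak_deriv i u w" "is_weak_deriv i u w'"
  shows "AE x in lebesgue_on Omega. w x = w' x"
  using assms unfolding is_weak_deriv_def distr_eq_def
  by (intro regular_distr_unique[OF Omega_open Omega_bounded]) auto

lemma W12_iff: "u \<in> W12 \<longleftrightarrow> u \<in> space_L2 (lebesgue_on Omega) \<and> (\<forall>i. \<exists>w. is_weak_deriv i u w)"
  by (auto simp: W12_def distr_in_L2_def is_weak_deriv_def)

lemma weak_deriv: "u \<in> W12 \<Longrightarrow> is_weak_deriv i u (weak_deriv i u)"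
proof -
  assume "u \<in> W12"
  then have "\<exists>w. is_weak_deriv i u w" by (simp add: W12_iff)
  from someI_ex[OF this] show ?thesis
    by (simp only: weak_deriv_def is_weak_deriv_def)
qed

lemma is_weak_deriv_diff:
  assumes "is_weak_deriv i u w" "is_weak_deriv i u' w'"
    "u \<in> space_L2 (lebesgue_on Omega)" "u' \<in> space_L2 (lebesgue_on Omega)"
  shows "is_weak_deriv i (\<lambda>x. u x - u' x) (\<lambda>x. w x - w' x)"
proof -
  have "distr_deriv (axis i 1) (regular_distr Omega (\<lambda>x. u x - u' x)) \<phi> =
      regular_distr Omega (\<lambda>x. w x - w' x) \<phi>" if \<phi>: "\<phi> \<in> test_functions Omega" for \<phi>
  proof -
    have "w \<in> space_L2 (lebesgue_on Omega)" "w' \<in> space_L2 (lebesgue_on Omega)"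
      "regular_distr Omega w \<phi> = - regular_distr Omega u (dir_deriv (axis i 1) \<phi>)"
      "regular_distr Omega w' \<phi> = - regular_distr Omega u' (dir_deriv (axis i 1) \<phi>)"
      using assms(1,2) \<phi> by (auto simp: is_weak_deriv_def distr_eq_def distr_deriv_def)
    then show ?thesis
      by (simp add: distr_deriv_def regular_distr_diff[OF _ _ _ Omega_measurable(1)] \<phi> assms(3,4)
          test_functionD(5)[OF \<phi> axis_Basis])
  qed
  then show ?thesis
    using assms(1,2) by (auto simp: is_weak_deriv_def distr_eq_def intro: space_L2_diff)
qed

lemma is_weak_deriv_C1: "Ck 1 F \<Longrightarrow> is_weak_deriv i F (dir_deriv (axis i 1) F)"
  unfolding is_weak_deriv_def distr_eq_def
  using distr_deriv_C1[OF Omega_open _ axis_Basis, of _ F i]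
  by (auto intro!: space_L2_Omega)

lemma C1_W12: "Ck 1 F \<Longrightarrow> F \<in> W12"
  using is_weak_deriv_C1 space_L2_Omega[OF Ck_1_continuous] by (auto simp: W12_iff)

text \<open>Even here uniqueness of weak derivatives is needed: the norm is defined through some weak
  derivative of the zero function.\<close>

lemma norm_W12_0: "norm_W12 (\<lambda>x. 0) = 0"
proof -
  have "(\<lambda>x::real^2. 0) \<in> smooth_alg" by (rule smooth_alg.const)
  then have C1: "Ck 1 (\<lambda>x::real^2. 0)" by (rule smooth_alg_Ck)
  have "is_weak_deriv i (\<lambda>x. 0) (\<lambda>x. 0)" for i
    by (simp add: is_weak_deriv_def distr_eq_def distr_deriv_def regular_distr_def space_L2_0)
  then have "AE x in lebesgue_on Omega. weak_deriv i (\<lambda>x. 0) x = 0" for i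
    by (rule is_weak_deriv_unique[OF weak_deriv[OF C1_W12[OF C1]]])
  moreover have "weak_deriv i (\<lambda>x. 0) \<in> space_L2 (lebesgue_on Omega)" for i
    using weak_deriv[OF C1_W12[OF C1]] by (simp add: is_weak_deriv_def)
  ultimately have "norm_L2 (lebesgue_on Omega) (weak_deriv i (\<lambda>x. 0)) =
      norm_L2 (lebesgue_on Omega) (\<lambda>x. 0)" for i
    by (intro norm_L2_cong_AE) (auto simp: space_L2_def)
  then show ?thesis by (simp add: norm_W12_def norm_L2_def)
qed

lemma norm_L2_le_norm_W12: "norm_L2 (lebesgue_on Omega) u \<le> norm_W12 u"
  and norm_L2_weak_deriv_le_norm_W12: "norm_L2 (lebesgue_on Omega) (weak_deriv i u) \<le> norm_W12 u"
proof -
  let ?S = "\<Sum>i\<in>UNIV. (norm_L2 (lebesgue_on Omega) (weak_deriv i u))\<^sup>2"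
  have "?S \<ge> 0" by (intro sum_nonneg) simp
  then show "norm_L2 (lebesgue_on Omega) u \<le> norm_W12 u"
    unfolding norm_W12_def by (intro real_le_rsqrt) simp
  have "(norm_L2 (lebesgue_on Omega) (weak_deriv i u))\<^sup>2 \<le> ?S"
    by (rule member_le_sum) auto
  then show "norm_L2 (lebesgue_on Omega) (weak_deriv i u) \<le> norm_W12 u"
    unfolding norm_W12_def by (intro real_le_rsqrt) (simp add: add_increasing)
qed

section \<open>Polar coordinates and the radial divergence theorem\<close>

lemma norm_power2_vec2: "(norm (x :: real ^ 2))\<^sup>2 = (x $ 1)\<^sup>2 + (x $ 2)\<^sup>2"
  unfolding power2_norm_eq_inner inner_vec_def by (simp add: sum_2 power2_eq_square)

lemma vec2_measurable [measurable]:
  "(\<lambda>(a, b). vector [a, b] :: real ^ 2) \<in> borel \<rightarrow>\<^sub>M borel"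
proof -
  let ?T = "\<lambda>(a, b). vector [a, b] :: real ^ 2"
  have "?T = (\<lambda>p. \<chi> i. if i = 1 then fst p else snd p)"
    by (auto simp: vec_eq_iff forall_2)
  moreover have "continuous_on UNIV (\<lambda>p::real \<times> real. if i = 1 then fst p else snd p)" for i :: 2
    by (cases "i = 1") (auto intro!: continuous_intros)
  then have "continuous_on UNIV (\<lambda>p::real \<times> real. \<chi> i::2. if i = 1 then fst p else snd p)"
    by (rule continuous_on_vec_lambda)
  ultimately have "continuous_on UNIV ?T" by (simp only:)
  then show "?T \<in> borel_measurable borel"
    by (rule borel_measurable_continuous_onI)
qed

text \<open>Transfers integrals over the plane to iterated integrals.\<close>

lemma lborel_vec2: "distr lborel borel (\<lambda>(a, b). vector [a, b] :: real ^ 2) = lborel"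
proof (rule lborel_eqI[symmetric])
  let ?T = "\<lambda>(a, b). vector [a, b] :: real ^ 2"
  fix l u :: "real ^ 2"
  assume lu: "\<And>b. b \<in> Basis \<Longrightarrow> l \<bullet> b \<le> u \<bullet> b"
  have lu': "l $ i \<le> u $ i" for i
    using lu[of "axis i 1"] by (simp add: inner_axis)
  have "emeasure (distr lborel borel ?T) (box l u) = emeasure lborel (?T -` box l u)"
    by (subst emeasure_distr) auto
  also have "?T -` box l u = {l $ 1<..<u $ 1} \<times> {l $ 2<..<u $ 2}"
    by (auto simp: mem_box_cart forall_2)
  also have "emeasure lborel ({l $ 1<..<u $ 1} \<times> {l $ 2<..<u $ 2}) =
      emeasure lborel {l $ 1<..<u $ 1} * emeasure lborel {l $ 2<..<u $ 2}"
    by (subst lborel_prod[symmetric], subst lborel.emeasure_pair_measure_Times) auto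
  also have "\<dots> = ennreal ((u - l) $ 1 * (u - l) $ 2)"
    using lu' by (simp add: ennreal_mult)
  also have "(u - l) $ 1 * (u - l) $ 2 = (\<Prod>b\<in>Basis. (u - l) \<bullet> b)"
  proof -
    have B: "(Basis :: (real ^ 2) set) = {axis 1 1, axis 2 1}"
      by (auto simp: Basis_vec_def exhaust_2 UNIV_2)
    have "axis 1 (1::real) \<noteq> (axis 2 1 :: real ^ 2)" by (simp add: axis_eq_axis)
    then show ?thesis unfolding B by (simp add: inner_axis)
  qed
  finally show "emeasure (distr lborel borel ?T) (box l u) = (\<Prod>b\<in>Basis. (u - l) \<bullet> b)" .
qed simp

definition polar :: "real \<times> real \<Rightarrow> real ^ 2" where
  "polar p = vector [fst p * cos (snd p), fst p * sin (snd p)]"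

lemma polar_nth [simp]: "polar p $ 1 = fst p * cos (snd p)" "polar p $ 2 = fst p * sin (snd p)"
  by (simp_all add: polar_def)

lemma polar_scale: "polar (r, t) = r *\<^sub>R polar (1, t)"
  by (simp add: vec_eq_iff forall_2)

lemma norm_polar: "norm (polar p) = \<bar>fst p\<bar>"
proof -
  have "(norm (polar p))\<^sup>2 = (fst p)\<^sup>2 * ((cos (snd p))\<^sup>2 + (sin (snd p))\<^sup>2)"
    by (simp only: norm_power2_vec2 polar_nth power_mult_distrib distrib_left)
  also have "\<dots> = \<bar>fst p\<bar>\<^sup>2" by (simp only: cos_squared_eq) simp
  finally show ?thesis by (rule power2_eq_imp_eq) auto
qed

lemma polar_continuous: "continuous_on UNIV polar"
proof -
  have "polar = (\<lambda>p. \<chi> i. if i = 1 then fst p * cos (snd p) else fst p * sin (snd p))"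
    by (auto simp: vec_eq_iff forall_2)
  moreover have "continuous_on UNIV
      (\<lambda>p::real \<times> real. if i = 1 then fst p * cos (snd p) else fst p * sin (snd p))" for i :: 2
    by (cases "i = 1") (auto intro!: continuous_intros continuous_on_cos continuous_on_sin)
  then have "continuous_on UNIV (\<lambda>p::real \<times> real. \<chi> i::2.
      if i = 1 then fst p * cos (snd p) else fst p * sin (snd p))"
    by (rule continuous_on_vec_lambda)
  ultimately show ?thesis by (simp only:)
qed

lemma polar_bij:
  "bij_betw polar ({0<..1} \<times> {0..<2 * pi}) (cball 0 1 - {0})"
proof (rule bij_betwI')
  fix p q :: "real \<times> real"
  assume "p \<in> {0<..1} \<times> {0..<2 * pi}" "q \<in> {0<..1} \<times> {0..<2 * pi}"
  then obtain r s t u where pq: "p = (r, s)" "q = (t, u)" "0 < r" "0 < t"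
    "0 \<le> s" "s < 2 * pi" "0 \<le> u" "u < 2 * pi" by auto
  show "polar p = polar q \<longleftrightarrow> p = q"
  proof
    assume eq: "polar p = polar q"
    have "r = t" using arg_cong[OF eq, of norm] pq by (simp add: norm_polar)
    moreover have "cos s = cos u \<and> sin s = sin u"
      using arg_cong[OF eq, of "\<lambda>x. x $ 1"] arg_cong[OF eq, of "\<lambda>x. x $ 2"] pq \<open>r = t\<close> by simp
    then obtain n :: int where n: "s = u + 2 * pi * n"
      using sin_cos_eq_iff[of s u] by auto
    have "n = 0"
    proof (rule ccontr)
      assume "n \<noteq> 0"
      then consider "n \<ge> 1" | "n \<le> -1" by linarith
      then show False
      proof cases
        case 1
        then have "2 * pi * n \<ge> 2 * pi * 1" by (intro mult_left_mono) auto
        then show False using n pq by linarith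
      next
        case 2
        then have "2 * pi * n \<le> 2 * pi * - 1" by (intro mult_left_mono) auto
        then show False using n pq by linarith
      qed
    qed
    then have "s = u" using n by simp
    ultimately show "p = q" using pq by simp
  qed simp
next
  fix p :: "real \<times> real" assume "p \<in> {0<..1} \<times> {0..<2 * pi}"
  then show "polar p \<in> cball 0 1 - {0}" using norm_polar[of p] by auto
next
  fix x :: "real ^ 2" assume x: "x \<in> cball 0 1 - {0}"
  define r where "r = norm x"
  have r: "r > 0" "r \<le> 1" using x by (auto simp: r_def)
  have "(x $ 1 / r)\<^sup>2 + (x $ 2 / r)\<^sup>2 = 1"
    using r(1) unfolding power_divide add_divide_distrib[symmetric] norm_power2_vec2[symmetric]
        r_def
    by simp
  then obtain t where "0 \<le> t" "t < 2 * pi" "x $ 1 / r = cos t" "x $ 2 / r = sin t"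
    using sincos_total_2pi by metis
  then have "x = polar (r, t)" "(r, t) \<in> {0<..1} \<times> {0..<2 * pi}"
    using r by (auto simp: vec_eq_iff forall_2 field_simps)
  then show "\<exists>p\<in>{0<..1} \<times> {0..<2 * pi}. x = polar p" by blast
qed

lemma polar_has_derivative:
  "((\<lambda>y::real^2. polar (y $ 1, y $ 2)) has_derivative
     (\<lambda>h. vector [h $ 1 * cos (y $ 2) - y $ 1 * sin (y $ 2) * h $ 2,
                  h $ 1 * sin (y $ 2) + y $ 1 * cos (y $ 2) * h $ 2])) (at y within S)"
proof -
  have eq: "(\<lambda>y::real^2. polar (y $ 1, y $ 2)) =
      (\<lambda>y. (y $ 1 * cos (y $ 2)) *\<^sub>R axis 1 1 + (y $ 1 * sin (y $ 2)) *\<^sub>R axis 2 1)"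
    by (auto simp: vec_eq_iff forall_2 axis_def)
  have c: "((\<lambda>x. x $ i) has_derivative (\<lambda>h. h $ i)) (at y within S)" for i
    by (rule bounded_linear_imp_has_derivative[OF bounded_linear_vec_nth])
  show ?thesis
    unfolding eq
    by (rule c derivative_eq_intros refl)+
      (simp add: fun_eq_iff vec_eq_iff forall_2 axis_def algebra_simps)
qed

text \<open>The polar map is a bijection onto the closed disc without its centre, with Jacobian
  determinant \<open>r\<close>; the centre and the circle are null sets.\<close>

lemma integral_polar:
  fixes F :: "real ^ 2 \<Rightarrow> real"
  assumes F: "continuous_on UNIV F"
  shows "(LINT x|lebesgue_on Omega. F x) =
    (LINT p|lborel. indicator ({0<..1} \<times> {0..<2 * pi}) p * (fst p * F (polar p)))"
proof -
  define S where "S = {y::real^2. 0 < y $ 1 \<and> y $ 1 \<le> 1 \<and> 0 \<le> y $ 2 \<and> y $ 2 < 2 * pi}"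
  define g where "g y = polar (y $ 1, y $ 2)" for y :: "real ^ 2"
  have [measurable]: "F \<in> borel_measurable borel" "polar \<in> borel_measurable borel"
    using F polar_continuous by (auto intro: borel_measurable_continuous_onI)
  have Sb: "S \<in> sets borel" unfolding S_def by measurable
  have img: "g ` S = cball 0 1 - {0}"
  proof -
    have "(\<lambda>y::real^2. (y $ 1, y $ 2)) ` S = {0<..1} \<times> {0..<2 * pi}"
      by (auto simp: S_def image_iff intro!: exI[of _ "vector [_, _]"])
    moreover have "g ` S = polar ` (\<lambda>y. (y $ 1, y $ 2)) ` S"
      by (simp add: g_def[abs_def] image_image)
    ultimately show ?thesis using bij_betw_imp_surj_on[OF polar_bij] by simp
  qed
  have inj: "inj_on g S"
  proof (rule inj_onI)
    fix x y assume xy: "x \<in> S" "y \<in> S" "g x = g y"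
    then have "(x $ 1, x $ 2) = (y $ 1, y $ 2)"
      by (intro inj_onD[OF bij_betw_imp_inj_on[OF polar_bij]]) (auto simp: g_def S_def)
    then show "x = y" by (simp add: vec_eq_iff forall_2)
  qed
  have inC: "integrable lebesgue (\<lambda>x. indicator (cball 0 1) x *\<^sub>R F x)"
    using borel_integrable_compact[OF compact_cball continuous_on_subset[OF F], of 0 1]
    by (simp add: integrable_completion)
  define V where "V x = (vec (F x) :: real ^ 1)" for x
  have V: "V absolutely_integrable_on g ` S"
    unfolding img
  proof (rule set_integrable_subset[of _ "cball 0 1"])
    have "(\<lambda>x. V x \<bullet> b) absolutely_integrable_on cball 0 1" if "b \<in> Basis" for b
    proof -
      from that have "(\<lambda>x. V x \<bullet> b) = F" by (auto simp: Basis_vec_def V_def inner_axis)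
      then show ?thesis using inC by (simp add: set_integrable_def)
    qed
    then show "V absolutely_integrable_on cball 0 1"
      by (subst absolutely_integrable_componentwise_iff) blast
  qed auto
  let ?g' = "\<lambda>y h::real^2. vector [h $ 1 * cos (y $ 2) - y $ 1 * sin (y $ 2) * h $ 2,
                  h $ 1 * sin (y $ 2) + y $ 1 * cos (y $ 2) * h $ 2] :: real ^ 2"
  have det: "det (matrix (?g' y)) = y $ 1" for y :: "real ^ 2"
  proof -
    have "det (matrix (?g' y)) =
        cos (y $ 2) * (y $ 1 * cos (y $ 2)) + y $ 1 * sin (y $ 2) * sin (y $ 2)"
      by (simp add: det_2 matrix_def axis_def)
    also have "\<dots> = y $ 1 * ((cos (y $ 2))\<^sup>2 + (sin (y $ 2))\<^sup>2)" by algebra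
    also have "\<dots> = y $ 1" by simp
    finally show ?thesis .
  qed
  have cov: "(\<lambda>x. \<bar>det (matrix (?g' x))\<bar> *\<^sub>R V (g x)) absolutely_integrable_on S \<and>
      integral S (\<lambda>x. \<bar>det (matrix (?g' x))\<bar> *\<^sub>R V (g x)) = integral (g ` S) V"
    using has_absolute_integral_change_of_variables[of S g ?g' V "integral (g ` S) V"]
      V Sb inj polar_has_derivative unfolding g_def by auto
  have "(LINT x|lebesgue_on Omega. F x) = (LINT x:Omega|lebesgue. F x)"
    unfolding set_lebesgue_integral_def by (rule integral_restrict_space) (simp add:
        Omega_measurable)
  also have "\<dots> = integral Omega F"
  proof (rule set_lebesgue_integral_eq_integral(2), rule set_integrable_subset[of _ "cball 0 1"])
    show "F absolutely_integrable_on cball 0 1" using inC by (simp add: set_integrable_def)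
  qed (auto simp: Omega_def)
  also have "\<dots> = integral (cball 0 1 - {0}) F"
  proof (rule integral_spike_set)
    have "negligible (sphere (0::real^2) 1 \<union> {0})"
      by (intro negligible_Un negligible_sphere negligible_sing)
    then show "negligible {x \<in> Omega - (cball 0 1 - {0}). F x \<noteq> 0}"
      "negligible {x \<in> cball 0 1 - {0} - Omega. F x \<noteq> 0}"
      by (rule negligible_subset; auto simp: Omega_def)+
  qed
  also have "\<dots> = integral (g ` S) V $ 1"
    using integral_component_eq_cart[OF set_lebesgue_integral_eq_integral(1)[OF V], of 1]
    unfolding img by (simp add: V_def)
  also have "\<dots> = integral S (\<lambda>x. \<bar>det (matrix (?g' x))\<bar> *\<^sub>R V (g x)) $ 1" using cov by simp
  also have "\<dots> = integral S (\<lambda>x. (\<bar>det (matrix (?g' x))\<bar> *\<^sub>R V (g x)) $ 1)"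
    using cov by (intro integral_component_eq_cart[symmetric]
        set_lebesgue_integral_eq_integral(1)) simp
  also have "\<dots> = integral S (\<lambda>x. x $ 1 * F (g x))"
    by (rule integral_cong) (simp add: det V_def S_def)
  also have "\<dots> = (LINT x:S|lebesgue. x $ 1 * F (g x))"
  proof (rule set_lebesgue_integral_eq_integral(2)[symmetric])
    have "(\<lambda>x. (\<bar>det (matrix (?g' x))\<bar> *\<^sub>R V (g x)) $ 1) absolutely_integrable_on S"
      using cov[THEN conjunct1, THEN absolutely_integrable_componentwise_iff[THEN iffD1],
          rule_format, OF axis_Basis[of 1]] by (simp add: inner_axis)
    then show "(\<lambda>x. x $ 1 * F (g x)) absolutely_integrable_on S"
      by (rule set_integrable_cong[THEN iffD1, rotated -1]) (simp_all add: det V_def S_def)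
  qed
  also have "\<dots> = (LINT x|lborel. indicator S x *\<^sub>R (x $ 1 * F (g x)))"
    unfolding set_lebesgue_integral_def g_def using Sb
    by (intro integral_completion) auto
  also have "\<dots> = (LINT p|lborel. indicator S (vector [fst p, snd p] :: real^2) *\<^sub>R (fst p *
      F (polar p)))"
  proof -
    have "(\<lambda>(a, b). vector [a, b] :: real ^ 2) \<in> lborel \<rightarrow>\<^sub>M borel" by simp
    from integral_distr[OF this, of "\<lambda>x. indicator S x *\<^sub>R (x $ 1 * F (g x))"]
    show ?thesis using Sb by (simp add: lborel_vec2 g_def case_prod_beta)
  qed
  also have "\<dots> = (LINT p|lborel. indicator ({0<..1} \<times> {0..<2 * pi}) p * (fst p * F (polar p)))"
    by (rule Bochner_Integration.integral_cong) (auto simp: S_def indicator_def)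
  finally show ?thesis .
qed

lemma dir_deriv_vec2:
  assumes "F differentiable at (x :: real ^ 2)"
  shows "dir_deriv h F x = h $ 1 * dir_deriv (axis 1 1) F x + h $ 2 * dir_deriv (axis 2 1) F x"
proof -
  obtain D where D: "(F has_derivative D) (at x)" "\<And>b. dir_deriv b F x = D b"
    using has_derivative_dir_deriv[OF assms] by metis
  interpret linear D using D(1) by (rule has_derivative_linear)
  have "h = h $ 1 *\<^sub>R axis 1 1 + h $ 2 *\<^sub>R axis 2 1"
    by (simp add: vec_eq_iff forall_2 axis_def)
  then have "D h = D (h $ 1 *\<^sub>R axis 1 1 + h $ 2 *\<^sub>R axis 2 1)" by simp
  then show ?thesis unfolding D(2) by (simp add: add scale)
qed

text \<open>The direction \<open>x\<close> varies with the point, so this is not an instance of the continuity of the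
  partial derivatives.\<close>

lemma radial_derivative_continuous:
  assumes "Ck 1 (F :: real ^ 2 \<Rightarrow> real)"
  shows "continuous_on UNIV (\<lambda>x. dir_deriv x F x)"
proof -
  have F: "\<And>x. F differentiable at x" "\<And>i. continuous_on UNIV (dir_deriv (axis i 1) F)"
    using assms by (auto simp: Ck_1_iff)
  have "continuous_on UNIV
      (\<lambda>x. x $ 1 * dir_deriv (axis 1 1) F x + x $ 2 * dir_deriv (axis 2 1) F x)"
    by (intro continuous_intros F(2))
  also have "(\<lambda>x. x $ 1 * dir_deriv (axis 1 1) F x + x $ 2 * dir_deriv (axis 2 1) F x) =
      (\<lambda>x. dir_deriv x F x)"
    by (intro ext dir_deriv_vec2[OF F(1), symmetric])
  finally show ?thesis .
qed

text \<open>The integrand is the divergence of \<open>F x\<close>. On each ray \<open>r (2 F + x \<cdot> \<nabla>F)\<close> is the derivative of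
  \<open>r\<^sup>2 F\<close>, so the radial integral leaves the value of \<open>F\<close> on the circle.\<close>

lemma integral_radial_divergence:
  assumes F: "Ck 1 (F :: real ^ 2 \<Rightarrow> real)"
  shows "(LINT x|lebesgue_on Omega. 2 * F x + dir_deriv x F x) =
    (LINT t|lborel. indicator {0..<2 * pi} t * F (polar (1, t)))"
proof -
  define G where "G x = 2 * F x + dir_deriv x F x" for x
  have diff: "\<And>x. F differentiable at x" using F by simp
  have G: "continuous_on UNIV G"
    unfolding G_def[abs_def] by (intro continuous_intros radial_derivative_continuous
        Ck_1_continuous F)
  have inner: "(LINT r|lborel. indicator {0<..1} r * (r * G (polar (r, t)))) =
      F (polar (1, t))" for t
  proof -
    have "(LINT r|lborel. indicator {0<..1} r * (r * G (polar (r, t)))) =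
        (LINT r|lborel. indicator {0..1} r *\<^sub>R (r * G (polar (r, t))))"
      by (rule Bochner_Integration.integral_cong) (auto simp: indicator_def)
    also have "\<dots> = 1\<^sup>2 * F (polar (1, t)) - 0\<^sup>2 * F (polar (0, t))"
    proof (rule integral_FTC_atLeastAtMost)
      fix r :: real
      have "((\<lambda>r. F (0 + r *\<^sub>R polar (1, t))) has_real_derivative
          dir_deriv (polar (1, t)) F (0 + r *\<^sub>R polar (1, t))) (at r)"
        by (rule dir_deriv_line[OF diff])
      then have "((\<lambda>r. F (polar (r, t))) has_real_derivative
          dir_deriv (polar (1, t)) F (polar (r, t))) (at r)"
        by (simp flip: polar_scale)
      then have "((\<lambda>r. r\<^sup>2 * F (polar (r, t))) has_real_derivative
          r * (2 * F (polar (r, t)) + r * dir_deriv (polar (1, t)) F (polar (r, t)))) (at r)"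
        by (auto intro!: derivative_eq_intros simp: power2_eq_square algebra_simps)
      also have "r * dir_deriv (polar (1, t)) F (polar (r, t)) =
          dir_deriv (polar (r, t)) F (polar (r, t))"
        unfolding dir_deriv_vec2[OF diff, where h = "polar (1, t)"]
            dir_deriv_vec2[OF diff, where h = "polar (r, t)"] by (simp add: algebra_simps)
      finally show "((\<lambda>r. r\<^sup>2 * F (polar (r, t))) has_vector_derivative r * G (polar (r, t)))
          (at r within {0..1})"
        by (auto simp: G_def has_real_derivative_iff_has_vector_derivative
            intro: has_vector_derivative_at_within)
    next
      show "continuous_on {0..1} (\<lambda>r. r * G (polar (r, t)))"
        by (intro continuous_intros continuous_on_compose2[OF G] continuous_on_compose2[OF
            polar_continuous]) auto
    qed simp
    finally show ?thesis by simp
  qed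
  have int: "integrable (lborel \<Otimes>\<^sub>M lborel)
      (\<lambda>(r, t). indicator ({0<..1} \<times> {0..<2 * pi}) (r, t) * (r * G (polar (r, t))))"
  proof -
    have "continuous_on ({0..1} \<times> {0..2 * pi}) (\<lambda>p. fst p * G (polar p))"
      by (intro continuous_intros continuous_on_compose2[OF G] continuous_on_subset[OF
          polar_continuous]) auto
    then have "integrable lborel (\<lambda>p. indicator ({0..1} \<times> {0..2 * pi}) p *\<^sub>R (fst p * G (polar p)))"
      by (intro borel_integrable_compact compact_Times) auto
    then have "integrable lborel (\<lambda>p. indicator ({0<..1} \<times> {0..<2 * pi}) p *\<^sub>R
        (indicator ({0..1} \<times> {0..2 * pi}) p *\<^sub>R (fst p * G (polar p))))"
      by (rule integrable_mult_indicator[rotated]) (auto intro!: borel_Times)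
    also have "(\<lambda>p. indicator ({0<..1} \<times> {0..<2 * pi}) p *\<^sub>R
        (indicator ({0..1} \<times> {0..2 * pi}) p *\<^sub>R (fst p * G (polar p)))) =
        (\<lambda>(r, t). indicator ({0<..1} \<times> {0..<2 * pi}) (r, t) * (r * G (polar (r, t))))"
      by (auto simp: indicator_def fun_eq_iff)
    finally show ?thesis by (simp add: lborel_prod)
  qed
  have "(LINT x|lebesgue_on Omega. 2 * F x + dir_deriv x F x) =
      (LINT p|lborel. indicator ({0<..1} \<times> {0..<2 * pi}) p * (fst p * G (polar p)))"
    using integral_polar[OF G] by (simp add: G_def)
  also have "\<dots> = (LINT p|(lborel \<Otimes>\<^sub>M lborel).
      (\<lambda>(r, t). indicator ({0<..1} \<times> {0..<2 * pi}) (r, t) * (r * G (polar (r, t)))) p)"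
    by (simp add: lborel_prod case_prod_beta)
  also have "\<dots> = (LINT t|lborel. LINT r|lborel.
      indicator ({0<..1} \<times> {0..<2 * pi}) (r, t) * (r * G (polar (r, t))))"
    by (rule lborel_pair.integral_snd[OF int, symmetric])
  also have "\<dots> = (LINT t|lborel. indicator {0..<2 * pi} t *
      (LINT r|lborel. indicator {0<..1} r * (r * G (polar (r, t)))))"
    by (intro Bochner_Integration.integral_cong refl)
      (simp add: indicator_times mult.assoc mult.left_commute[of "indicator {0<..1} _"])
  finally show ?thesis by (simp add: inner)
qed

lemma integral_circle_measure:
  fixes F :: "real ^ 2 \<Rightarrow> real"
  assumes "continuous_on UNIV F"
  shows "(LINT x|circle_measure. F x) = (LINT t|lborel. indicator {0..<2 * pi} t *
      F (polar (1, t)))"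
proof -
  have [measurable]: "F \<in> borel_measurable borel" "polar \<in> borel_measurable borel"
    using assms polar_continuous by (auto intro: borel_measurable_continuous_onI)
  have p: "vector [cos t, sin t] = polar (1, t)" for t by (simp add: polar_def)
  have "(LINT x|circle_measure. F x) = (LINT t|lebesgue_on {0..2 * pi}. F (polar (1, t)))"
    unfolding circle_measure_def p
    using integral_distr[of "\<lambda>t. polar (1, t)" "lebesgue_on {0..2 * pi}" borel F]
    by (simp add: measurable_restrict_space1 measurable_completion)
  also have "\<dots> = (LINT t|lebesgue. indicator {0..2 * pi} t *\<^sub>R F (polar (1, t)))"
    by (rule integral_restrict_space) simp
  also have "\<dots> = (LINT t|lborel. indicator {0..2 * pi} t *\<^sub>R F (polar (1, t)))"
    by (rule integral_completion) simp
  also have "\<dots> = (LINT t|lborel. indicator {0..<2 * pi} t * F (polar (1, t)))"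
  proof (rule integral_cong_AE)
    show "AE t in lborel. indicator {0..2 * pi} t *\<^sub>R F (polar (1, t)) =
        indicator {0..<2 * pi} t * F (polar (1, t))"
      using AE_lborel_singleton[of "2 * pi"] by eventually_elim (auto simp: indicator_def)
  qed auto
  finally show ?thesis .
qed

corollary integral_radial_divergence_circle:
  assumes F: "Ck 1 (F :: real ^ 2 \<Rightarrow> real)"
  shows "(LINT x|lebesgue_on Omega. 2 * F x + dir_deriv x F x) = (LINT x|circle_measure. F x)"
  using integral_radial_divergence[OF F] integral_circle_measure[OF Ck_1_continuous[OF F]] by simp

section \<open>Traces and the dual norm\<close>

lemma C1_mult:
  assumes "Ck 1 F" "Ck 1 G"
  shows "Ck 1 (\<lambda>x. F x * G x)"
proof -
  have FG: "\<And>x. F differentiable at x" "\<And>x. G differentiable at x"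
    "\<And>b. b \<in> Basis \<Longrightarrow> continuous_on UNIV (dir_deriv b F)"
    "\<And>b. b \<in> Basis \<Longrightarrow> continuous_on UNIV (dir_deriv b G)"
    using assms by (auto simp: Ck_1_iff)
  have "dir_deriv b (\<lambda>x. F x * G x) = (\<lambda>x. F x * dir_deriv b G x + dir_deriv b F x * G x)" for b
    using dir_deriv_mult FG(1,2) by blast
  then show ?thesis
    unfolding Ck_1_iff using FG
    by (auto intro!: continuous_intros assms[THEN Ck_1_continuous])
qed

lemma space_L2_circle:
  assumes "continuous_on UNIV F"
  shows "F \<in> space_L2 circle_measure"
proof -
  have [measurable]: "F \<in> borel_measurable borel" "polar \<in> borel_measurable borel"
    using assms polar_continuous by (auto intro: borel_measurable_continuous_onI)
  have p: "vector [cos t, sin t] = polar (1, t)" for t by (simp add: polar_def)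
  have "continuous_on UNIV (\<lambda>t. F (polar (1, t)))"
    by (intro continuous_on_compose2[OF assms] continuous_on_compose2[OF polar_continuous]
        continuous_intros) auto
  then have "(\<lambda>t. F (polar (1, t))) \<in> space_L2 (lebesgue_on {0..2 * pi})"
    by (intro space_L2_continuous) auto
  then have "integrable (distr (lebesgue_on {0..2 * pi}) borel (\<lambda>t. polar (1, t))) (\<lambda>x. (F x)\<^sup>2)"
    by (subst integrable_distr_eq)
      (auto simp: space_L2_def intro!: measurable_restrict_space1 measurable_completion)
  moreover have "F \<in> borel_measurable circle_measure"
    by (simp add: circle_measure_def)
  ultimately show ?thesis by (simp add: space_L2_def circle_measure_def p)
qed

text \<open>A continuously differentiable function is its own approximating sequence.\<close>

lemma has_trace_0:
  assumes F: "Ck 1 F" and 0: "\<And>x. norm x = 1 \<Longrightarrow> F x = 0"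
  shows "has_trace F (\<lambda>x. 0)"
proof -
  have "norm_L2 circle_measure (\<lambda>x. F x - 0) = 0"
    using integral_circle_measure[of "\<lambda>x. (F x)\<^sup>2"] Ck_1_continuous[OF F]
    by (simp add: norm_L2_def 0 norm_polar continuous_intros)
  then show ?thesis
    unfolding has_trace_def using F C1_W12[OF F]
    by (auto simp: norm_W12_0 space_L2_0 intro!: exI[of _ "\<lambda>k. F"])
qed

text \<open>Since \<open>\<gamma>\<close> is the divergence of \<open>W x\<close>, integration by parts moves the radial derivative onto
  \<open>u\<close>. It is carried out for the smooth approximations \<open>U k\<close> of \<open>u\<close>; their boundary terms tend
  to zero because the trace of \<open>u\<close> vanishes.\<close>

lemma W12_0_dual_estimate:
  assumes W: "Ck 1 W" and \<gamma>: "continuous_on UNIV \<gamma>"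
    and div: "\<And>x. \<gamma> x = 2 * W x + dir_deriv x W x" and u: "u \<in> W12_0"
  shows "\<bar>LINT x|lebesgue_on Omega. \<gamma> x * u x\<bar> \<le> 2 * norm_L2 (lebesgue_on Omega) W * norm_W12 u"
proof -
  let ?M = "lebesgue_on Omega"
  obtain U where U: "\<And>k. Ck 1 (U k)" "(\<lambda>k. norm_W12 (\<lambda>x. U k x - u x)) \<longlonglongrightarrow> 0"
    "(\<lambda>k. norm_L2 circle_measure (\<lambda>x. U k x - 0)) \<longlonglongrightarrow> 0"
    using u unfolding W12_0_def has_trace_def by blast
  have uW: "u \<in> W12" using u by (simp add: W12_0_def)
  then have uL: "u \<in> space_L2 ?M" by (simp add: W12_iff)
  have cW: "continuous_on UNIV W" by (rule Ck_1_continuous[OF W])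
  have cU: "continuous_on UNIV (U k)" for k by (rule Ck_1_continuous[OF U(1)])
  have WL: "W \<in> space_L2 ?M" "\<gamma> \<in> space_L2 ?M" "\<And>k. U k \<in> space_L2 ?M"
    using cW \<gamma> cU by (auto intro: space_L2_Omega)
  have dU: "dir_deriv (axis i 1) (U k) \<in> space_L2 ?M" for i k
    using is_weak_deriv_C1[OF U(1)] by (simp add: is_weak_deriv_def)
  have WxL: "(\<lambda>x. W x * x $ i) \<in> space_L2 ?M" for i
    by (intro space_L2_Omega continuous_intros cW)
  have Wx: "norm_L2 ?M (\<lambda>x. W x * x $ i) \<le> norm_L2 ?M W" for i
    unfolding norm_L2_def
  proof (intro real_sqrt_le_mono integral_mono)
    show "integrable ?M (\<lambda>x. (W x * x $ i)\<^sup>2)" "integrable ?M (\<lambda>x. (W x)\<^sup>2)"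
      using WxL WL(1) by (auto simp: space_L2_def)
    fix x assume "x \<in> space ?M"
    then have "\<bar>x $ i\<bar> \<le> 1" using component_le_norm_cart[of x i] by (simp add: Omega_def)
    then show "(W x * x $ i)\<^sup>2 \<le> (W x)\<^sup>2"
      by (simp add: power_mult_distrib mult_left_le abs_square_le_1)
  qed
  define d where "d k = norm_W12 (\<lambda>x. U k x - u x)" for k
  define c where "c k = norm_L2 circle_measure (U k)" for k
  \<comment> \<open>the classical derivative of \<open>U k\<close> splits into the weak derivative of \<open>u\<close> and a part that
    tends to zero\<close>
  have diffW: "(\<lambda>x. U k x - u x) \<in> W12"
    and wd: "AE x in ?M. dir_deriv (axis i 1) (U k) x =
      weak_deriv i u x + weak_deriv i (\<lambda>x. U k x - u x) x" for k i
  proof -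
    have *: "is_weak_deriv i (\<lambda>x. U k x - u x) (\<lambda>x. dir_deriv (axis i 1) (U k) x -
        weak_deriv i u x)" for i
      by (intro is_weak_deriv_diff is_weak_deriv_C1 U(1) weak_deriv uW WL uL)
    show W12: "(\<lambda>x. U k x - u x) \<in> W12"
      using * space_L2_diff[OF WL(3) uL] by (auto simp: W12_iff)
    show "AE x in ?M. dir_deriv (axis i 1) (U k) x =
      weak_deriv i u x + weak_deriv i (\<lambda>x. U k x - u x) x"
      using is_weak_deriv_unique[OF *[of i] weak_deriv[OF W12, of i]]
      by eventually_elim simp
  qed
  have wdL: "weak_deriv i u \<in> space_L2 ?M" "weak_deriv i (\<lambda>x. U k x - u x) \<in> space_L2 ?M" for i k
    using weak_deriv[OF uW] weak_deriv[OF diffW] by (auto simp: is_weak_deriv_def)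
  have partial: "\<bar>LINT x|?M. W x * x $ i * dir_deriv (axis i 1) (U k) x\<bar>
      \<le> norm_L2 ?M W * (norm_W12 u + d k)" for i k
  proof -
    have "(LINT x|?M. W x * x $ i * dir_deriv (axis i 1) (U k) x) =
        (LINT x|?M. W x * x $ i * weak_deriv i u x + W x * x $ i * weak_deriv i (\<lambda>x. U k x -
            u x) x)"
    proof (rule integral_cong_AE)
      show "AE x in ?M. W x * x $ i * dir_deriv (axis i 1) (U k) x =
          W x * x $ i * weak_deriv i u x + W x * x $ i * weak_deriv i (\<lambda>x. U k x - u x) x"
        using wd[of i k] by eventually_elim (simp add: distrib_left)
      show "(\<lambda>x. W x * x $ i * dir_deriv (axis i 1) (U k) x) \<in> borel_measurable ?M"
        "(\<lambda>x. W x * x $ i * weak_deriv i u x + W x * x $ i * weak_deriv i (\<lambda>x. U k x - u x) x)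
          \<in> borel_measurable ?M"
        by (intro borel_measurable_integrable Bochner_Integration.integrable_add
            space_L2_mult_integrable WxL wdL dU)+
    qed
    also have "\<dots> = (LINT x|?M. W x * x $ i * weak_deriv i u x) +
        (LINT x|?M. W x * x $ i * weak_deriv i (\<lambda>x. U k x - u x) x)"
      by (intro Bochner_Integration.integral_add space_L2_mult_integrable WxL wdL)
    finally have "\<bar>LINT x|?M. W x * x $ i * dir_deriv (axis i 1) (U k) x\<bar> \<le>
        \<bar>LINT x|?M. W x * x $ i * weak_deriv i u x\<bar> +
        \<bar>LINT x|?M. W x * x $ i * weak_deriv i (\<lambda>x. U k x - u x) x\<bar>" by linarith
    also have "\<dots> \<le> norm_L2 ?M (\<lambda>x. W x * x $ i) * norm_L2 ?M (weak_deriv i u) +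
        norm_L2 ?M (\<lambda>x. W x * x $ i) * norm_L2 ?M (weak_deriv i (\<lambda>x. U k x - u x))"
      by (intro add_mono L2_Cauchy_Schwarz WxL wdL)
    also have "\<dots> \<le> norm_L2 ?M W * norm_W12 u + norm_L2 ?M W * d k"
      unfolding d_def by (intro add_mono mult_mono Wx norm_L2_weak_deriv_le_norm_W12) auto
    finally show ?thesis by (simp add: distrib_left)
  qed
  have main: "\<bar>LINT x|?M. \<gamma> x * u x\<bar> \<le> 2 * norm_L2 ?M W * norm_W12 u +
      (norm_L2 ?M \<gamma> * d k + 2 * norm_L2 ?M W * d k + norm_L2 circle_measure W * c k)" for k
  proof -
    have UL: "\<And>x. U k differentiable at x" "\<And>x. W differentiable at x"
      using U(1)[of k] W by auto
    have "(LINT x|circle_measure. W x * U k x) =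
        (LINT x|?M. 2 * (W x * U k x) + dir_deriv x (\<lambda>x. W x * U k x) x)"
      by (rule integral_radial_divergence_circle[symmetric]) (intro C1_mult W U)
    also have "\<dots> = (LINT x|?M. \<gamma> x * U k x +
        (W x * x $ 1 * dir_deriv (axis 1 1) (U k) x + W x * x $ 2 * dir_deriv (axis 2 1) (U k) x))"
    proof (rule Bochner_Integration.integral_cong[OF refl])
      fix x :: "real ^ 2"
      have "dir_deriv x (U k) x = x $ 1 * dir_deriv (axis 1 1) (U k) x + x $ 2 *
          dir_deriv (axis 2 1) (U k) x"
        by (rule dir_deriv_vec2[OF UL(1)])
      then show "2 * (W x * U k x) + dir_deriv x (\<lambda>x. W x * U k x) x = \<gamma> x * U k x +
          (W x * x $ 1 * dir_deriv (axis 1 1) (U k) x + W x * x $ 2 * dir_deriv (axis 2 1) (U k) x)"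
        unfolding dir_deriv_mult[OF UL(2,1)] div by (simp only: algebra_simps)
    qed
    also have "\<dots> = (LINT x|?M. \<gamma> x * U k x) +
        ((LINT x|?M. W x * x $ 1 * dir_deriv (axis 1 1) (U k) x) +
         (LINT x|?M. W x * x $ 2 * dir_deriv (axis 2 1) (U k) x))"
      by (subst Bochner_Integration.integral_add;
          (intro Bochner_Integration.integrable_add space_L2_mult_integrable WL WxL dU refl)?)
        (subst Bochner_Integration.integral_add; (intro space_L2_mult_integrable WxL dU refl)?)
    finally have "\<bar>LINT x|?M. \<gamma> x * U k x\<bar> \<le> \<bar>LINT x|circle_measure. W x * U k x\<bar> +
        norm_L2 ?M W * (norm_W12 u + d k) + norm_L2 ?M W * (norm_W12 u + d k)"
      using partial[of 1 k] partial[of 2 k] by linarith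
    moreover have "\<bar>LINT x|circle_measure. W x * U k x\<bar> \<le> norm_L2 circle_measure W * c k"
      unfolding c_def by (intro L2_Cauchy_Schwarz space_L2_circle cW cU)
    moreover have "\<bar>(LINT x|?M. \<gamma> x * U k x) - (LINT x|?M. \<gamma> x * u x)\<bar> \<le> norm_L2 ?M \<gamma> * d k"
    proof -
      have "(LINT x|?M. \<gamma> x * U k x) - (LINT x|?M. \<gamma> x * u x) = (LINT x|?M. \<gamma> x * (U k x - u x))"
        by (simp add: right_diff_distrib space_L2_mult_integrable WL uL)
      also have "\<bar>\<dots>\<bar> \<le> norm_L2 ?M \<gamma> * norm_L2 ?M (\<lambda>x. U k x - u x)"
        by (intro L2_Cauchy_Schwarz space_L2_diff WL uL)
      also have "\<dots> \<le> norm_L2 ?M \<gamma> * d k"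
        unfolding d_def by (intro mult_left_mono norm_L2_le_norm_W12) auto
      finally show ?thesis .
    qed
    ultimately show ?thesis by (simp add: algebra_simps)
  qed
  have "(\<lambda>k. 2 * norm_L2 ?M W * norm_W12 u +
      (norm_L2 ?M \<gamma> * d k + 2 * norm_L2 ?M W * d k + norm_L2 circle_measure W * c k))
      \<longlonglongrightarrow> 2 * norm_L2 ?M W * norm_W12 u +
      (norm_L2 ?M \<gamma> * 0 + 2 * norm_L2 ?M W * 0 + norm_L2 circle_measure W * 0)"
    using U(2,3) by (intro tendsto_intros) (simp_all add: d_def c_def)
  from LIMSEQ_le_const[OF this] main show ?thesis by simp
qed

section \<open>Superposition of modes on disjoint time slabs\<close>

text \<open>The slabs accumulate at \<open>0\<close> only, which is outside the open time interval.\<close>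

definition slab :: "nat \<Rightarrow> real set" where
  "slab n = {- ((1/2) ^ n)<..<- ((1/2) ^ Suc n)}"

definition slabbed :: "(nat \<Rightarrow> real \<Rightarrow> real) \<Rightarrow> bool" where
  "slabbed a \<longleftrightarrow> (\<forall>n t. t \<notin> slab n \<longrightarrow> a n t = 0)"

definition superpose ::
  "(nat \<Rightarrow> real \<Rightarrow> real) \<Rightarrow> (nat \<Rightarrow> real ^ 2 \<Rightarrow> real) \<Rightarrow> (real ^ 2) \<times> real \<Rightarrow> real" where
  "superpose a V z = (\<Sum>n. a n (snd z) * V n (fst z))"

lemma slabbedD: "slabbed a \<Longrightarrow> t \<notin> slab n \<Longrightarrow> a n t = 0"
  by (simp add: slabbed_def)

lemma slab_less: "t \<in> slab m \<Longrightarrow> t \<in> slab n \<Longrightarrow> \<not> m < n"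
proof
  assume "t \<in> slab m" "t \<in> slab n" "m < n"
  moreover have "(1/2::real) ^ n \<le> (1/2) ^ Suc m"
    using \<open>m < n\<close> by (intro power_decreasing) auto
  ultimately show False by (auto simp: slab_def)
qed

lemma slab_unique: "t \<in> slab m \<Longrightarrow> t \<in> slab n \<Longrightarrow> m = n"
  using slab_less[of t m n] slab_less[of t n m] by linarith

lemma slab_Tint: "slab n \<subseteq> Tint"
proof
  fix t assume "t \<in> slab n"
  moreover have "(1/2::real) ^ n \<le> 1" "(1/2::real) ^ Suc n > 0" by (auto intro: power_le_one)
  ultimately show "t \<in> Tint" unfolding slab_def Tint_def greaterThanLessThan_iff by linarith
qed

lemma superpose_slab:
  assumes "slabbed a" "t \<in> slab n"
  shows "superpose a V (x, t) = a n t * V n x"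
proof -
  have "(\<Sum>k. a k t * V k x) = (\<Sum>k\<in>{n}. a k t * V k x)"
    by (rule suminf_finite) (use assms slab_unique slabbedD in \<open>auto, metis\<close>)
  then show ?thesis by (simp add: superpose_def)
qed

lemma superpose_outside:
  assumes "slabbed a" "\<And>n. t \<notin> slab n"
  shows "superpose a V (x, t) = 0"
  using assms by (simp add: superpose_def slabbedD)

lemma superpose_cases:
  assumes "slabbed a"
  obtains "\<And>V x. superpose a V (x, t) = 0" "\<And>n. a n t = 0"
  | n where "t \<in> slab n" "\<And>V x. superpose a V (x, t) = a n t * V n x" "\<And>k. k \<noteq> n \<Longrightarrow> a k t = 0"
proof (cases "\<exists>n. t \<in> slab n")
  case True
  then obtain n where n: "t \<in> slab n" by blast
  have "a k t = 0" if "k \<noteq> n" for k using slabbedD[OF assms] slab_unique[OF n] that by metis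
  then show ?thesis using that(2)[OF n superpose_slab[OF assms n]] by blast
next
  case False
  then show ?thesis using that(1) superpose_outside[OF assms] slabbedD[OF assms] by blast
qed

lemma superpose_finite:
  assumes "slabbed a" "t \<le> - ((1/2) ^ M)"
  shows "superpose a V (x, t) = (\<Sum>n<M. a n t * V n x)"
proof -
  have "a n t = 0" if "n \<notin> {..<M}" for n
  proof (rule slabbedD[OF assms(1)])
    have "(1/2::real) ^ n \<le> (1/2) ^ M" using that by (intro power_decreasing) auto
    then show "t \<notin> slab n"
      using assms(2) unfolding slab_def greaterThanLessThan_iff by linarith
  qed
  then have "(\<Sum>n. a n t * V n x) = (\<Sum>n<M. a n t * V n x)"
    by (intro suminf_finite) simp_all
  then show ?thesis by (simp add: superpose_def)
qed

lemma superpose_measurable: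
  assumes "\<And>n. a n \<in> borel_measurable borel" "\<And>n. V n \<in> borel_measurable borel"
  shows "superpose a V \<in> borel_measurable borel"
proof -
  have [measurable]: "a n \<in> borel_measurable borel" "V n \<in> borel_measurable borel" for n
    using assms by auto
  have "(\<lambda>z. a n (snd z) * V n (fst z)) \<in> borel_measurable (borel \<Otimes>\<^sub>M borel)" for n
    by measurable
  then have "(\<lambda>z. \<Sum>n. a n (snd z) * V n (fst z)) \<in> borel_measurable (borel \<Otimes>\<^sub>M borel)"
    by (rule borel_measurable_suminf)
  then show ?thesis by (simp add: superpose_def[abs_def] borel_prod)
qed

lemma Qcyl_open: "open Qcyl" and Qcyl_bounded: "bounded Qcyl"
  and Qcyl_measurable: "Qcyl \<in> sets lebesgue" "Qcyl \<in> sets borel"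
proof -
  show o: "open Qcyl" by (auto simp: Qcyl_def Tint_def intro!: open_Times Omega_open)
  show "bounded Qcyl" by (auto simp: Qcyl_def Tint_def intro!: bounded_Times Omega_bounded)
  show "Qcyl \<in> sets lebesgue" "Qcyl \<in> sets borel" using o by auto
qed

lemma e_Basis [simp]: "e_x i \<in> Basis" "e_t \<in> Basis"
  by (auto simp: e_x_def e_t_def Basis_prod_def)

lemma Basis_spacetime:
  assumes "b \<in> (Basis :: ((real ^ 2) \<times> real) set)"
  obtains i where "b = e_x i" | "b = e_t"
  using assms by (auto simp: Basis_prod_def e_x_def e_t_def Basis_vec_def)

lemma test_function_Qcyl_support:
  assumes "\<phi> \<in> test_functions Qcyl"
  shows "\<exists>M. \<forall>x t. \<phi> (x, t) \<noteq> 0 \<longrightarrow> t \<le> - ((1/2) ^ M) \<and> x \<in> Omega \<and> t \<in> Tint"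
proof -
  obtain K where K: "compact K" "K \<subseteq> Qcyl" "\<And>z. z \<notin> K \<Longrightarrow> \<phi> z = 0"
    using test_function_support[OF assms] by metis
  have "\<exists>M. \<forall>z\<in>K. snd z \<le> - ((1/2) ^ M)"
  proof (cases "K = {}")
    case False
    have "compact (snd ` K)" by (intro compact_continuous_image K(1) continuous_intros)
    then obtain s where s: "s \<in> snd ` K" "\<And>t. t \<in> snd ` K \<Longrightarrow> t \<le> s"
      using compact_attains_sup[of "snd ` K"] False by blast
    then have "s < 0" using K(2) by (auto simp: Qcyl_def Tint_def)
    then obtain M where "(1/2) ^ M < - s" using real_arch_pow_inv[of "- s" "1/2"] by auto
    then have "s \<le> - ((1/2) ^ M)" by simp
    then show ?thesis using s(2) by (intro exI[of _ M]) force
  qed auto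
  then obtain M where M: "\<forall>z\<in>K. snd z \<le> - ((1/2) ^ M)" by blast
  show ?thesis
  proof (intro exI[of _ M] allI impI)
    fix x t assume "\<phi> (x, t) \<noteq> 0"
    then have "(x, t) \<in> K" using K(3) by blast
    then show "t \<le> - ((1/2) ^ M) \<and> x \<in> Omega \<and> t \<in> Tint"
      using M K(2) by (force simp: Qcyl_def)
  qed
qed

definition tensor_sum ::
  "nat \<Rightarrow> (nat \<Rightarrow> real \<Rightarrow> real) \<Rightarrow> (nat \<Rightarrow> real ^ 2 \<Rightarrow> real) \<Rightarrow> (real ^ 2) \<times> real \<Rightarrow> real" where
  "tensor_sum M a V z = (\<Sum>n<M. a n (snd z) * V n (fst z))"

text \<open>The support of \<open>\<phi>\<close> is compact in the open cylinder and so stays away from \<open>t = 0\<close>: it meets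
  finitely many slabs. The number \<open>M\<close> depends on \<open>\<phi>\<close> only, so that one finite sum serves for a
  superposition and for its derivatives.\<close>

lemma superpose_tensor_sum_test:
  assumes "\<phi> \<in> test_functions Qcyl"
  shows "\<exists>M. \<forall>a V. slabbed a \<longrightarrow>
    (\<forall>z. superpose a V z * \<phi> z = tensor_sum M a V z * \<phi> z) \<and>
    (\<forall>b z. superpose a V z * dir_deriv b \<phi> z = tensor_sum M a V z * dir_deriv b \<phi> z)"
proof -
  obtain M where M: "\<forall>x t. \<phi> (x, t) \<noteq> 0 \<longrightarrow> t \<le> - ((1/2) ^ M) \<and> x \<in> Omega \<and> t \<in> Tint"
    using test_function_Qcyl_support[OF assms] by blast
  define K :: "((real ^ 2) \<times> real) set" where "K = UNIV \<times> {..- ((1/2) ^ M)}"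
  have "closed K" unfolding K_def by (intro closed_Times) auto
  have \<phi>0: "\<phi> z = 0" if "z \<notin> K" for z
    using M that by (cases z) (auto simp: K_def)
  have d0: "dir_deriv b \<phi> z = 0" if "z \<notin> K" for b z
    by (rule dir_deriv_outside[OF \<open>closed K\<close> \<phi>0 that])
  have eq: "superpose a V z = tensor_sum M a V z" if "slabbed a" "z \<in> K" for a V z
    using superpose_finite[OF that(1), of "snd z" M V "fst z"] that(2)
    by (simp add: tensor_sum_def K_def mem_Times_iff)
  show ?thesis
  proof (intro exI[of _ M] allI impI conjI)
    fix a V z assume "slabbed a"
    then show "superpose a V z * \<phi> z = tensor_sum M a V z * \<phi> z"
      using eq[of a z V] \<phi>0[of z] by (cases "z \<in> K") simp_all
  next
    fix a V b z assume "slabbed a"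
    then show "superpose a V z * dir_deriv b \<phi> z = tensor_sum M a V z * dir_deriv b \<phi> z"
      using eq[of a z V] d0[of z b] by (cases "z \<in> K") simp_all
  qed
qed

lemma tensor_sum_C1:
  assumes a: "\<And>n t. (a n has_real_derivative a' n t) (at t)" "\<And>n. continuous_on UNIV (a' n)"
    and V: "\<And>n. Ck 1 (V n)"
  shows "Ck 1 (tensor_sum M a V)"
    and "dir_deriv (e_x i) (tensor_sum M a V) = tensor_sum M a (\<lambda>n. dir_deriv (axis i 1) (V n))"
    and "dir_deriv e_t (tensor_sum M a V) = tensor_sum M a' V"
    and "continuous_on UNIV (tensor_sum M a V)"
proof -
  have V': "\<And>n x. V n differentiable at x" "\<And>n i. continuous_on UNIV (dir_deriv (axis i 1) (V n))"
    using V by (auto simp: Ck_1_iff)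
  have ca: "continuous_on UNIV (a n)" for n
    by (intro continuous_at_imp_continuous_on ballI DERIV_isCont[OF a(1)])
  have DV: "(V n has_derivative (\<lambda>h. dir_deriv h (V n) x)) (at x)" for n x
    using V'(1)[of n x] by (simp add: dir_deriv_def frechet_derivative_works)
  have D: "((\<lambda>z. a n (snd z) * V n (fst z)) has_derivative
      (\<lambda>h. a n (snd z) * dir_deriv (fst h) (V n) (fst z) + snd h * a' n (snd z) *
          V n (fst z))) (at z)" for n z
  proof -
    have 1: "((\<lambda>z. V n (fst z)) has_derivative (\<lambda>h. dir_deriv (fst h) (V n) (fst z))) (at z)"
      by (rule has_derivative_compose[OF has_derivative_fst[OF has_derivative_ident] DV])
    have 2: "((\<lambda>z. a n (snd z)) has_derivative (\<lambda>h. a' n (snd z) * snd h)) (at z)"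
      by (rule has_derivative_compose[OF has_derivative_snd[OF has_derivative_ident]
          a(1)[of n "snd z", unfolded has_field_derivative_def]])
    show ?thesis using has_derivative_mult[OF 2 1] by (simp add: mult.commute)
  qed
  have Ds: "(tensor_sum M a V has_derivative (\<lambda>h. \<Sum>n<M. a n (snd z) *
      dir_deriv (fst h) (V n) (fst z) +
      snd h * a' n (snd z) * V n (fst z))) (at z)" for z
    unfolding tensor_sum_def[abs_def] by (rule has_derivative_sum) (rule D)
  have dir0: "dir_deriv 0 (V n) x = 0" for n x
    using linear_0[OF has_derivative_linear[OF DV]] .
  show dx: "dir_deriv (e_x i) (tensor_sum M a V) =
      tensor_sum M a (\<lambda>n. dir_deriv (axis i 1) (V n))" for i
    by (rule ext) (simp add: dir_deriv_eq[OF Ds] tensor_sum_def e_x_def)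
  show dt: "dir_deriv e_t (tensor_sum M a V) = tensor_sum M a' V"
    by (rule ext) (simp add: dir_deriv_eq[OF Ds] tensor_sum_def e_t_def dir0)
  have cont: "continuous_on UNIV (tensor_sum M a V)"
    if "\<And>n. continuous_on UNIV (a n)" "\<And>n. continuous_on UNIV (V n)" for a V
    unfolding tensor_sum_def[abs_def]
    by (intro continuous_intros continuous_on_compose2[OF that(1)] continuous_on_compose2[OF
        that(2)]) auto
  show "continuous_on UNIV (tensor_sum M a V)"
    by (intro cont ca Ck_1_continuous V)
  have "continuous_on UNIV (dir_deriv b (tensor_sum M a V))" if "b \<in> Basis" for b
    using that
  proof (cases rule: Basis_spacetime)
    case (1 i)
    then show ?thesis using dx cont[OF ca V'(2)] by simp
  next
    case 2
    then show ?thesis using dt cont[OF a(2) Ck_1_continuous[OF V]] by simp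
  qed
  moreover have "tensor_sum M a V differentiable at z" for z unfolding differentiable_def by
      (intro exI) (rule Ds)
  ultimately show "Ck 1 (tensor_sum M a V)" by (simp add: Ck_1_iff)
qed

text \<open>Superpositions may be differentiated term by term in the sense of distributions, as a test
  function only sees a finite sum of continuously differentiable terms.\<close>

lemma distr_deriv_superpose:
  assumes a: "\<And>n t. (a n has_real_derivative a' n t) (at t)" "\<And>n. continuous_on UNIV (a' n)"
    and V: "\<And>n. Ck 1 (V n)" and sl: "slabbed a" "slabbed a'" and \<phi>: "\<phi> \<in> test_functions Qcyl"
  shows "distr_deriv (e_x i) (regular_distr Qcyl (superpose a V)) \<phi> =
      regular_distr Qcyl (superpose a (\<lambda>n. dir_deriv (axis i 1) (V n))) \<phi>"
    and "distr_deriv e_t (regular_distr Qcyl (superpose a V)) \<phi> =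
      regular_distr Qcyl (superpose a' V) \<phi>"
proof -
  note T = tensor_sum_C1[OF a V]
  obtain M where M: "\<forall>a V. slabbed a \<longrightarrow>
    (\<forall>z. superpose a V z * \<phi> z = tensor_sum M a V z * \<phi> z) \<and>
    (\<forall>b z. superpose a V z * dir_deriv b \<phi> z = tensor_sum M a V z * dir_deriv b \<phi> z)"
    using superpose_tensor_sum_test[OF \<phi>] ..
  have "distr_deriv (e_x i) (regular_distr Qcyl (superpose a V)) \<phi> =
      distr_deriv (e_x i) (regular_distr Qcyl (tensor_sum M a V)) \<phi>"
    by (simp add: distr_deriv_def regular_distr_def M sl)
  also have "\<dots> = regular_distr Qcyl (superpose a (\<lambda>n. dir_deriv (axis i 1) (V n))) \<phi>"
    using distr_deriv_C1[OF Qcyl_open \<phi> e_Basis(1) T(1)] by (simp add: T(2) regular_distr_def M sl)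
  finally show "distr_deriv (e_x i) (regular_distr Qcyl (superpose a V)) \<phi> =
      regular_distr Qcyl (superpose a (\<lambda>n. dir_deriv (axis i 1) (V n))) \<phi>" .
  have "distr_deriv e_t (regular_distr Qcyl (superpose a V)) \<phi> =
      distr_deriv e_t (regular_distr Qcyl (tensor_sum M a V)) \<phi>"
    by (simp add: distr_deriv_def regular_distr_def M sl)
  also have "\<dots> = regular_distr Qcyl (superpose a' V) \<phi>"
    using distr_deriv_C1[OF Qcyl_open \<phi> e_Basis(2) T(1)] by (simp add: T(3) regular_distr_def M sl)
  finally show "distr_deriv e_t (regular_distr Qcyl (superpose a V)) \<phi> =
      regular_distr Qcyl (superpose a' V) \<phi>" .
qed

lemma integrable_lebesgue_on_iff_nn:
  fixes f :: "'a::euclidean_space \<Rightarrow> real"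
  assumes [measurable]: "f \<in> borel_measurable borel" "S \<in> sets borel" and "\<And>x. f x \<ge> 0"
    and fin: "(\<integral>\<^sup>+x. ennreal (f x) * indicator S x \<partial>lborel) < \<infinity>"
  shows "integrable (lebesgue_on S) f"
proof (rule integrableI_bounded)
  show "f \<in> borel_measurable (lebesgue_on S)"
    by (intro measurable_restrict_space1 measurable_completion) simp
  have "(\<integral>\<^sup>+x. ennreal (norm (f x)) \<partial>lebesgue_on S) =
      (\<integral>\<^sup>+x. ennreal (f x) * indicator S x \<partial>lebesgue)"
    using assms(2,3) by (simp add: nn_integral_restrict_space)
  also have "\<dots> = (\<integral>\<^sup>+x. ennreal (f x) * indicator S x \<partial>lborel)"
    by (rule nn_integral_completion)
  finally show "(\<integral>\<^sup>+x. ennreal (norm (f x)) \<partial>lebesgue_on S) < \<infinity>" using fin by simp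
qed

text \<open>No mixed terms occur because the slabs are disjoint. The value may be infinite; this is used
  to show that the pressure gradient is not square integrable.\<close>

lemma nn_integral_superpose:
  assumes sl: "slabbed a"
    and [measurable]: "\<And>n. a n \<in> borel_measurable borel" "\<And>n. V n \<in> borel_measurable borel"
    and int: "\<And>n. integrable lborel (\<lambda>t. (a n t)\<^sup>2)" "\<And>n. V n \<in> space_L2 (lebesgue_on Omega)"
  shows "(\<integral>\<^sup>+z. ennreal ((superpose a V z)\<^sup>2) * indicator Qcyl z \<partial>lborel) =
    (\<Sum>n. ennreal ((LINT t|lborel. (a n t)\<^sup>2) * (LINT x|lebesgue_on Omega. (V n x)\<^sup>2)))"
proof -
  let ?A = "\<lambda>n. LINT t|lborel. (a n t)\<^sup>2"
  let ?B = "\<lambda>n. LINT x|lebesgue_on Omega. (V n x)\<^sup>2"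
  have [measurable]: "superpose a V \<in> borel_measurable borel"
    by (intro superpose_measurable) auto
  note [measurable] = Qcyl_measurable(2) Omega_measurable(2)
  have pw: "ennreal ((superpose a V (x, t))\<^sup>2) * indicator Qcyl (x, t) =
      (\<Sum>n. ennreal ((a n t)\<^sup>2) * (ennreal ((V n x)\<^sup>2) * indicator Omega x))" for x t
    using sl
  proof (cases rule: superpose_cases[where t = t])
    case 1
    then show ?thesis by simp
  next
    case (2 n)
    have "(\<Sum>n. ennreal ((a n t)\<^sup>2) * (ennreal ((V n x)\<^sup>2) * indicator Omega x)) =
        (\<Sum>k\<in>{n}. ennreal ((a k t)\<^sup>2) * (ennreal ((V k x)\<^sup>2) * indicator Omega x))"
      by (rule suminf_finite) (use 2(3) in auto)
    moreover have "indicator Qcyl (x, t) = (indicator Omega x :: ennreal)"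
      using 2(1) slab_Tint[of n] by (auto simp: Qcyl_def indicator_def)
    ultimately show ?thesis
      by (simp add: 2(2) power_mult_distrib ennreal_mult mult.assoc)
  qed
  have B: "(\<integral>\<^sup>+x. ennreal ((V n x)\<^sup>2) * indicator Omega x \<partial>lborel) = ennreal (?B n)" for n
  proof -
    have "(\<integral>\<^sup>+x. ennreal ((V n x)\<^sup>2) * indicator Omega x \<partial>lborel) =
        (\<integral>\<^sup>+x. ennreal ((V n x)\<^sup>2) * indicator Omega x \<partial>lebesgue)"
      by (rule nn_integral_completion[symmetric])
    also have "\<dots> = (\<integral>\<^sup>+x. ennreal ((V n x)\<^sup>2) \<partial>lebesgue_on Omega)"
      by (simp add: nn_integral_restrict_space Omega_measurable)
    also have "\<dots> = ennreal (?B n)"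
      using int(2)[of n] by (intro nn_integral_eq_integral) (auto simp: space_L2_def)
    finally show ?thesis .
  qed
  have AB: "(\<integral>\<^sup>+z. ennreal ((a n (snd z))\<^sup>2) * (ennreal ((V n (fst z))\<^sup>2) * indicator Omega (fst z))
      \<partial>(lborel \<Otimes>\<^sub>M lborel)) = ennreal (?A n * ?B n)" for n
  proof -
    have "(\<integral>\<^sup>+z. ennreal ((a n (snd z))\<^sup>2) * (ennreal ((V n (fst z))\<^sup>2) * indicator Omega (fst z))
        \<partial>(lborel \<Otimes>\<^sub>M lborel)) =
      (\<integral>\<^sup>+x. \<integral>\<^sup>+t. ennreal ((a n t)\<^sup>2) * (ennreal ((V n x)\<^sup>2) * indicator Omega x) \<partial>lborel \<partial>lborel)"
      by (subst lborel.nn_integral_fst[symmetric]) auto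
    also have "\<dots> = ennreal (?A n) * ennreal (?B n)"
      using int(1)[of n] by (simp add: nn_integral_multc nn_integral_cmult B
          nn_integral_eq_integral)
    finally show ?thesis by (simp add: ennreal_mult)
  qed
  have "(\<integral>\<^sup>+z. ennreal ((superpose a V z)\<^sup>2) * indicator Qcyl z \<partial>lborel) =
      (\<integral>\<^sup>+z. (\<Sum>n. ennreal ((a n (snd z))\<^sup>2) * (ennreal ((V n (fst z))\<^sup>2) * indicator Omega (fst z)))
      \<partial>(lborel \<Otimes>\<^sub>M lborel))"
    unfolding lborel_prod by (rule nn_integral_cong) (metis pw prod.collapse)
  also have "\<dots> = (\<Sum>n. ennreal (?A n * ?B n))"
    by (subst nn_integral_suminf) (auto simp: AB)
  finally show ?thesis .
qed

lemma superpose_L2: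
  assumes sl: "slabbed a"
    and [measurable]: "\<And>n. a n \<in> borel_measurable borel" "\<And>n. V n \<in> borel_measurable borel"
    and int: "\<And>n. integrable lborel (\<lambda>t. (a n t)\<^sup>2)" "\<And>n. V n \<in> space_L2 (lebesgue_on Omega)"
    and sum: "summable (\<lambda>n. (LINT t|lborel. (a n t)\<^sup>2) * (LINT x|lebesgue_on Omega. (V n x)\<^sup>2))"
  shows "superpose a V \<in> space_L2 (lebesgue_on Qcyl)"
proof -
  have [measurable]: "superpose a V \<in> borel_measurable borel"
    by (intro superpose_measurable) auto
  note [measurable] = Qcyl_measurable(2)
  have "(\<integral>\<^sup>+z. ennreal ((superpose a V z)\<^sup>2) * indicator Qcyl z \<partial>lborel) =
      ennreal (\<Sum>n. (LINT t|lborel. (a n t)\<^sup>2) * (LINT x|lebesgue_on Omega. (V n x)\<^sup>2))"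
    unfolding nn_integral_superpose[OF sl assms(2,3) int]
    by (rule suminf_ennreal2) (use sum in auto)
  then have "(\<integral>\<^sup>+z. ennreal ((superpose a V z)\<^sup>2) * indicator Qcyl z \<partial>lborel) < \<infinity>" by simp
  then have "integrable (lebesgue_on Qcyl) (\<lambda>z. (superpose a V z)\<^sup>2)"
    by (intro integrable_lebesgue_on_iff_nn) auto
  moreover have "superpose a V \<in> borel_measurable (lebesgue_on Qcyl)"
    by (intro measurable_restrict_space1 measurable_completion) simp
  ultimately show ?thesis by (simp add: space_L2_def)
qed

section \<open>Functionals on the Sobolev space with zero trace\<close>

lemma integral_lebesgue_on_eq_lborel:
  fixes f :: "'a::euclidean_space \<Rightarrow> real"
  assumes "f \<in> borel_measurable borel" "S \<in> sets borel" "\<And>x. x \<notin> S \<Longrightarrow> f x = 0"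
  shows "(LINT x|lebesgue_on S. f x) = (LINT x|lborel. f x)"
proof -
  have "(LINT x|lebesgue_on S. f x) = (LINT x|lebesgue. indicator S x *\<^sub>R f x)"
    using assms(2) by (intro integral_restrict_space) auto
  also have "\<dots> = (LINT x|lebesgue. f x)"
    by (rule Bochner_Integration.integral_cong) (use assms(3) in \<open>auto simp: indicator_def\<close>)
  also have "\<dots> = (LINT x|lborel. f x)"
    using assms(1) by (intro integral_completion) simp
  finally show ?thesis .
qed

lemma Tint_measurable: "Tint \<in> sets borel" "Tint \<in> sets lebesgue"
  by (auto simp: Tint_def)

lemma regular_distr_Qcyl_Fubini:
  assumes F: "continuous_on UNIV F" and \<phi>: "\<phi> \<in> test_functions Qcyl"
  shows "regular_distr Qcyl F \<phi> = (LINT t|lebesgue_on Tint. LINT x|lebesgue_on Omega. F (x, t) *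
      \<phi> (x, t))"
proof -
  have c: "continuous_on UNIV (\<lambda>z. F z * \<phi> z)"
    using F test_functionD(3)[OF \<phi>] by (intro continuous_intros)
  then have [measurable]: "(\<lambda>z. F z * \<phi> z) \<in> borel_measurable borel"
    by (rule borel_measurable_continuous_onI)
  then have [measurable]: "(\<lambda>z. F z * \<phi> z) \<in> borel_measurable (borel \<Otimes>\<^sub>M borel)"
    by (simp add: borel_prod)
  have supp: "F (x, t) * \<phi> (x, t) = 0" if "x \<notin> Omega \<or> t \<notin> Tint" for x t
    using test_function_Qcyl_support[OF \<phi>] that by auto
  have int: "integrable (lborel \<Otimes>\<^sub>M lborel) (\<lambda>(x, t). F (x, t) * \<phi> (x, t))"
    using integrable_mult_test_function[OF \<phi> F] by (simp add: lborel_prod case_prod_beta')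
  have cx: "(\<lambda>x. F (x, t) * \<phi> (x, t)) \<in> borel_measurable borel" for t
    by (intro borel_measurable_continuous_onI continuous_on_compose2[OF c]) (auto intro!:
        continuous_intros)
  have "regular_distr Qcyl F \<phi> = (LINT z|lborel. F z * \<phi> z)"
    using F by (intro regular_distr_eq_lborel Qcyl_open \<phi> borel_measurable_continuous_onI)
  also have "\<dots> = (LINT z|(lborel \<Otimes>\<^sub>M lborel). (\<lambda>(x, t). F (x, t) * \<phi> (x, t)) z)"
    by (simp add: lborel_prod case_prod_beta')
  also have "\<dots> = (LINT t|lborel. LINT x|lborel. F (x, t) * \<phi> (x, t))"
    by (rule lborel_pair.integral_snd[OF int, symmetric])
  also have "\<dots> = (LINT t|lebesgue_on Tint. LINT x|lborel. F (x, t) * \<phi> (x, t))"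
  proof (rule integral_lebesgue_on_eq_lborel[symmetric])
    show "(\<lambda>t. LINT x|lborel. F (x, t) * \<phi> (x, t)) \<in> borel_measurable borel"
      using borel_measurable_integrable[OF lborel_pair.integrable_snd[OF int]] by simp
    show "(LINT x|lborel. F (x, t) * \<phi> (x, t)) = 0" if "t \<notin> Tint" for t
    proof -
      have "(\<lambda>x. F (x, t) * \<phi> (x, t)) = (\<lambda>x. 0)" using supp that by blast
      then show ?thesis by (simp only:) simp
    qed
  qed (rule Tint_measurable)
  also have "\<dots> = (LINT t|lebesgue_on Tint. LINT x|lebesgue_on Omega. F (x, t) * \<phi> (x, t))"
    by (intro Bochner_Integration.integral_cong refl integral_lebesgue_on_eq_lborel[symmetric] cx
        Omega_measurable) (use supp in auto)
  finally show ?thesis .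
qed

lemma W12_0_0: "(\<lambda>x. 0) \<in> W12_0"
proof -
  have "Ck 1 (\<lambda>x::real^2. 0)" by (rule smooth_alg_Ck[OF smooth_alg.const])
  then show ?thesis by (simp add: W12_0_def C1_W12 has_trace_0)
qed

lemma unit_ball_W12_0_nonempty: "{u \<in> W12_0. norm_W12 u \<le> 1} \<noteq> {}"
  using W12_0_0 by (auto simp: norm_W12_0 intro!: exI[of _ "\<lambda>x. 0"])

text \<open>Carries an explicit bound, so that suprema in the dual norm are taken over bounded sets.\<close>

definition bounded_functional :: "((real ^ 2 \<Rightarrow> real) \<Rightarrow> real) \<Rightarrow> real \<Rightarrow> bool" where
  "bounded_functional l C \<longleftrightarrow> C \<ge> 0 \<and> (\<forall>u\<in>W12_0. \<bar>l u\<bar> \<le> C * norm_W12 u)"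

lemma bounded_functional_le:
  assumes "bounded_functional l C" "u \<in> W12_0" "norm_W12 u \<le> 1"
  shows "\<bar>l u\<bar> \<le> C"
proof -
  have "\<bar>l u\<bar> \<le> C * norm_W12 u" using assms by (simp add: bounded_functional_def)
  also have "\<dots> \<le> C * 1" using assms by (intro mult_left_mono) (auto simp: bounded_functional_def)
  finally show ?thesis by simp
qed

lemma norm_W_minus1_le: "bounded_functional l C \<Longrightarrow> norm_W_minus1 l \<le> C"
  unfolding norm_W_minus1_def
  by (rule cSUP_least[OF unit_ball_W12_0_nonempty]) (simp add: bounded_functional_le)

lemma norm_W_minus1_upper:
  assumes "bounded_functional l C" "u \<in> W12_0" "norm_W12 u \<le> 1"
  shows "\<bar>l u\<bar> \<le> norm_W_minus1 l"
  unfolding norm_W_minus1_def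
proof (rule cSUP_upper)
  show "bdd_above ((\<lambda>u. \<bar>l u\<bar>) ` {u \<in> W12_0. norm_W12 u \<le> 1})"
    by (rule bdd_aboveI[of _ C]) (use bounded_functional_le[OF assms(1)] in auto)
qed (use assms in simp)

lemma norm_W_minus1_nonneg: "bounded_functional l C \<Longrightarrow> norm_W_minus1 l \<ge> 0"
  using norm_W_minus1_upper[OF _ W12_0_0] abs_ge_zero order_trans norm_W12_0 by (metis zero_le_one)

lemma bounded_functional_cmult:
  "bounded_functional l C \<Longrightarrow> bounded_functional (\<lambda>u. c * l u) (\<bar>c\<bar> * C)"
  by (auto simp: bounded_functional_def abs_mult mult.assoc intro!: mult_left_mono)

lemma norm_W_minus1_cmult_le:
  assumes "bounded_functional l C"
  shows "norm_W_minus1 (\<lambda>u. c * l u) \<le> \<bar>c\<bar> * norm_W_minus1 l"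
  unfolding norm_W_minus1_def[of "\<lambda>u. c * l u"]
  by (rule cSUP_least[OF unit_ball_W12_0_nonempty])
    (auto simp: abs_mult intro!: mult_left_mono norm_W_minus1_upper[OF assms])

lemma norm_W_minus1_cmult:
  assumes "bounded_functional l C"
  shows "norm_W_minus1 (\<lambda>u. c * l u) = \<bar>c\<bar> * norm_W_minus1 l"
proof (cases "c = 0")
  case True
  have "norm_W_minus1 (\<lambda>u. c * l u) \<ge> 0"
    by (rule norm_W_minus1_nonneg[OF bounded_functional_cmult[OF assms]])
  then show ?thesis using norm_W_minus1_cmult_le[OF assms, of c] True by simp
next
  case False
  have "norm_W_minus1 (\<lambda>u. inverse c * (c * l u)) \<le> \<bar>inverse c\<bar> * norm_W_minus1 (\<lambda>u. c * l u)"
    by (rule norm_W_minus1_cmult_le[OF bounded_functional_cmult[OF assms]])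
  then have "norm_W_minus1 l \<le> norm_W_minus1 (\<lambda>u. c * l u) / \<bar>c\<bar>"
    using False by (simp add: divide_inverse mult.commute flip: mult.assoc)
  then have "\<bar>c\<bar> * norm_W_minus1 l \<le> norm_W_minus1 (\<lambda>u. c * l u)"
    using False by (simp add: field_simps)
  then show ?thesis using norm_W_minus1_cmult_le[OF assms, of c] by simp
qed

definition L2_functional :: "(real ^ 2 \<Rightarrow> real) \<Rightarrow> (real ^ 2 \<Rightarrow> real) \<Rightarrow> real" where
  "L2_functional \<gamma> u = (LINT x|lebesgue_on Omega. \<gamma> x * u x)"

lemma W12_0_L2: "u \<in> W12_0 \<Longrightarrow> u \<in> space_L2 (lebesgue_on Omega)"
  by (simp add: W12_0_def W12_iff)

lemma L2_functional_W_minus1: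
  assumes "\<gamma> \<in> space_L2 (lebesgue_on Omega)"
  shows "L2_functional \<gamma> \<in> W_minus1"
proof -
  have "\<bar>L2_functional \<gamma> u\<bar> \<le> norm_L2 (lebesgue_on Omega) \<gamma> * norm_W12 u" if "u \<in> W12_0" for u
  proof -
    have "\<bar>L2_functional \<gamma> u\<bar> \<le> norm_L2 (lebesgue_on Omega) \<gamma> * norm_L2 (lebesgue_on Omega) u"
      unfolding L2_functional_def by (intro L2_Cauchy_Schwarz assms W12_0_L2 that)
    also have "\<dots> \<le> norm_L2 (lebesgue_on Omega) \<gamma> * norm_W12 u"
      by (intro mult_left_mono norm_L2_le_norm_W12) simp
    finally show ?thesis .
  qed
  moreover have "L2_functional \<gamma> (\<lambda>x. u x + w x) = L2_functional \<gamma> u + L2_functional \<gamma> w"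
    if "u \<in> W12_0" "w \<in> W12_0" for u w
    using space_L2_mult_integrable[OF assms W12_0_L2[OF that(1)]]
      space_L2_mult_integrable[OF assms W12_0_L2[OF that(2)]]
    by (simp add: L2_functional_def distrib_left)
  moreover have "L2_functional \<gamma> (\<lambda>x. c * u x) = c * L2_functional \<gamma> u" for c u
    by (simp add: L2_functional_def mult.left_commute)
  ultimately show ?thesis unfolding W_minus1_def by blast
qed

lemma L2_functional_cmult: "L2_functional (\<lambda>x. c * \<gamma> x) u = c * L2_functional \<gamma> u"
  by (simp add: L2_functional_def mult.assoc)

text \<open>At each time the functional is a multiple of one fixed functional, so it suffices to
  approximate the scalar factors by simple functions.\<close>

lemma superpose_functional_L2_W_minus1:
  assumes sl: "slabbed a" and a[measurable]: "\<And>n. a n \<in> borel_measurable borel"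
    and int: "\<And>n. integrable lborel (\<lambda>t. (a n t)\<^sup>2)"
    and \<gamma>: "\<And>n. \<gamma> n \<in> space_L2 (lebesgue_on Omega)"
    and C: "\<And>n. bounded_functional (L2_functional (\<gamma> n)) (C n)"
    and sum: "summable (\<lambda>n. (LINT t|lborel. (a n t)\<^sup>2) * (C n)\<^sup>2)"
  shows "(\<lambda>t. L2_functional (\<lambda>x. superpose a \<gamma> (x, t))) \<in> L2_W_minus1"
proof -
  let ?h = "\<lambda>t. L2_functional (\<lambda>x. superpose a \<gamma> (x, t))"
  let ?l = "\<lambda>n. L2_functional (\<gamma> n)"
  let ?T = "lebesgue_on Tint"
  let ?K = "\<lambda>n. norm_W_minus1 (?l n)"
  have K: "0 \<le> ?K n" "?K n \<le> C n" "(?K n)\<^sup>2 \<le> (C n)\<^sup>2" for n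
  proof -
    show 1: "0 \<le> ?K n" "?K n \<le> C n"
      using norm_W_minus1_nonneg[OF C] norm_W_minus1_le[OF C] by auto
    show "(?K n)\<^sup>2 \<le> (C n)\<^sup>2" using 1 by (intro power_mono)
  qed
  have h: "?h t = (\<lambda>u. a n t * ?l n u)" if "t \<in> slab n" for n t
    by (rule ext) (simp add: superpose_slab[OF sl that] L2_functional_cmult)
  have h0: "?h t = (\<lambda>u. 0)" if "\<And>n. t \<notin> slab n" for t
    by (rule ext) (simp add: superpose_outside[OF sl that] L2_functional_def)
  have zero_in: "(\<lambda>u. 0) \<in> W_minus1" by (auto simp: W_minus1_def intro!: exI[of _ 0])
  have norm0: "norm_W_minus1 (\<lambda>u. 0) = 0"
    using norm_W_minus1_cmult[OF C, of 0 0] by simp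
  have hW: "?h t \<in> W_minus1" for t
  proof (cases "\<exists>n. t \<in> slab n")
    case True
    then obtain n where "t \<in> slab n" by blast
    then show ?thesis
      using L2_functional_W_minus1[OF space_L2_cmult[OF \<gamma>[of n]], of "a n t"] superpose_slab[OF
          sl] by simp
  next
    case False
    then show ?thesis using h0 zero_in by simp
  qed
  have am: "a n \<in> borel_measurable ?T" for n
    by (intro measurable_restrict_space1 measurable_completion) simp
  have "\<forall>n. \<exists>F. \<forall>i. simple_function ?T (F i) \<and> (\<forall>t\<in>Tint. (\<lambda>i. F i t) \<longlonglongrightarrow> a n t \<and> (\<forall>j. \<bar>F j t\<bar> \<le>
      2 * \<bar>a n t\<bar>))"
  proof
    fix n
    obtain F where "\<forall>i. simple_function ?T (F i)" "\<forall>t\<in>space ?T. (\<lambda>i. F i t) \<longlonglongrightarrow> a n t"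
      "\<forall>i. \<forall>t\<in>space ?T. dist (F i t) 0 \<le> 2 * dist (a n t) 0"
      using borel_measurable_implies_sequence_metric[OF am, of n 0] by blast
    then show "\<exists>F. \<forall>i. simple_function ?T (F i) \<and> (\<forall>t\<in>Tint. (\<lambda>i. F i t) \<longlonglongrightarrow> a n t \<and> (\<forall>j. \<bar>F j t\<bar> \<le>
        2 * \<bar>a n t\<bar>))"
      by (intro exI[of _ F]) simp
  qed
  from choice[OF this] obtain r where r0: "\<forall>n i. simple_function ?T (r n i) \<and>
      (\<forall>t\<in>Tint. (\<lambda>i. r n i t) \<longlonglongrightarrow> a n t \<and> (\<forall>j. \<bar>r n j t\<bar> \<le> 2 * \<bar>a n t\<bar>))" ..
  have r: "\<And>n i. simple_function ?T (r n i)"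
    "\<And>n t. t \<in> Tint \<Longrightarrow> (\<lambda>i. r n i t) \<longlonglongrightarrow> a n t" "\<And>n t j. t \<in> Tint \<Longrightarrow> \<bar>r n j t\<bar> \<le> 2 * \<bar>a n t\<bar>"
    using r0 by simp_all
  define s where "s k t = (\<lambda>u. \<Sum>n<k. r n k t * ?l n u)" for k t
  have s_simple: "simple_function ?T (s k)" for k
  proof -
    have "simple_function ?T (\<lambda>t u. \<Sum>n<m. r n k t * ?l n u)" for m
    proof (induction m)
      case (Suc m)
      have "simple_function ?T (\<lambda>t. (\<lambda>f c u. f u + c * ?l m u) (\<lambda>u. \<Sum>n<m. r n k t *
          ?l n u) (r m k t))"
        by (rule simple_function_compose2[OF Suc r(1)])
      then show ?case by simp
    qed simp
    then show ?thesis unfolding s_def[abs_def] .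
  qed
  have s_in: "s k t \<in> W_minus1" for k t
  proof -
    let ?g = "\<lambda>x. \<Sum>n<k. r n k t * \<gamma> n x"
    have g: "?g \<in> space_L2 (lebesgue_on Omega)" by (intro space_L2_sum space_L2_cmult \<gamma>)
    have "\<forall>u\<in>W12_0. \<forall>w\<in>W12_0. s k t (\<lambda>x. u x + w x) = s k t u + s k t w"
      "\<forall>c. \<forall>u\<in>W12_0. s k t (\<lambda>x. c * u x) = c * s k t u"
      using L2_functional_W_minus1[OF \<gamma>]
      by (auto simp: s_def W_minus1_def distrib_left sum.distrib sum_distrib_left mult.left_commute)
    moreover have "\<exists>C. \<forall>u\<in>W12_0. \<bar>s k t u\<bar> \<le> C * norm_W12 u"
    proof -
      have "\<bar>s k t u\<bar> \<le> (\<Sum>n<k. \<bar>r n k t\<bar> * C n) * norm_W12 u" if "u \<in> W12_0" for u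
      proof -
        have "\<bar>s k t u\<bar> \<le> (\<Sum>n<k. \<bar>r n k t * ?l n u\<bar>)" unfolding s_def by (rule sum_abs)
        also have "\<dots> \<le> (\<Sum>n<k. \<bar>r n k t\<bar> * (C n * norm_W12 u))"
          using C that by (intro sum_mono) (auto simp: abs_mult bounded_functional_def intro!:
              mult_left_mono)
        finally show ?thesis by (simp add: sum_distrib_right mult.assoc)
      qed
      then show ?thesis by blast
    qed
    ultimately show ?thesis unfolding W_minus1_def by blast
  qed
  \<comment> \<open>domination by a multiple of \<open>a n\<close> makes the approximants vanish wherever \<open>a n\<close> does\<close>
  have rz: "r n k t = 0" if "t \<in> Tint" "a n t = 0" for n k t
    using r(3)[OF that(1), of n k] that(2) by simp
  have s_lim: "(\<lambda>k. norm_W_minus1 (\<lambda>u. s k t u - ?h t u)) \<longlonglongrightarrow> 0" if t: "t \<in> Tint" for t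
  proof (cases "\<exists>n. t \<in> slab n")
    case True
    then obtain m where m: "t \<in> slab m" by blast
    have a0: "a n t = 0" if "n \<noteq> m" for n using slabbedD[OF sl] slab_unique[OF m] that by metis
    have eq: "norm_W_minus1 (\<lambda>u. s k t u - ?h t u) = \<bar>r m k t - a m t\<bar> * ?K m" if "m < k" for k
    proof -
      have "s k t u = r m k t * ?l m u" for u
      proof -
        have "s k t u = (\<Sum>n\<in>{m}. r n k t * ?l n u)"
          unfolding s_def by (rule sum.mono_neutral_right) (use that a0 rz[OF t] in auto)
        then show ?thesis by simp
      qed
      then have "(\<lambda>u. s k t u - ?h t u) = (\<lambda>u. (r m k t - a m t) * ?l m u)"
        using fun_cong[OF h[OF m]] by (simp add: left_diff_distrib)
      then show ?thesis using norm_W_minus1_cmult[OF C] by simp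
    qed
    have "(\<lambda>k. \<bar>r m k t - a m t\<bar> * ?K m) \<longlonglongrightarrow> \<bar>a m t - a m t\<bar> * ?K m"
      by (intro tendsto_intros r(2) t)
    then have "(\<lambda>k. \<bar>r m k t - a m t\<bar> * ?K m) \<longlonglongrightarrow> 0" by simp
    moreover have "\<forall>\<^sub>F k in sequentially. \<bar>r m k t - a m t\<bar> * ?K m =
        norm_W_minus1 (\<lambda>u. s k t u - ?h t u)"
      using eq by (auto intro!: eventually_sequentiallyI[of "Suc m"])
    ultimately show ?thesis by (rule Lim_transform_eventually)
  next
    case False
    then have "a n t = 0" for n using slabbedD[OF sl] by blast
    then have "s k t = (\<lambda>u. 0)" for k by (simp add: s_def rz[OF t])
    then show ?thesis using h0[of t] False norm0 by simp
  qed
  have pw: "ennreal ((norm_W_minus1 (?h t))\<^sup>2) = (\<Sum>n. ennreal ((a n t)\<^sup>2 * (?K n)\<^sup>2))" for t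
  proof (cases "\<exists>n. t \<in> slab n")
    case True
    then obtain m where m: "t \<in> slab m" by blast
    have a0: "a n t = 0" if "n \<noteq> m" for n using slabbedD[OF sl] slab_unique[OF m] that by metis
    have "(\<Sum>n. ennreal ((a n t)\<^sup>2 * (?K n)\<^sup>2)) = (\<Sum>n\<in>{m}. ennreal ((a n t)\<^sup>2 * (?K n)\<^sup>2))"
      by (rule suminf_finite) (use a0 in auto)
    then show ?thesis
      unfolding h[OF m] norm_W_minus1_cmult[OF C] by (simp add: power_mult_distrib)
  next
    case False
    then have "a n t = 0" for n using slabbedD[OF sl] by blast
    then show ?thesis using h0[of t] False norm0 by simp
  qed
  define f where "f t = (norm_W_minus1 (?h t))\<^sup>2" for t
  have [measurable]: "f \<in> borel_measurable borel"
  proof -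
    have "(\<lambda>t. enn2real (\<Sum>n. ennreal ((a n t)\<^sup>2 *
        (?K n)\<^sup>2))) \<in> borel_measurable borel" by measurable
    also have "(\<lambda>t. enn2real (\<Sum>n. ennreal ((a n t)\<^sup>2 * (?K n)\<^sup>2))) = f"
      by (rule ext, subst pw[symmetric]) (simp add: f_def)
    finally show ?thesis .
  qed
  have "integrable ?T f"
  proof (rule integrable_lebesgue_on_iff_nn)
    have "(\<integral>\<^sup>+t. ennreal (f t) * indicator Tint t \<partial>lborel) \<le>
        (\<integral>\<^sup>+t. (\<Sum>n. ennreal ((a n t)\<^sup>2 * (?K n)\<^sup>2)) \<partial>lborel)"
    proof (rule nn_integral_mono)
      fix t
      have "ennreal (f t) * indicator Tint t \<le> ennreal (f t)" by (cases "t \<in> Tint") simp_all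
      also have "ennreal (f t) = (\<Sum>n. ennreal ((a n t)\<^sup>2 * (?K n)\<^sup>2))" by (simp only: f_def pw)
      finally show "ennreal (f t) * indicator Tint t \<le> (\<Sum>n. ennreal ((a n t)\<^sup>2 * (?K n)\<^sup>2))" .
    qed
    also have "\<dots> = (\<Sum>n. \<integral>\<^sup>+t. ennreal ((a n t)\<^sup>2 * (?K n)\<^sup>2) \<partial>lborel)"
      by (rule nn_integral_suminf) simp
    also have "\<dots> = (\<Sum>n. ennreal ((LINT t|lborel. (a n t)\<^sup>2) * (?K n)\<^sup>2))"
      using int by (subst nn_integral_eq_integral) auto
    also have "\<dots> = ennreal (\<Sum>n. (LINT t|lborel. (a n t)\<^sup>2) * (?K n)\<^sup>2)"
    proof (rule suminf_ennreal2)
      show "summable (\<lambda>n. (LINT t|lborel. (a n t)\<^sup>2) * (?K n)\<^sup>2)"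
        by (rule summable_comparison_test'[OF sum, of 0]) (auto simp: abs_mult intro!:
            mult_left_mono K)
    qed simp
    finally show "(\<integral>\<^sup>+t. ennreal (f t) * indicator Tint t \<partial>lborel) < \<infinity>"
      using le_less_trans[OF _ ennreal_less_top] by simp
  qed (auto simp: f_def Tint_measurable)
  then have "integrable ?T (\<lambda>t. (norm_W_minus1 (?h t))\<^sup>2)" by (simp only: f_def[abs_def])
  moreover have "AE t in ?T. (\<lambda>k. norm_W_minus1 (\<lambda>u. s k t u - ?h t u)) \<longlonglongrightarrow> 0"
    by (rule AE_I2) (use s_lim in simp)
  ultimately show ?thesis
    unfolding L2_W_minus1_def using hW s_simple s_in by blast
qed

section \<open>Continuity in time, initial values and boundary values\<close>

lemma finite_slabs: "finite {n. t \<in> slab n}"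
proof (cases "\<exists>n. t \<in> slab n")
  case True
  then obtain n where "t \<in> slab n" by blast
  then have "{n. t \<in> slab n} \<subseteq> {n}" using slab_unique by blast
  then show ?thesis by (rule finite_subset) simp
qed simp

lemma superpose_sum:
  assumes "slabbed a" "finite S" "{n. t \<in> slab n} \<subseteq> S"
  shows "superpose a V (x, t) = (\<Sum>n\<in>S. a n t * V n x)"
proof -
  have "(\<Sum>n. a n t * V n x) = (\<Sum>n\<in>S. a n t * V n x)"
  proof (rule suminf_finite[OF assms(2)])
    fix n assume "n \<notin> S"
    then show "a n t * V n x = 0" using slabbedD[OF assms(1), of t n] assms(3) by auto
  qed
  then show ?thesis by (simp add: superpose_def)
qed

text \<open>The difference at times \<open>t\<close> and \<open>t0\<close> is bounded by the series of \<open>\<bar>a n t - a n t0\<bar> * \<parallel>V n\<parallel>\<close>,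
  which converges uniformly, hence is continuous in \<open>t\<close> and vanishes at \<open>t0\<close>. This covers the
  endpoint \<open>t = 0\<close>, where the slabs accumulate.\<close>

lemma superpose_C_L2_rep:
  assumes sl: "slabbed a" and a: "\<And>n. continuous_on UNIV (a n)"
    and V: "\<And>n. V n \<in> space_L2 (lebesgue_on Omega)"
    and c: "\<And>n t. \<bar>a n t\<bar> * norm_L2 (lebesgue_on Omega) (V n) \<le> c n" "summable c"
  shows "is_C_L2_rep (superpose a V) (\<lambda>t x. superpose a V (x, t))"
proof -
  let ?M = "lebesgue_on Omega"
  have in_L2: "(\<lambda>x. superpose a V (x, t)) \<in> space_L2 ?M" for t
    unfolding superpose_sum[OF sl finite_slabs order_refl]
    by (intro space_L2_sum space_L2_cmult V)
  have "((\<lambda>t. norm_L2 ?M (\<lambda>x. superpose a V (x, t) - superpose a V (x, t0))) \<longlongrightarrow> 0)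
      (at t0 within {-1..0})" for t0
  proof -
    define g where "g t = (\<Sum>n. \<bar>a n t - a n t0\<bar> * norm_L2 ?M (V n))" for t
    have bound: "\<bar>a n t - a n t0\<bar> * norm_L2 ?M (V n) \<le> 2 * c n" for n t
    proof -
      have "\<bar>a n t - a n t0\<bar> * norm_L2 ?M (V n) \<le> (\<bar>a n t\<bar> + \<bar>a n t0\<bar>) * norm_L2 ?M (V n)"
        by (intro mult_right_mono) auto
      also have "\<dots> \<le> 2 * c n" using c(1)[of n t] c(1)[of n t0] by (simp add: distrib_right)
      finally show ?thesis .
    qed
    have sum2c: "summable (\<lambda>n. 2 * c n)" using c(2) by (rule summable_mult)
    have summable_g: "summable (\<lambda>n. \<bar>a n t - a n t0\<bar> * norm_L2 ?M (V n))" for t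
      by (rule summable_comparison_test'[OF sum2c, of 0]) (simp add: bound)
    have "uniform_limit UNIV (\<lambda>N t. \<Sum>n<N. \<bar>a n t - a n t0\<bar> * norm_L2 ?M (V n)) g sequentially"
      unfolding g_def by (rule Weierstrass_m_test[OF _ sum2c]) (simp add: bound)
    then have "continuous_on UNIV g"
      by (rule uniform_limit_theorem[rotated])
        (auto intro!: always_eventually continuous_intros a)
    then have "(g \<longlongrightarrow> g t0) (at t0 within {-1..0})"
      by (meson UNIV_I continuous_on_def subset_UNIV tendsto_within_subset)
    then have g0: "(g \<longlongrightarrow> 0) (at t0 within {-1..0})" by (simp add: g_def)
    have le: "norm_L2 ?M (\<lambda>x. superpose a V (x, t) - superpose a V (x, t0)) \<le> g t" for t
    proof -
      let ?S = "{n. t \<in> slab n} \<union> {n. t0 \<in> slab n}"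
      have fin: "finite ?S" using finite_slabs by simp
      have "superpose a V (x, t) - superpose a V (x, t0) = (\<Sum>n\<in>?S. (a n t - a n t0) * V n x)" for x
        using superpose_sum[OF sl fin, of t V x] superpose_sum[OF sl fin, of t0 V x]
        by (simp add: left_diff_distrib sum_subtractf)
      then have "norm_L2 ?M (\<lambda>x. superpose a V (x, t) - superpose a V (x, t0)) \<le>
          (\<Sum>n\<in>?S. norm_L2 ?M (\<lambda>x. (a n t - a n t0) * V n x))"
        using norm_L2_sum[OF fin, of "\<lambda>n x. (a n t - a n t0) * V n x" ?M]
        by (simp add: space_L2_cmult V)
      also have "\<dots> \<le> g t"
        unfolding g_def norm_L2_cmult by (rule sum_le_suminf[OF summable_g fin]) simp
      finally show ?thesis .
    qed
    show ?thesis
      by (rule tendsto_sandwich[OF _ _ tendsto_const g0]) (auto intro: always_eventually le)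
  qed
  then show ?thesis using in_L2 by (simp add: is_C_L2_rep_def)
qed

lemma superpose_C_L2_zero_initial:
  assumes "slabbed a" "\<And>n. continuous_on UNIV (a n)" "\<And>n. V n \<in> space_L2 (lebesgue_on Omega)"
    "\<And>n t. \<bar>a n t\<bar> * norm_L2 (lebesgue_on Omega) (V n) \<le> c n" "summable c"
  shows "superpose a V \<in> C_L2" "superpose a V \<in> zero_initial_value"
proof -
  note rep = superpose_C_L2_rep[OF assms]
  then show "superpose a V \<in> C_L2" unfolding C_L2_def by blast
  have "-1 \<notin> slab n" for n
    using power_le_one[of "1/2::real" n] by (simp add: slab_def)
  then have "superpose a V (x, -1) = 0" for x by (rule superpose_outside[OF assms(1)])
  then show "superpose a V \<in> zero_initial_value"
    unfolding zero_initial_value_def using rep by auto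
qed

lemma superpose_zero_lateral_trace:
  assumes sl: "slabbed a" and V: "\<And>n. Ck 1 (V n)" "\<And>n x. norm x = 1 \<Longrightarrow> V n x = 0"
  shows "superpose a V \<in> zero_lateral_trace"
proof -
  have "has_trace (\<lambda>x. superpose a V (x, t)) (\<lambda>x. 0)" for t
    using sl
  proof (cases rule: superpose_cases[where t = t])
    case 1
    then show ?thesis using W12_0_0 by (simp add: W12_0_def)
  next
    case (2 n)
    have "Ck 1 (\<lambda>x. a n t * V n x)"
      by (intro C1_mult V smooth_alg_Ck smooth_alg.const)
    then show ?thesis unfolding 2 by (rule has_trace_0) (simp add: V)
  qed
  then show ?thesis by (simp add: zero_lateral_trace_def)
qed

text \<open>The functions \<open>V n\<close> may be large in the norm of square-integrable functions; the potentials \<open>W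
  n\<close> measure them in the dual norm.\<close>

lemma superpose_dt_in_L2_W_minus1:
  assumes a: "\<And>n t. (a n has_real_derivative a' n t) (at t)" "\<And>n. continuous_on UNIV (a' n)"
    and sl: "slabbed a" "slabbed a'"
    and V: "\<And>n. Ck 1 (V n)" and W: "\<And>n. Ck 1 (W n)"
    and div: "\<And>n x. V n x = 2 * W n x + dir_deriv x (W n) x"
    and int: "\<And>n. integrable lborel (\<lambda>t. (a' n t)\<^sup>2)"
    and sum: "summable (\<lambda>n. (LINT t|lborel. (a' n t)\<^sup>2) * (LINT x|lebesgue_on Omega. (W n x)\<^sup>2))"
  shows "superpose a V \<in> dt_in_L2_W_minus1"
proof -
  let ?h = "\<lambda>t. L2_functional (\<lambda>x. superpose a' V (x, t))"
  let ?C = "\<lambda>n. 2 * norm_L2 (lebesgue_on Omega) (W n)"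
  have cV: "continuous_on UNIV (V n)" for n by (rule Ck_1_continuous[OF V])
  have "?h \<in> L2_W_minus1"
  proof (rule superpose_functional_L2_W_minus1[where C = ?C])
    show "bounded_functional (L2_functional (V n)) (?C n)" for n
      unfolding bounded_functional_def L2_functional_def
      using W12_0_dual_estimate[OF W cV div] by simp
    show "summable (\<lambda>n. (LINT t|lborel. (a' n t)\<^sup>2) * (?C n)\<^sup>2)"
      using summable_mult[OF sum, of 4]
      by (simp add: power_mult_distrib norm_L2_power2 mult.left_commute)
  qed (auto intro: sl borel_measurable_continuous_onI a(2) int space_L2_Omega cV)
  moreover have "distr_deriv e_t (regular_distr Qcyl (superpose a V)) \<phi> =
      (LINT t|lebesgue_on Tint. ?h t (\<lambda>x. \<phi> (x, t)))" if \<phi>: "\<phi> \<in> test_functions Qcyl" for \<phi>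
  proof -
    obtain M where M: "\<forall>a V. slabbed a \<longrightarrow>
    (\<forall>z. superpose a V z * \<phi> z = tensor_sum M a V z * \<phi> z) \<and>
    (\<forall>b z. superpose a V z * dir_deriv b \<phi> z = tensor_sum M a V z * dir_deriv b \<phi> z)"
    using superpose_tensor_sum_test[OF \<phi>] ..
    have ct: "continuous_on UNIV (tensor_sum M a' V)"
      unfolding tensor_sum_def[abs_def]
      by (intro continuous_intros continuous_on_compose2[OF a(2)] continuous_on_compose2[OF cV])
          auto
    have "distr_deriv e_t (regular_distr Qcyl (superpose a V)) \<phi> =
        regular_distr Qcyl (superpose a' V) \<phi>"
      by (rule distr_deriv_superpose(2)[OF a V sl \<phi>])
    also have "\<dots> = regular_distr Qcyl (tensor_sum M a' V) \<phi>"
      by (simp add: regular_distr_def M sl(2))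
    also have "\<dots> = (LINT t|lebesgue_on Tint. LINT x|lebesgue_on Omega. tensor_sum M a' V (x, t) *
        \<phi> (x, t))"
      by (rule regular_distr_Qcyl_Fubini[OF ct \<phi>])
    also have "\<dots> = (LINT t|lebesgue_on Tint. ?h t (\<lambda>x. \<phi> (x, t)))"
      by (simp add: L2_functional_def M sl(2))
    finally show ?thesis .
  qed
  ultimately show ?thesis
    unfolding dt_in_L2_W_minus1_def distr_eq_def by (intro CollectI bexI[of _ ?h]) simp_all
qed

section \<open>Harmonic polynomials and radial moments\<close>

definition cplx :: "real ^ 2 \<Rightarrow> complex" where
  "cplx x = Complex (x $ 1) (x $ 2)"

definition Re_pow :: "nat \<Rightarrow> real ^ 2 \<Rightarrow> real" where
  "Re_pow n x = Re (cplx x ^ n)"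

definition Im_pow :: "nat \<Rightarrow> real ^ 2 \<Rightarrow> real" where
  "Im_pow n x = Im (cplx x ^ n)"

definition rsq :: "real ^ 2 \<Rightarrow> real" where
  "rsq x = (x $ 1)\<^sup>2 + (x $ 2)\<^sup>2"

lemma rsq_norm: "rsq x = (norm x)\<^sup>2"
  by (simp add: rsq_def norm_power2_vec2)

lemma rsq_nonneg: "rsq x \<ge> 0" by (simp add: rsq_def)

lemma rsq_le_1: "x \<in> Omega \<Longrightarrow> rsq x \<le> 1"
  by (simp add: rsq_norm Omega_def power_le_one)

lemma Re_pow_Suc: "Re_pow (Suc n) x = x $ 1 * Re_pow n x - x $ 2 * Im_pow n x"
  and Im_pow_Suc: "Im_pow (Suc n) x = x $ 1 * Im_pow n x + x $ 2 * Re_pow n x"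
  by (simp_all add: Re_pow_def Im_pow_def cplx_def)

lemma Re_Im_pow_0 [simp]: "Re_pow 0 = (\<lambda>x. 1)" "Im_pow 0 = (\<lambda>x. 0)"
  by (simp_all add: Re_pow_def[abs_def] Im_pow_def[abs_def])

lemma coordinate_smooth: "(\<lambda>x::real^2. x $ i) \<in> smooth_alg"
  using smooth_alg.coord[of "axis i 1 :: real ^ 2"] by (simp add: inner_axis)

lemma Re_Im_pow_smooth: "Re_pow n \<in> smooth_alg \<and> Im_pow n \<in> smooth_alg"
proof (induction n)
  case (Suc n)
  have "(\<lambda>x. x $ 1 * Re_pow n x - x $ 2 * Im_pow n x) \<in> smooth_alg"
    "(\<lambda>x. x $ 1 * Im_pow n x + x $ 2 * Re_pow n x) \<in> smooth_alg"
    using Suc by (auto intro!: smooth_alg_diff smooth_alg.add smooth_alg.mult coordinate_smooth)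
  then show ?case by (simp add: Re_pow_Suc[abs_def] Im_pow_Suc[abs_def])
qed (simp add: smooth_alg.const)

lemma rsq_smooth: "rsq \<in> smooth_alg"
  unfolding rsq_def[abs_def] by (intro smooth_alg.add smooth_alg_power coordinate_smooth)

lemma smooth_alg_differentiable: "f \<in> smooth_alg \<Longrightarrow> f differentiable at x"
  using smooth_alg_has_derivative[of f] unfolding differentiable_def by blast

lemma pow_has_derivative:
  "((\<lambda>x. cplx x ^ n) has_derivative (\<lambda>h. of_nat n * cplx h * cplx x ^ (n - 1))) (at x)"
proof -
  have "linear cplx"
    by (rule linearI) (simp_all add: cplx_def complex_eq_iff)
  then have "(cplx has_derivative cplx) (at x)"
    by (intro bounded_linear_imp_has_derivative) (simp add: linear_conv_bounded_linear)
  from has_derivative_power[OF this, of n] show ?thesis by (simp add: mult_ac)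
qed

lemma dir_deriv_Re_pow:
  "dir_deriv h (Re_pow n) x = real n * (h $ 1 * Re_pow (n - 1) x - h $ 2 * Im_pow (n - 1) x)"
proof -
  have "(Re_pow n has_derivative (\<lambda>h. Re (of_nat n * cplx h * cplx x ^ (n - 1)))) (at x)"
    unfolding Re_pow_def[abs_def] by (rule has_derivative_Re[OF pow_has_derivative])
  from dir_deriv_eq[OF this, of h] show ?thesis
    by (simp add: Re_pow_def Im_pow_def cplx_def algebra_simps)
qed

lemma dir_deriv_Im_pow:
  "dir_deriv h (Im_pow n) x = real n * (h $ 1 * Im_pow (n - 1) x + h $ 2 * Re_pow (n - 1) x)"
proof -
  have "(Im_pow n has_derivative (\<lambda>h. Im (of_nat n * cplx h * cplx x ^ (n - 1)))) (at x)"
    unfolding Im_pow_def[abs_def] by (rule has_derivative_Im[OF pow_has_derivative])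
  from dir_deriv_eq[OF this, of h] show ?thesis
    by (simp add: Re_pow_def Im_pow_def cplx_def algebra_simps)
qed

lemma euler_Re_Im_pow:
  "dir_deriv x (Re_pow n) x = real n * Re_pow n x" "dir_deriv x (Im_pow n) x = real n * Im_pow n x"
proof -
  show "dir_deriv x (Re_pow n) x = real n * Re_pow n x"
    by (cases n) (simp_all add: dir_deriv_Re_pow Re_pow_Suc del: Re_Im_pow_0)
  show "dir_deriv x (Im_pow n) x = real n * Im_pow n x"
    by (cases n) (simp_all add: dir_deriv_Im_pow Im_pow_Suc del: Re_Im_pow_0)
qed

lemma has_derivative_rsq_power:
  "((\<lambda>x. rsq x ^ m) has_derivative (\<lambda>h. 2 * real m * rsq x ^ (m - 1) * (x \<bullet> h))) (at x)"
proof -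
  have "rsq = (\<lambda>x. x \<bullet> x)" by (simp add: rsq_norm power2_norm_eq_inner fun_eq_iff)
  moreover have "((\<lambda>x. x \<bullet> x) has_derivative (\<lambda>h. 2 * (x \<bullet> h))) (at x)"
    by (auto intro!: derivative_eq_intros simp: inner_commute)
  ultimately have "(rsq has_derivative (\<lambda>h. 2 * (x \<bullet> h))) (at x)" by simp
  from has_derivative_power[OF this, of m] show ?thesis by (simp add: mult_ac)
qed

lemma dir_deriv_rsq_power: "dir_deriv h (\<lambda>x. rsq x ^ m) x = 2 * real m * rsq x ^ (m - 1) * (x \<bullet> h)"
  by (rule dir_deriv_eq[OF has_derivative_rsq_power])

lemma Re_Im_pow_square: "(Re_pow n x)\<^sup>2 + (Im_pow n x)\<^sup>2 = rsq x ^ n"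
proof -
  have "(Re_pow n x)\<^sup>2 + (Im_pow n x)\<^sup>2 = (cmod (cplx x ^ n))\<^sup>2"
    by (simp add: Re_pow_def Im_pow_def cmod_power2)
  also have "\<dots> = ((cmod (cplx x))\<^sup>2) ^ n" by (simp add: norm_power flip: power_mult) (simp add:
      mult.commute)
  also have "(cmod (cplx x))\<^sup>2 = rsq x" by (simp add: cmod_power2 cplx_def rsq_def)
  finally show ?thesis .
qed

lemma Re_Im_pow_square_le: "(Re_pow n x)\<^sup>2 \<le> rsq x ^ n" "(Im_pow n x)\<^sup>2 \<le> rsq x ^ n"
  using Re_Im_pow_square[of n x] by (simp_all flip: Re_Im_pow_square)

text \<open>The velocity and divergence modes and their potentials have this form with homogeneous \<open>q\<close>;
  the powers \<open>0\<close>, \<open>M\<close> and \<open>2 M\<close> come from expanding \<open>(1 - |x|\<^sup>2\<^sup>M)\<^sup>2\<close>.\<close>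

definition radial_mix :: "nat \<Rightarrow> real \<Rightarrow> real \<Rightarrow> real \<Rightarrow> (real ^ 2 \<Rightarrow> real) \<Rightarrow> real ^ 2 \<Rightarrow> real" where
  "radial_mix M c0 c1 c2 q x = q x * (c0 + c1 * rsq x ^ M + c2 * rsq x ^ (2 * M))"

lemma radial_mix_smooth: "q \<in> smooth_alg \<Longrightarrow> radial_mix M c0 c1 c2 q \<in> smooth_alg"
  unfolding radial_mix_def[abs_def]
  by (intro smooth_alg.mult smooth_alg.add smooth_alg.const smooth_alg_power rsq_smooth)

lemma dir_deriv_radial_mix:
  assumes "q \<in> smooth_alg"
  shows "dir_deriv h (radial_mix M c0 c1 c2 q) x =
    dir_deriv h q x * (c0 + c1 * rsq x ^ M + c2 * rsq x ^ (2 * M)) +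
    q x * (c1 * (2 * real M * rsq x ^ (M - 1) * (x \<bullet> h)) +
           c2 * (2 * real (2 * M) * rsq x ^ (2 * M - 1) * (x \<bullet> h)))"
proof -
  have q: "(q has_derivative (\<lambda>h. dir_deriv h q x)) (at x)"
    using smooth_alg_differentiable[OF assms] by (simp add: dir_deriv_def frechet_derivative_works)
  have "(radial_mix M c0 c1 c2 q has_derivative (\<lambda>h. q x *
      (0 + c1 * (2 * real M * rsq x ^ (M - 1) * (x \<bullet> h)) +
       c2 * (2 * real (2 * M) * rsq x ^ (2 * M - 1) * (x \<bullet> h))) +
      dir_deriv h q x * (c0 + c1 * rsq x ^ M + c2 * rsq x ^ (2 * M)))) (at x)"
    unfolding radial_mix_def[abs_def]
    by (intro has_derivative_mult has_derivative_add has_derivative_mult_right has_derivative_const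
        has_derivative_rsq_power q)
  from dir_deriv_eq[OF this] show ?thesis by simp
qed

text \<open>By Euler's identity, multiplying a homogeneous function of degree \<open>e\<close> by the field \<open>x\<close> and
  taking the divergence multiplies it by \<open>e + 2\<close>; the three terms have the degrees \<open>d\<close>, \<open>d + 2
  M\<close> and \<open>d + 4 M\<close>.\<close>

lemma radial_mix_homogeneous_divergence:
  assumes q: "q \<in> smooth_alg" and euler: "dir_deriv x q x = d * q x" and M: "M > 0"
  shows "2 * radial_mix M c0 c1 c2 q x + dir_deriv x (radial_mix M c0 c1 c2 q) x =
    radial_mix M ((d + 2) * c0) ((d + 2 + 2 * real M) * c1) ((d + 2 + 4 * real M) * c2) q x"
proof -
  have xx: "x \<bullet> x = rsq x" by (simp add: rsq_norm power2_norm_eq_inner)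
  have "rsq x ^ (M - 1) * rsq x = rsq x ^ M" "rsq x ^ (2 * M - 1) * rsq x = rsq x ^ (2 * M)"
    using M by (simp_all flip: power_Suc2)
  then have "2 * real M * rsq x ^ (M - 1) * rsq x = 2 * real M * rsq x ^ M"
    "2 * real (2 * M) * rsq x ^ (2 * M - 1) * rsq x = 4 * real M * rsq x ^ (2 * M)"
    by (simp_all add: mult.assoc)
  then show ?thesis
    by (simp only: dir_deriv_radial_mix[OF q] xx euler radial_mix_def) (simp add: algebra_simps)
qed

lemma radial_mix_square_le:
  assumes "x \<in> Omega"
  shows "(radial_mix M c0 c1 c2 q x)\<^sup>2 \<le> (\<bar>c0\<bar> + \<bar>c1\<bar> + \<bar>c2\<bar>)\<^sup>2 * (q x)\<^sup>2"
proof -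
  have r: "0 \<le> rsq x ^ k" "rsq x ^ k \<le> 1" for k
    using rsq_nonneg[of x] rsq_le_1[OF assms] by (auto intro: power_le_one)
  have "\<bar>c0 + c1 * rsq x ^ M + c2 * rsq x ^ (2 * M)\<bar> \<le>
      \<bar>c0\<bar> + \<bar>c1 * rsq x ^ M\<bar> + \<bar>c2 * rsq x ^ (2 * M)\<bar>"
    by linarith
  also have "\<dots> \<le> \<bar>c0\<bar> + \<bar>c1\<bar> + \<bar>c2\<bar>"
    using r by (intro add_mono order_refl) (auto simp: abs_mult intro!: mult_left_le)
  finally have "(c0 + c1 * rsq x ^ M + c2 * rsq x ^ (2 * M))\<^sup>2 \<le> (\<bar>c0\<bar> + \<bar>c1\<bar> + \<bar>c2\<bar>)\<^sup>2"
    by (simp add: abs_le_square_iff[symmetric])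
  then have "(q x)\<^sup>2 * (c0 + c1 * rsq x ^ M + c2 * rsq x ^ (2 * M))\<^sup>2 \<le>
      (q x)\<^sup>2 * (\<bar>c0\<bar> + \<bar>c1\<bar> + \<bar>c2\<bar>)\<^sup>2" by (rule mult_left_mono) simp
  then show ?thesis by (simp add: radial_mix_def power_mult_distrib mult.commute)
qed

lemma smooth_alg_C1: "f \<in> smooth_alg \<Longrightarrow> Ck 1 f"
  by (rule smooth_alg_Ck)

lemma smooth_alg_L2: "f \<in> smooth_alg \<Longrightarrow> f \<in> space_L2 (lebesgue_on Omega)"
  by (intro space_L2_Omega Ck_1_continuous smooth_alg_C1)

text \<open>The function is \<open>2 F + x \<cdot> \<nabla>F\<close> for \<open>F = |x|\<^sup>2\<^sup>m / (2 m + 2)\<close>, so the integral is \<open>2 \<pi>\<close> times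
  the value of \<open>F\<close> on the circle.\<close>

lemma integral_rsq_power: "(LINT x|lebesgue_on Omega. rsq x ^ m) = pi / (real m + 1)"
proof -
  let ?F = "\<lambda>x. rsq x ^ m * (1 / (2 * real m + 2))"
  have F: "?F \<in> smooth_alg" by (intro smooth_alg.mult smooth_alg_power rsq_smooth smooth_alg.const)
  have "dir_deriv x ?F x = 2 * real m * rsq x ^ m * (1 / (2 * real m + 2))" for x
  proof -
    have "dir_deriv x ?F x = 2 * real m * rsq x ^ (m - 1) * (x \<bullet> x) * (1 / (2 * real m + 2))"
      by (rule dir_deriv_eq[OF has_derivative_mult_left[OF has_derivative_rsq_power]])
    also have "x \<bullet> x = rsq x" by (simp add: rsq_norm power2_norm_eq_inner)
    also have "2 * real m * rsq x ^ (m - 1) * rsq x = 2 * real m * rsq x ^ m"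
      by (cases m) auto
    finally show ?thesis .
  qed
  then have "(LINT x|lebesgue_on Omega. rsq x ^ m) =
      (LINT x|lebesgue_on Omega. 2 * ?F x + dir_deriv x ?F x)"
    by (intro Bochner_Integration.integral_cong refl) (simp add: field_simps
        add_divide_distrib[symmetric])
  also have "\<dots> = (LINT t|lborel. indicator {0..<2 * pi} t * ?F (polar (1, t)))"
    by (rule integral_radial_divergence[OF smooth_alg_C1[OF F]])
  also have "\<dots> = (LINT t|lborel. indicator {0..<2 * pi} t * (1 / (2 * real m + 2)))"
    by (simp add: rsq_norm norm_polar)
  also have "\<dots> = pi / (real m + 1)"
    by (simp add: field_simps)
  finally show ?thesis .
qed

lemma integral_square_le_moment:
  assumes f: "f \<in> smooth_alg" and le: "\<And>x. x \<in> Omega \<Longrightarrow> (f x)\<^sup>2 \<le> C * rsq x ^ m"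
  shows "(LINT x|lebesgue_on Omega. (f x)\<^sup>2) \<le> C * (pi / (real m + 1))"
proof -
  have "(LINT x|lebesgue_on Omega. (f x)\<^sup>2) \<le> (LINT x|lebesgue_on Omega. C * rsq x ^ m)"
  proof (rule integral_mono)
    show "integrable (lebesgue_on Omega) (\<lambda>x. (f x)\<^sup>2)"
      using smooth_alg_L2[OF f] by (simp add: space_L2_def)
    show "integrable (lebesgue_on Omega) (\<lambda>x. C * rsq x ^ m)"
      by (intro space_L2_integrable finite_measure_Omega smooth_alg_L2 smooth_alg.mult
          smooth_alg.const smooth_alg_power rsq_smooth)
  qed (simp add: le)
  then show ?thesis by (simp add: integral_rsq_power)
qed

lemma integral_cos_period:
  assumes "N > 0"
  shows "(LINT t|lborel. indicator {0..<2 * pi} t * cos (real N * t)) = 0"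
proof -
  have "(LINT t|lborel. indicator {0..<2 * pi} t * cos (real N * t)) =
      (LINT t|lborel. indicator {0..2 * pi} t *\<^sub>R cos (real N * t))"
  proof (rule integral_cong_AE)
    show "AE t in lborel. indicator {0..<2 * pi} t * cos (real N * t) =
        indicator {0..2 * pi} t *\<^sub>R cos (real N * t)"
      using AE_lborel_singleton[of "2 * pi"] by eventually_elim (auto simp: indicator_def)
  qed auto
  also have "\<dots> = sin (real N * (2 * pi)) / real N - sin (real N * 0) / real N"
  proof (rule integral_FTC_atLeastAtMost)
    show "((\<lambda>t. sin (real N * t) / real N) has_vector_derivative cos (real N *
        t)) (at t within {0..2 * pi})" for t
      using assms
      by (auto intro!: derivative_eq_intros has_vector_derivative_at_within
          simp flip: has_real_derivative_iff_has_vector_derivative)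
  qed (auto intro!: continuous_intros)
  also have "\<dots> = 0" using sin_npi[of "2 * N"] by (simp add: mult.commute mult.left_commute)
  finally show ?thesis .
qed

lemma Re_pow_circle: "Re_pow N (polar (1, t)) = cos (real N * t)"
proof -
  have "cplx (polar (1, t)) = cis t" by (simp add: cplx_def cis.ctr)
  then show ?thesis by (simp add: Re_pow_def Complex.DeMoivre)
qed

section \<open>Time pulses\<close>

text \<open>At \<open>0\<close> the difference quotient is a positive power of the positive part of the increment.\<close>

lemma max_power_deriv:
  "((\<lambda>y. (max 0 y) ^ Suc (Suc k)) has_real_derivative real (Suc (Suc k)) *
      (max 0 y) ^ Suc k) (at y)"
proof -
  consider "y > 0" | "y < 0" | "y = 0" by linarith
  then show ?thesis
  proof cases
    case 1
    have "((\<lambda>y. y ^ Suc (Suc k)) has_real_derivative real (Suc (Suc k)) * (max 0 y) ^ Suc k) (at y)"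
      using 1 DERIV_pow[of "Suc (Suc k)" y] by simp
    then show ?thesis
      by (rule DERIV_cong_ev[THEN iffD1, rotated -1])
        (use 1 in \<open>auto simp: eventually_nhds intro!: exI[of _ "{0<..}"]\<close>)
  next
    case 2
    have "((\<lambda>y. 0) has_real_derivative real (Suc (Suc k)) * (max 0 y) ^ Suc k) (at y)"
      using 2 by simp
    then show ?thesis
      by (rule DERIV_cong_ev[THEN iffD1, rotated -1])
        (use 2 in \<open>auto simp: eventually_nhds intro!: exI[of _ "{..<0}"]\<close>)
  next
    case 3
    have "((\<lambda>h::real. (max 0 h) ^ Suc k) \<longlongrightarrow> (max 0 0) ^ Suc k) (at 0)"
      by (intro tendsto_intros)
    then have "((\<lambda>h::real. (max 0 h) ^ Suc k) \<longlongrightarrow> 0) (at 0)" by simp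
    moreover have "\<forall>\<^sub>F h in at 0. (max 0 h) ^ Suc k = (max 0 h) ^ Suc (Suc k) / (h::real)"
      by (auto simp: eventually_at_filter max_def)
    ultimately have "((\<lambda>h::real. (max 0 h) ^ Suc (Suc k) / h) \<longlongrightarrow> 0) (at 0)"
      by (rule Lim_transform_eventually)
    then show ?thesis using 3 by (simp add: DERIV_def)
  qed
qed

definition arch :: "real \<Rightarrow> real" where "arch s = max 0 (s * (1 - s))"

text \<open>The third power makes the function twice continuously differentiable. The pressure contains
  the first derivative and has to be continuously differentiable in space and time.\<close>

definition bump :: "real \<Rightarrow> real" where "bump s = arch s ^ 3"

definition bump' :: "real \<Rightarrow> real" where "bump' s = 3 * arch s ^ 2 * (1 - 2 * s)"

definition bump'' :: "real \<Rightarrow> real" where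
  "bump'' s = 6 * arch s * (1 - 2 * s)\<^sup>2 - 6 * arch s ^ 2"

lemma arch_eq_0: "s \<notin> {0<..<1} \<Longrightarrow> arch s = 0"
proof -
  assume "s \<notin> {0<..<1}"
  then have "s * (1 - s) \<le> 0" by (auto simp: mult_le_0_iff)
  then show "arch s = 0" by (simp add: arch_def)
qed

lemma arch_continuous: "continuous_on UNIV arch"
  unfolding arch_def[abs_def] by (intro continuous_intros)

lemma arch_bounds: "0 \<le> arch s" "arch s \<le> 1"
proof -
  show "0 \<le> arch s" by (simp add: arch_def)
  have "0 \<le> (s - 1/2)\<^sup>2" by simp
  then have "s * (1 - s) \<le> 1" by (simp add: power2_eq_square algebra_simps)
  then show "arch s \<le> 1" by (simp add: arch_def)
qed

lemma bump_deriv: "(bump has_real_derivative bump' s) (at s)"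
proof -
  have "((\<lambda>s. s * (1 - s)) has_real_derivative 1 - 2 * s) (at s)"
    by (auto intro!: derivative_eq_intros)
  from DERIV_chain2[OF max_power_deriv[of 1] this]
  show ?thesis by (simp add: bump_def[abs_def] bump'_def arch_def numeral_eq_Suc mult_ac)
qed

lemma bump'_deriv: "(bump' has_real_derivative bump'' s) (at s)"
proof -
  have "((\<lambda>s. s * (1 - s)) has_real_derivative 1 - 2 * s) (at s)"
    by (auto intro!: derivative_eq_intros)
  from DERIV_chain2[OF max_power_deriv[of 0] this]
  have "((\<lambda>s. arch s ^ 2) has_real_derivative 2 * arch s * (1 - 2 * s)) (at s)"
    by (simp add: arch_def numeral_eq_Suc)
  moreover have "((\<lambda>s. 1 - 2 * s) has_real_derivative - 2) (at s)"
    by (auto intro!: derivative_eq_intros)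
  ultimately have "((\<lambda>s. 3 * (arch s ^ 2 * (1 - 2 * s))) has_real_derivative
      3 * (2 * arch s * (1 - 2 * s) * (1 - 2 * s) + - 2 * arch s ^ 2)) (at s)"
    by (intro DERIV_cmult DERIV_mult)
  then show ?thesis unfolding bump'_def[abs_def] bump''_def
    by (simp add: power2_eq_square algebra_simps)
qed

lemma bump_continuous:
  "continuous_on UNIV bump" "continuous_on UNIV bump'" "continuous_on UNIV bump''"
  unfolding bump_def[abs_def] bump'_def[abs_def] bump''_def[abs_def]
  by (intro continuous_intros arch_continuous)+

lemma bump_support:
  assumes "s \<notin> {0<..<1}"
  shows "bump s = 0" "bump' s = 0" "bump'' s = 0"
  using arch_eq_0[OF assms] by (simp_all add: bump_def bump'_def bump''_def)

lemma bump_bounds: "\<bar>bump s\<bar> \<le> 1"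
  using arch_bounds[of s] by (simp add: bump_def power_le_one)

lemma integral_bump'_square_pos: "(LINT s|lborel. (bump' s)\<^sup>2) > 0"
proof -
  have int: "integrable lborel (\<lambda>s. (bump' s)\<^sup>2)"
    by (rule integrable_compact_support[of _ "{0..1}"])
      (auto intro!: continuous_intros bump_continuous bump_support)
  \<comment> \<open>on \<open>[1/8, 1/4]\<close> we have \<open>arch s \<ge> 1/16\<close> and \<open>1 - 2 s \<ge> 1/2\<close>; this gives the constant \<open>3
    (1/16)\<^sup>2 / 2\<close>\<close>
  have "(LINT s|lborel. (3 / 512)\<^sup>2 * indicator {1/8..1/4::real} s) \<le> (LINT s|lborel. (bump' s)\<^sup>2)"
  proof (rule integral_mono[OF _ int])
    fix s :: real
    show "(3 / 512)\<^sup>2 * indicator {1/8..1/4} s \<le> (bump' s)\<^sup>2"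
    proof (cases "s \<in> {1/8..1/4}")
      case True
      then have "1/8 * (3/4) \<le> s * (1 - s)" by (intro mult_mono) auto
      then have "1/16 \<le> arch s" by (simp add: arch_def)
      then have "(1/16)\<^sup>2 \<le> (arch s)\<^sup>2" by (intro power_mono) auto
      then have "3 * (1/16)\<^sup>2 * (1/2) \<le> bump' s"
        unfolding bump'_def using True by (intro mult_mono) auto
      then have "3 / 512 \<le> bump' s" by (simp add: power2_eq_square)
      then have "(3 / 512)\<^sup>2 \<le> (bump' s)\<^sup>2" by (intro power_mono) auto
      then show ?thesis using True by simp
    qed simp
  qed simp
  then show ?thesis by (simp add: power2_eq_square)
qed

locale pulse_train =
  fixes \<tau> :: "nat \<Rightarrow> real"
  assumes \<tau>_pos: "\<And>n. 0 < \<tau> n" and \<tau>_le: "\<And>n. \<tau> n \<le> (1/2) ^ Suc n"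
begin

definition rescaled :: "(real \<Rightarrow> real) \<Rightarrow> nat \<Rightarrow> real \<Rightarrow> real" where
  "rescaled \<rho> n t = \<rho> ((t + (1/2) ^ n) / \<tau> n)"

text \<open>Chosen so that the integral of the square of \<open>pulse' n\<close> is a constant times \<open>1 / (n + 1)\<close>,
  independently of the length \<open>\<tau> n\<close>, whereas \<open>pulse n\<close> itself is of order \<open>sqrt (\<tau> n)\<close>.\<close>

definition amplitude :: "nat \<Rightarrow> real" where
  "amplitude n = sqrt (\<tau> n / real (Suc n))"

definition pulse :: "nat \<Rightarrow> real \<Rightarrow> real" where
  "pulse n t = amplitude n * rescaled bump n t"

definition pulse' :: "nat \<Rightarrow> real \<Rightarrow> real" where
  "pulse' n t = amplitude n / \<tau> n * rescaled bump' n t"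

definition pulse'' :: "nat \<Rightarrow> real \<Rightarrow> real" where
  "pulse'' n t = amplitude n / (\<tau> n)\<^sup>2 * rescaled bump'' n t"

lemma amplitude_power2: "(amplitude n)\<^sup>2 = \<tau> n / real (Suc n)"
  using \<tau>_pos[of n] by (simp add: amplitude_def)

lemma rescaled_deriv:
  assumes "\<And>s. (\<rho> has_real_derivative \<rho>' s) (at s)"
  shows "((\<lambda>t. c * rescaled \<rho> n t) has_real_derivative c / \<tau> n * rescaled \<rho>' n t) (at t)"
proof -
  have "((\<lambda>t. (t + (1/2) ^ n) / \<tau> n) has_real_derivative 1 / \<tau> n) (at t)"
    using \<tau>_pos[of n] by (auto intro!: derivative_eq_intros)
  from DERIV_chain2[OF assms this] have
    "((\<lambda>t. rescaled \<rho> n t) has_real_derivative rescaled \<rho>' n t * (1 / \<tau> n)) (at t)"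
    unfolding rescaled_def .
  from DERIV_cmult[OF this, of c] show ?thesis by (simp add: mult_ac)
qed

lemma pulse_deriv: "(pulse n has_real_derivative pulse' n t) (at t)"
  and pulse'_deriv: "(pulse' n has_real_derivative pulse'' n t) (at t)"
proof -
  show "(pulse n has_real_derivative pulse' n t) (at t)"
    unfolding pulse_def[abs_def] pulse'_def by (rule rescaled_deriv[OF bump_deriv])
  have "amplitude n / (\<tau> n)\<^sup>2 = amplitude n / \<tau> n / \<tau> n" by (simp add: power2_eq_square)
  then show "(pulse' n has_real_derivative pulse'' n t) (at t)"
    unfolding pulse'_def[abs_def] pulse''_def by (simp only:) (rule rescaled_deriv[OF bump'_deriv])
qed

lemma rescaled_continuous: "continuous_on UNIV \<rho> \<Longrightarrow> continuous_on UNIV (rescaled \<rho> n)"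
proof -
  assume \<rho>: "continuous_on UNIV \<rho>"
  have "continuous_on UNIV (\<lambda>t. (t + (1/2) ^ n) / \<tau> n)"
    using \<tau>_pos[of n] by (intro continuous_intros) auto
  then show ?thesis unfolding rescaled_def[abs_def]
    by (rule continuous_on_compose2[OF \<rho>]) simp
qed

lemma pulse_continuous:
  "continuous_on UNIV (pulse n)" "continuous_on UNIV (pulse' n)" "continuous_on UNIV (pulse'' n)"
  unfolding pulse_def[abs_def] pulse'_def[abs_def] pulse''_def[abs_def]
  by (intro continuous_intros rescaled_continuous bump_continuous)+

lemma rescaled_support:
  assumes "\<And>s. s \<notin> {0<..<1} \<Longrightarrow> \<rho> s = 0" "t \<notin> slab n"
  shows "rescaled \<rho> n t = 0"
proof -
  have "(t + (1/2) ^ n) / \<tau> n \<notin> {0<..<1}"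
  proof
    assume "(t + (1/2) ^ n) / \<tau> n \<in> {0<..<1}"
    then have "0 < t + (1/2) ^ n" "t + (1/2) ^ n < \<tau> n"
      using \<tau>_pos[of n] by (auto simp: zero_less_divide_iff divide_less_eq)
    moreover have "(1/2::real) ^ n = 2 * (1/2) ^ Suc n" by simp
    ultimately show False using \<tau>_le[of n] assms(2)
      unfolding slab_def greaterThanLessThan_iff by linarith
  qed
  then show ?thesis unfolding rescaled_def by (rule assms(1))
qed

lemma pulse_slabbed: "slabbed pulse" "slabbed pulse'" "slabbed pulse''"
  unfolding slabbed_def pulse_def pulse'_def pulse''_def
  using rescaled_support[of bump] rescaled_support[of bump'] rescaled_support[of bump'']
      bump_support
  by auto

lemma rescaled_integral:
  assumes "continuous_on UNIV \<rho>" "\<And>s. s \<notin> {0<..<1} \<Longrightarrow> \<rho> s = 0"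
  shows "integrable lborel (\<lambda>t. (c * rescaled \<rho> n t)\<^sup>2)"
    and "(LINT t|lborel. (c * rescaled \<rho> n t)\<^sup>2) = c\<^sup>2 * \<tau> n * (LINT s|lborel. (\<rho> s)\<^sup>2)"
proof -
  show "integrable lborel (\<lambda>t. (c * rescaled \<rho> n t)\<^sup>2)"
  proof (rule integrable_compact_support[of _ "{-1..0}"])
    fix t :: real assume "t \<notin> {-1..0}"
    then have "t \<notin> slab n" using slab_Tint[of n] by (auto simp: Tint_def)
    then show "(c * rescaled \<rho> n t)\<^sup>2 = 0" using rescaled_support[OF assms(2)] by simp
  qed (auto intro!: continuous_intros rescaled_continuous assms(1))
  have "(LINT t|lborel. (rescaled \<rho> n t)\<^sup>2) =
      \<bar>\<tau> n\<bar> * (LINT s|lborel. (rescaled \<rho> n (- ((1/2) ^ n) + \<tau> n * s))\<^sup>2)"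
    using lborel_integral_real_affine[of "\<tau> n" "\<lambda>t. (rescaled \<rho> n t)\<^sup>2" "- ((1/2) ^ n)"] \<tau>_pos[of n]
    by simp
  also have "\<dots> = \<tau> n * (LINT s|lborel. (\<rho> s)\<^sup>2)"
    using \<tau>_pos[of n] by (simp add: rescaled_def)
  finally show "(LINT t|lborel. (c * rescaled \<rho> n t)\<^sup>2) = c\<^sup>2 * \<tau> n * (LINT s|lborel. (\<rho> s)\<^sup>2)"
    by (simp add: power_mult_distrib)
qed

lemma pulse_square_integrable:
  "integrable lborel (\<lambda>t. (pulse n t)\<^sup>2)" "integrable lborel (\<lambda>t. (pulse' n t)\<^sup>2)"
  unfolding pulse_def pulse'_def
  by (intro rescaled_integral(1) bump_continuous bump_support; assumption)+

lemma pulse_square_integral: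
  "(LINT t|lborel. (pulse n t)\<^sup>2) = (\<tau> n)\<^sup>2 / real (Suc n) * (LINT s|lborel. (bump s)\<^sup>2)"
proof -
  have "(LINT t|lborel. (pulse n t)\<^sup>2) = (amplitude n)\<^sup>2 * \<tau> n * (LINT s|lborel. (bump s)\<^sup>2)"
    unfolding pulse_def by (rule rescaled_integral(2)) (auto intro: bump_continuous bump_support)
  then show ?thesis by (simp add: amplitude_power2) (simp add: power2_eq_square)
qed

lemma pulse'_square_integral:
  "(LINT t|lborel. (pulse' n t)\<^sup>2) = (LINT s|lborel. (bump' s)\<^sup>2) / real (Suc n)"
proof -
  have "(LINT t|lborel. (pulse' n t)\<^sup>2) = (amplitude n / \<tau> n)\<^sup>2 * \<tau> n *
      (LINT s|lborel. (bump' s)\<^sup>2)"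
    unfolding pulse'_def by (rule rescaled_integral(2)) (auto intro: bump_continuous bump_support)
  then show ?thesis using \<tau>_pos[of n] by (simp add: power_divide amplitude_power2) (simp add:
      power2_eq_square)
qed

lemma pulse_bound: "\<bar>pulse n t\<bar> \<le> sqrt (\<tau> n)"
proof -
  have "\<bar>pulse n t\<bar> \<le> amplitude n * 1"
    using \<tau>_pos[of n] bump_bounds
    by (auto simp: pulse_def abs_mult rescaled_def amplitude_def intro!: mult_left_mono)
  also have "\<dots> \<le> sqrt (\<tau> n)"
    using \<tau>_pos[of n] by (simp add: amplitude_def field_simps)
  finally show ?thesis .
qed

end

section \<open>The spatial modes\<close>

text \<open>The gradient of \<open>Re_pow (Suc n)\<close>, by the Cauchy-Riemann equations.\<close>

definition grad_mode :: "2 \<Rightarrow> nat \<Rightarrow> real ^ 2 \<Rightarrow> real" where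
  "grad_mode k n = (if k = 1 then (\<lambda>x. real (Suc n) * Re_pow n x) else (\<lambda>x. - real (Suc n) *
      Im_pow n x))"

text \<open>The cut-off differs from \<open>1\<close> in a layer of width about \<open>1 / (n + 1)\<^sup>3\<close>. The third power is
  what makes the square norm of the residual mode of order \<open>1 / (n + 1)\<close>.\<close>

definition cutoff_degree :: "nat \<Rightarrow> nat" where "cutoff_degree n = Suc n ^ 3"

text \<open>The field \<open>\<zeta> \<nabla>\<Phi>\<close> with \<open>\<zeta> = (1 - |x|\<^sup>2\<^sup>M)\<^sup>2\<close>.\<close>

definition velocity_mode :: "2 \<Rightarrow> nat \<Rightarrow> real ^ 2 \<Rightarrow> real" where
  "velocity_mode k n = radial_mix (cutoff_degree n) 1 (- 2) 1 (grad_mode k n)"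

text \<open>The coefficients are those of \<open>velocity_mode\<close>, divided by the degrees of the three terms plus
  \<open>2\<close>.\<close>

definition velocity_potential :: "2 \<Rightarrow> nat \<Rightarrow> real ^ 2 \<Rightarrow> real" where
  "velocity_potential k n = radial_mix (cutoff_degree n) (1 / (real n + 2)) (- 2 / (real n + 2 +
      2 * real (cutoff_degree n)))
     (1 / (real n + 2 + 4 * real (cutoff_degree n))) (grad_mode k n)"

text \<open>The part \<open>(\<zeta> - 1) \<nabla>\<Phi>\<close> of the velocity mode that the pressure does not cancel.\<close>

definition residual_mode :: "2 \<Rightarrow> nat \<Rightarrow> real ^ 2 \<Rightarrow> real" where
  "residual_mode k n = radial_mix (cutoff_degree n) 0 (- 2) 1 (grad_mode k n)"

definition div_core :: "nat \<Rightarrow> real ^ 2 \<Rightarrow> real" where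
  "div_core n x = Re_pow (Suc n) x * rsq x ^ (cutoff_degree n - 1)"

text \<open>Equals \<open>\<nabla>\<zeta> \<cdot> \<nabla>\<Phi>\<close>, as \<open>\<Phi>\<close> is harmonic.\<close>

definition div_mode :: "nat \<Rightarrow> real ^ 2 \<Rightarrow> real" where
  "div_mode n = radial_mix (cutoff_degree n) (- 4 * real (cutoff_degree n) * real (Suc n)) (4 *
      real (cutoff_degree n) * real (Suc n)) 0
     (div_core n)"

definition div_degree :: "nat \<Rightarrow> real" where
  "div_degree n = real (Suc n) + 2 * real (cutoff_degree n - 1)"

definition div_potential :: "nat \<Rightarrow> real ^ 2 \<Rightarrow> real" where
  "div_potential n = radial_mix (cutoff_degree n)
     (- 4 * real (cutoff_degree n) * real (Suc n) / (div_degree n + 2))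
     (4 * real (cutoff_degree n) * real (Suc n) / (div_degree n + 2 + 2 *
         real (cutoff_degree n))) 0 (div_core n)"

lemma cutoff_degree_pos: "cutoff_degree n > 0" by (simp add: cutoff_degree_def)

lemma grad_mode_smooth: "grad_mode k n \<in> smooth_alg"
  using Re_Im_pow_smooth[of n] by (auto simp: grad_mode_def intro!: smooth_alg.mult
      smooth_alg.const smooth_alg_uminus)

lemma div_core_smooth: "div_core n \<in> smooth_alg"
  unfolding div_core_def[abs_def]
  using Re_Im_pow_smooth by (intro smooth_alg.mult smooth_alg_power rsq_smooth) blast

lemma mode_smooth:
  "velocity_mode k n \<in> smooth_alg" "velocity_potential k n \<in> smooth_alg" "residual_mode k n \<in>
      smooth_alg"
  "div_mode n \<in> smooth_alg" "div_potential n \<in> smooth_alg"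
  unfolding velocity_mode_def velocity_potential_def residual_mode_def div_mode_def
      div_potential_def
  by (intro radial_mix_smooth grad_mode_smooth div_core_smooth)+

lemma not_1_imp_2: "k \<noteq> (1::2) \<Longrightarrow> k = 2"
  using exhaust_2 by blast

lemma dir_deriv_cmult:
  "q \<in> smooth_alg \<Longrightarrow> dir_deriv h (\<lambda>x. c * q x) x = c * dir_deriv h q x"
proof -
  assume "q \<in> smooth_alg"
  then have "(q has_derivative (\<lambda>h. dir_deriv h q x)) (at x)"
    using smooth_alg_differentiable by (simp add: dir_deriv_def flip: frechet_derivative_works)
  from dir_deriv_eq[OF has_derivative_mult_right[OF this]] show ?thesis .
qed

lemma pressure_gradient: "dir_deriv (axis k 1) (Re_pow (Suc n)) = grad_mode k n"
proof (rule ext)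
  fix x
  show "dir_deriv (axis k 1) (Re_pow (Suc n)) x = grad_mode k n x"
    by (cases "k = 1") (auto simp: grad_mode_def dir_deriv_Re_pow axis_def algebra_simps dest!:
        not_1_imp_2)
qed

lemma grad_mode_euler: "dir_deriv x (grad_mode k n) x = real n * grad_mode k n x"
proof (cases "k = 1")
  case True
  then show ?thesis
    using Re_Im_pow_smooth[of n] by (simp add: grad_mode_def dir_deriv_cmult euler_Re_Im_pow del:
        Re_Im_pow_0)
next
  case False
  have "dir_deriv x (\<lambda>x. - real (Suc n) * Im_pow n x) x = - real (Suc n) * (real n * Im_pow n x)"
    using Re_Im_pow_smooth[of n] by (simp only: dir_deriv_cmult euler_Re_Im_pow)
  then show ?thesis using False by (simp add: grad_mode_def)
qed

lemma div_core_euler: "dir_deriv x (div_core n) x = div_degree n * div_core n x"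
proof -
  have 1: "dir_deriv x (\<lambda>x. rsq x ^ m) x = 2 * real m * rsq x ^ m" for m
  proof -
    have xx: "x \<bullet> x = rsq x" by (simp add: rsq_norm power2_norm_eq_inner)
    show ?thesis unfolding dir_deriv_rsq_power xx by (cases m) auto
  qed
  have "dir_deriv x (div_core n) x = Re_pow (Suc n) x *
      dir_deriv x (\<lambda>x. rsq x ^ (cutoff_degree n - 1)) x +
      dir_deriv x (Re_pow (Suc n)) x * rsq x ^ (cutoff_degree n - 1)"
    unfolding div_core_def[abs_def]
    using Re_Im_pow_smooth smooth_alg_power[OF rsq_smooth]
    by (intro dir_deriv_mult smooth_alg_differentiable) blast+
  then show ?thesis
    unfolding 1 euler_Re_Im_pow by (simp add: div_core_def div_degree_def algebra_simps)
qed

lemma nonzero_times_divide: "(a::real) \<noteq> 0 \<Longrightarrow> a * (c / a) = c"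
  by simp

lemma velocity_radial_divergence:
  "velocity_mode k n x = 2 * velocity_potential k n x + dir_deriv x (velocity_potential k n) x"
proof -
  have nz: "real n + 2 + 2 * real (cutoff_degree n) \<noteq> 0" "real n + 2 + 4 *
      real (cutoff_degree n) \<noteq> 0" "real n + 2 \<noteq> 0"
    by (smt (verit) of_nat_0_le_iff)+
  show ?thesis
    unfolding velocity_potential_def velocity_mode_def
      radial_mix_homogeneous_divergence[OF grad_mode_smooth grad_mode_euler cutoff_degree_pos]
      nonzero_times_divide[OF nz(1)] nonzero_times_divide[OF nz(2)] nonzero_times_divide[OF nz(3)]
          ..
qed

lemma div_radial_divergence:
  "div_mode n x = 2 * div_potential n x + dir_deriv x (div_potential n) x"
proof -
  have nz: "div_degree n + 2 + 2 * real (cutoff_degree n) \<noteq> 0" "div_degree n + 2 \<noteq> 0"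
    unfolding div_degree_def by (smt (verit) of_nat_0_le_iff)+
  show ?thesis
    unfolding div_potential_def div_mode_def
      radial_mix_homogeneous_divergence[OF div_core_smooth div_core_euler cutoff_degree_pos]
      nonzero_times_divide[OF nz(1)] nonzero_times_divide[OF nz(2)] mult_zero_right ..
qed

text \<open>Harmonicity of \<open>\<Phi>\<close> removes the term with \<open>\<zeta>\<close>; the gradient of \<open>\<zeta>\<close> is radial, so the other term
  is a multiple of the radial derivative of \<open>\<Phi>\<close>.\<close>

lemma divergence_of_velocity_mode:
  "(\<Sum>k\<in>UNIV. dir_deriv (axis k 1) (velocity_mode k n) x) = div_mode n x"
proof -
  let ?M = "cutoff_degree n"
  let ?r = "rsq x"
  let ?P = "1 + (- 2) * ?r ^ ?M + 1 * ?r ^ (2 * ?M)"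
  have cr: "dir_deriv (axis 1 1) (grad_mode 1 n) x + dir_deriv (axis 2 1) (grad_mode 2 n) x = 0"
  proof -
    have "dir_deriv (axis 1 1) (\<lambda>x. real (Suc n) * Re_pow n x) x =
        real (Suc n) * dir_deriv (axis 1 1) (Re_pow n) x"
      "dir_deriv (axis 2 1) (\<lambda>x. - real (Suc n) * Im_pow n x) x =
          - real (Suc n) * dir_deriv (axis 2 1) (Im_pow n) x"
      using Re_Im_pow_smooth[of n] by (intro dir_deriv_cmult; blast)+
    then show ?thesis
      by (simp add: grad_mode_def dir_deriv_Re_pow dir_deriv_Im_pow axis_def algebra_simps del:
          Re_Im_pow_0)
  qed
  have core: "x $ 1 * grad_mode 1 n x + x $ 2 * grad_mode 2 n x = real (Suc n) * Re_pow (Suc n) x"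
    unfolding Re_pow_Suc by (simp add: grad_mode_def algebra_simps)
  have ax: "x \<bullet> axis k 1 = x $ k" for k by (simp add: inner_axis)
  have pow: "2 * real (2 * ?M) * ?r ^ (2 * ?M - 1) = 4 * real ?M * (?r ^ (?M - 1) * ?r ^ ?M)"
  proof -
    have "2 * ?M - 1 = (?M - 1) + ?M" using cutoff_degree_pos[of n] by simp
    then have "?r ^ (2 * ?M - 1) = ?r ^ (?M - 1) * ?r ^ ?M" by (simp only: power_add)
    then show ?thesis by simp
  qed
  let ?c = "-2 * (2 * real ?M * ?r ^ (?M - 1)) + 4 * real ?M * (?r ^ (?M - 1) * ?r ^ ?M)"
  have d: "dir_deriv (axis k 1) (velocity_mode k n) x =
      dir_deriv (axis k 1) (grad_mode k n) x * ?P + grad_mode k n x * (?c * x $ k)" for k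
    unfolding velocity_mode_def dir_deriv_radial_mix[OF grad_mode_smooth] ax pow
    by (simp add: algebra_simps)
  have "(\<Sum>k\<in>UNIV. dir_deriv (axis k 1) (velocity_mode k n) x) =
      (dir_deriv (axis 1 1) (grad_mode 1 n) x + dir_deriv (axis 2 1) (grad_mode 2 n) x) * ?P +
      ?c * (x $ 1 * grad_mode 1 n x + x $ 2 * grad_mode 2 n x)"
    unfolding d sum_2 by (simp add: algebra_simps)
  also have "\<dots> = div_mode n x"
    unfolding cr core by (simp add: div_mode_def radial_mix_def div_core_def algebra_simps)
  finally show ?thesis .
qed

lemma mode_boundary:
  assumes "norm x = 1"
  shows "velocity_mode k n x = 0" "div_mode n x = 0"
  using assms by (simp_all add: velocity_mode_def div_mode_def radial_mix_def rsq_norm)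

text \<open>By the radial divergence theorem the integral is a multiple of \<open>\<integral> cos ((n + 1) t)\<close> over a
  period.\<close>

lemma integral_div_mode: "(LINT x|lebesgue_on Omega. div_mode n x) = 0"
proof -
  let ?C = "- 4 * real (cutoff_degree n) * real (Suc n) / (div_degree n + 2) +
     4 * real (cutoff_degree n) * real (Suc n) / (div_degree n + 2 + 2 * real (cutoff_degree n))"
  have "div_potential n (polar (1, t)) = ?C * cos (real (Suc n) * t)" for t
    unfolding div_potential_def radial_mix_def div_core_def Re_pow_circle
    by (simp add: rsq_norm norm_polar)
  then have "(LINT x|lebesgue_on Omega. div_mode n x) =
      (LINT t|lborel. ?C * (indicator {0..<2 * pi} t * cos (real (Suc n) * t)))"
    unfolding div_radial_divergence
    using integral_radial_divergence[OF smooth_alg_C1[OF mode_smooth(5)], of n]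
    by (simp only: mult.left_commute)
  also have "\<dots> = 0" using integral_cos_period[of "Suc n"] by simp
  finally show ?thesis .
qed

definition sq_norm :: "(real ^ 2 \<Rightarrow> real) \<Rightarrow> real" where
  "sq_norm f = (LINT x|lebesgue_on Omega. (f x)\<^sup>2)"

lemma sq_norm_nonneg [simp]: "sq_norm f \<ge> 0"
  by (simp add: sq_norm_def)

lemma grad_mode_square: "(grad_mode 1 n x)\<^sup>2 + (grad_mode 2 n x)\<^sup>2 = (real (Suc n))\<^sup>2 * rsq x ^ n"
  unfolding Re_Im_pow_square[symmetric]
  by (simp add: grad_mode_def power_mult_distrib distrib_left del: of_nat_Suc)

lemma grad_mode_square_le: "(grad_mode k n x)\<^sup>2 \<le> (real (Suc n))\<^sup>2 * rsq x ^ n"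
  using grad_mode_square[of n x] exhaust_2[of k] zero_le_power2[of "grad_mode 1 n x"]
      zero_le_power2[of "grad_mode 2 n x"]
  by (metis add_increasing add_increasing2 order_refl)

text \<open>Growth in \<open>n\<close> is the source of the counterexample: all other square norms that are paired with
  \<open>pulse'\<close> are at most of order \<open>1 / (n + 1)\<close>.\<close>

lemma pressure_gradient_norm: "sq_norm (grad_mode 1 n) + sq_norm (grad_mode 2 n) =
    pi * real (Suc n)"
proof -
  have "sq_norm (grad_mode 1 n) + sq_norm (grad_mode 2 n) =
      (LINT x|lebesgue_on Omega. (grad_mode 1 n x)\<^sup>2 + (grad_mode 2 n x)\<^sup>2)"
    unfolding sq_norm_def using smooth_alg_L2[OF grad_mode_smooth]
    by (intro Bochner_Integration.integral_add[symmetric]) (auto simp: space_L2_def)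
  also have "\<dots> = (real (Suc n))\<^sup>2 * (pi / (real n + 1))"
    unfolding grad_mode_square by (simp add: integral_rsq_power)
  also have "\<dots> = pi * real (Suc n)" by (simp add: power2_eq_square field_simps)
  finally show ?thesis .
qed

lemma pressure_norm: "sq_norm (Re_pow (Suc n)) \<le> pi / real (Suc n)"
proof -
  have "sq_norm (Re_pow (Suc n)) \<le> 1 * (pi / (real (Suc n) + 1))"
    unfolding sq_norm_def
  proof (rule integral_square_le_moment)
    show "Re_pow (Suc n) \<in> smooth_alg" using Re_Im_pow_smooth by blast
    show "(Re_pow (Suc n) x)\<^sup>2 \<le> 1 * rsq x ^ Suc n" for x
      using Re_Im_pow_square_le(1)[of "Suc n" x] by (simp only: mult_1)
  qed
  also have "\<dots> \<le> pi / real (Suc n)" by (simp add: field_simps)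
  finally show ?thesis .
qed

text \<open>Division by the degree gains a factor \<open>n + 1\<close> over \<open>grad_mode\<close> in each of the three terms.\<close>

lemma velocity_potential_norm: "sq_norm (velocity_potential k n) \<le> 16 * pi / real (Suc n)"
proof -
  let ?c0 = "1 / (real n + 2)" and ?c1 = "- 2 / (real n + 2 + 2 * real (cutoff_degree n))"
    and ?c2 = "1 / (real n + 2 + 4 * real (cutoff_degree n))"
  let ?S = "\<bar>?c0\<bar> + \<bar>?c1\<bar> + \<bar>?c2\<bar>"
  have "\<bar>?c1\<bar> \<le> 2 / real (Suc n)" "\<bar>?c2\<bar> \<le> 1 / real (Suc n)" "\<bar>?c0\<bar> \<le> 1 / real (Suc n)"
    by (auto simp: abs_divide intro!: frac_le)
  moreover have "4 / real (Suc n) = 1 / real (Suc n) + 2 / real (Suc n) + 1 / real (Suc n)"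
    by (simp flip: add_divide_distrib)
  ultimately have "?S \<le> 4 / real (Suc n)" by linarith
  then have "?S\<^sup>2 \<le> (4 / real (Suc n))\<^sup>2" by (intro power_mono) auto
  then have S: "?S\<^sup>2 * (real (Suc n))\<^sup>2 \<le> 16"
    by (simp add: power_divide field_simps del: of_nat_Suc)
  have "sq_norm (velocity_potential k n) \<le> 16 * (pi / (real n + 1))"
    unfolding sq_norm_def
  proof (rule integral_square_le_moment[OF mode_smooth(2)])
    fix x assume x: "x \<in> Omega"
    have "(velocity_potential k n x)\<^sup>2 \<le> ?S\<^sup>2 * (grad_mode k n x)\<^sup>2"
      unfolding velocity_potential_def by (rule radial_mix_square_le[OF x])
    also have "\<dots> \<le> ?S\<^sup>2 * ((real (Suc n))\<^sup>2 * rsq x ^ n)"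
      by (intro mult_left_mono grad_mode_square_le) simp
    also have "\<dots> = (?S\<^sup>2 * (real (Suc n))\<^sup>2) * rsq x ^ n" by simp
    also have "\<dots> \<le> 16 * rsq x ^ n"
      using S rsq_nonneg by (intro mult_right_mono) auto
    finally show "(velocity_potential k n x)\<^sup>2 \<le> 16 * rsq x ^ n" .
  qed
  then show ?thesis by (simp add: add.commute)
qed

text \<open>The factor \<open>|x|\<^sup>2\<^sup>M\<close> concentrates this mode in the boundary layer.\<close>

lemma residual_norm: "sq_norm (residual_mode k n) \<le> 9 * pi / real (Suc n)"
proof -
  have "sq_norm (residual_mode k n) \<le> 9 * (real (Suc n))\<^sup>2 * (pi / (real (2 * cutoff_degree n) +
      1))"
    unfolding sq_norm_def
  proof (rule integral_square_le_moment[OF mode_smooth(3)])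
    fix x assume x: "x \<in> Omega"
    have r: "0 \<le> rsq x ^ k" "rsq x ^ k \<le> 1" for k
      using rsq_nonneg[of x] rsq_le_1[OF x] by (auto intro: power_le_one)
    have pw: "rsq x ^ (2 * cutoff_degree n) = rsq x ^ cutoff_degree n * rsq x ^ cutoff_degree n"
      by (simp only: mult_2 power_add)
    have eq: "residual_mode k n x = rsq x ^ cutoff_degree n *
        radial_mix (cutoff_degree n) (- 2) 1 0 (grad_mode k n) x"
      unfolding residual_mode_def radial_mix_def pw by (simp add: algebra_simps)
    have "(radial_mix (cutoff_degree n) (- 2) 1 0 (grad_mode k n) x)\<^sup>2 \<le>
        (\<bar>- 2\<bar> + \<bar>1\<bar> + \<bar>0\<bar>)\<^sup>2 * (grad_mode k n x)\<^sup>2"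
      by (rule radial_mix_square_le[OF x])
    also have "\<dots> \<le> 9 * ((real (Suc n))\<^sup>2 * rsq x ^ n)"
      using grad_mode_square_le[of k n x] by simp
    also have "\<dots> \<le> 9 * ((real (Suc n))\<^sup>2 * 1)"
      using r by (intro mult_left_mono) auto
    finally have "(rsq x ^ cutoff_degree n)\<^sup>2 *
        (radial_mix (cutoff_degree n) (- 2) 1 0 (grad_mode k n) x)\<^sup>2 \<le>
        (rsq x ^ cutoff_degree n)\<^sup>2 * (9 * ((real (Suc n))\<^sup>2 * 1))"
      by (rule mult_left_mono) simp
    then show "(residual_mode k n x)\<^sup>2 \<le> 9 * (real (Suc n))\<^sup>2 * rsq x ^ (2 * cutoff_degree n)"
      unfolding eq pw power_mult_distrib power2_eq_square[of "rsq x ^ cutoff_degree n"]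
      by (simp only: mult_1_right mult.commute)
  qed
  also have "\<dots> \<le> 9 * (real (Suc n))\<^sup>2 * (pi / (real (Suc n))^3)"
    by (intro mult_left_mono frac_le) (auto simp: cutoff_degree_def)
  also have "\<dots> = 9 * pi / real (Suc n)"
    by (simp add: power2_eq_square power3_eq_cube del: of_nat_Suc)
  finally show ?thesis .
qed

text \<open>Each coefficient of \<open>div_mode\<close> is of order \<open>M (n + 1)\<close> and is divided by a degree of order
  \<open>M\<close>; the factor \<open>|x|\<^sup>2\<^sup>M\<^sup>-\<^sup>2\<close> gains \<open>1 / M\<close> in the square norm.\<close>

lemma div_potential_norm: "sq_norm (div_potential n) \<le> 9 * pi / real (Suc n)"
proof -
  let ?D = "4 * real (cutoff_degree n) * real (Suc n)"
  let ?A = "- 4 * real (cutoff_degree n) * real (Suc n) / (div_degree n + 2)"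
    and ?B = "4 * real (cutoff_degree n) * real (Suc n) / (div_degree n + 2 + 2 *
        real (cutoff_degree n))"
  let ?S = "\<bar>?A\<bar> + \<bar>?B\<bar> + \<bar>0::real\<bar>"
  have cut: "real (cutoff_degree n) > 0" using cutoff_degree_pos[of n] by simp
  have deg: "div_degree n + 2 = real (Suc n) + 2 * real (cutoff_degree n)"
    using cutoff_degree_pos[of n] by (simp add: div_degree_def of_nat_diff)
  have "?D / (real (Suc n) + 2 * real (cutoff_degree n)) \<le> ?D / (2 * real (cutoff_degree n))"
    "?D / (real (Suc n) + 4 * real (cutoff_degree n)) \<le> ?D / (4 * real (cutoff_degree n))"
    using cut by (intro divide_left_mono mult_pos_pos; simp)+
  moreover have "?D / (2 * real (cutoff_degree n)) =
      2 * real (Suc n)" "?D / (4 * real (cutoff_degree n)) = real (Suc n)"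
    using cut by (simp_all add: field_simps)
  moreover have "\<bar>?A\<bar> = ?D / (real (Suc n) + 2 * real (cutoff_degree n))"
    "\<bar>?B\<bar> = ?D / (real (Suc n) + 4 * real (cutoff_degree n))"
    unfolding deg using cut by (simp_all add: abs_divide abs_mult)
  ultimately have "?S \<le> 3 * real (Suc n)" by linarith
  then have "?S\<^sup>2 \<le> (3 * real (Suc n))\<^sup>2" by (intro power_mono) auto
  moreover have "(3 * real (Suc n))\<^sup>2 = 9 * (real (Suc n))\<^sup>2"
    by (simp add: power_mult_distrib del: of_nat_Suc)
  ultimately have S: "?S\<^sup>2 \<le> 9 * (real (Suc n))\<^sup>2" by (simp only:)
  have "sq_norm (div_potential n) \<le> 9 * (real (Suc n))\<^sup>2 * (pi / (real (2 * (cutoff_degree n -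
      1)) + 1))"
    unfolding sq_norm_def
  proof (rule integral_square_le_moment[OF mode_smooth(5)])
    fix x assume x: "x \<in> Omega"
    have r: "0 \<le> rsq x ^ k" "rsq x ^ k \<le> 1" for k
      using rsq_nonneg[of x] rsq_le_1[OF x] by (auto intro: power_le_one)
    have "(div_potential n x)\<^sup>2 \<le> ?S\<^sup>2 * (div_core n x)\<^sup>2"
      unfolding div_potential_def by (rule radial_mix_square_le[OF x])
    also have "(div_core n x)\<^sup>2 = (Re_pow (Suc n) x)\<^sup>2 * rsq x ^ (2 * (cutoff_degree n - 1))"
      by (simp add: div_core_def power_mult_distrib power_even_eq)
    also have "\<dots> \<le> 1 * rsq x ^ (2 * (cutoff_degree n - 1))"
      using order_trans[OF Re_Im_pow_square_le(1) r(2)] r(1) by (intro mult_right_mono)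
    finally have "(div_potential n x)\<^sup>2 \<le> ?S\<^sup>2 * rsq x ^ (2 * (cutoff_degree n - 1))"
      by (simp add: mult_left_mono)
    also have "\<dots> \<le> 9 * (real (Suc n))\<^sup>2 * rsq x ^ (2 * (cutoff_degree n - 1))"
      using S r by (intro mult_right_mono) auto
    finally show "(div_potential n x)\<^sup>2 \<le> 9 * (real (Suc n))\<^sup>2 * rsq x ^ (2 * (cutoff_degree n -
        1))" .
  qed
  also have "\<dots> \<le> 9 * (real (Suc n))\<^sup>2 * (pi / (real (Suc n))^3)"
  proof -
    have "real (2 * (cutoff_degree n - 1)) + 1 \<ge> real (cutoff_degree n)" using
        cutoff_degree_pos[of n] by simp
    then have "real (2 * (cutoff_degree n - 1)) +
        1 \<ge> (real (Suc n))^3" by (simp add: cutoff_degree_def)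
    then show ?thesis by (intro mult_left_mono frac_le) auto
  qed
  also have "\<dots> = 9 * pi / real (Suc n)"
    by (simp add: power2_eq_square power3_eq_cube del: of_nat_Suc)
  finally show ?thesis .
qed

section \<open>The length of the pulses\<close>

lemma superpose_add: "slabbed a \<Longrightarrow>
  superpose a (\<lambda>n x. X n x + Y n x) z = superpose a X z + superpose a Y z"
  using superpose_sum[OF _ finite_slabs order_refl, where a = a and t = "snd z" and x = "fst z"]
  by (simp add: distrib_left sum.distrib)

lemma superpose_sum_modes: "slabbed a \<Longrightarrow>
  superpose a (\<lambda>n x. \<Sum>j\<in>J. X j n x) z = (\<Sum>j\<in>J. superpose a (X j) z)"
  using superpose_sum[OF _ finite_slabs order_refl, where a = a and t = "snd z" and x = "fst z"]
  by (simp add: sum_distrib_left) (rule sum.swap)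

lemma superpose_test_integrable:
  assumes "slabbed a" "\<And>n. continuous_on UNIV (a n)" "\<And>n. continuous_on UNIV (V n)"
    and \<phi>: "\<phi> \<in> test_functions Qcyl"
  shows "integrable (lebesgue_on Qcyl) (\<lambda>z. superpose a V z * \<phi> z)"
proof -
  obtain M where M: "\<forall>a V. slabbed a \<longrightarrow>
    (\<forall>z. superpose a V z * \<phi> z = tensor_sum M a V z * \<phi> z) \<and>
    (\<forall>b z. superpose a V z * dir_deriv b \<phi> z = tensor_sum M a V z * dir_deriv b \<phi> z)"
    using superpose_tensor_sum_test[OF \<phi>] ..
  have "continuous_on UNIV (tensor_sum M a V)"
    unfolding tensor_sum_def[abs_def]
    by (intro continuous_intros continuous_on_compose2[OF assms(2)] continuous_on_compose2[OF
        assms(3)]) auto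
  then have "tensor_sum M a V \<in> space_L2 (lebesgue_on Qcyl)"
    by (intro space_L2_continuous Qcyl_bounded Qcyl_measurable)
  then have "integrable (lebesgue_on Qcyl) (\<lambda>z. tensor_sum M a V z * \<phi> z)"
    by (rule space_L2_mult_integrable[OF _ test_function_L2[OF \<phi> Qcyl_measurable(1)]])
  moreover have "superpose a V z * \<phi> z = tensor_sum M a V z * \<phi> z" for z
    using M assms(1) by blast
  ultimately show ?thesis by (simp only:)
qed

definition laplacian_mode :: "2 \<Rightarrow> nat \<Rightarrow> real ^ 2 \<Rightarrow> real" where
  "laplacian_mode k n x = (\<Sum>j\<in>UNIV. dir_deriv (axis j 1) (dir_deriv (axis j 1) (velocity_mode k
      n)) x)"

text \<open>A common bound for everything that is multiplied by \<open>pulse\<close>; the pulses are chosen afterwards,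
  short enough to compensate its growth in \<open>n\<close>.\<close>

definition mode_size :: "nat \<Rightarrow> real" where
  "mode_size n = (\<Sum>k\<in>UNIV. sq_norm (velocity_mode k n)) + (\<Sum>k\<in>UNIV. sq_norm (laplacian_mode k n)) +
     (\<Sum>k\<in>UNIV. \<Sum>i\<in>UNIV. sq_norm (dir_deriv (axis i 1) (velocity_mode k n))) +
     sq_norm (div_mode n) + (\<Sum>i\<in>UNIV. sq_norm (dir_deriv (axis i 1) (div_mode n)))"

text \<open>Short enough to absorb \<open>mode_size n\<close> and to keep the pulse inside its slab.\<close>

definition pulse_length :: "nat \<Rightarrow> real" where
  "pulse_length n = (1/4) ^ Suc n / (1 + mode_size n)"

lemma laplacian_mode_smooth: "laplacian_mode k n \<in> smooth_alg"
  unfolding laplacian_mode_def[abs_def] UNIV_2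
  using mode_smooth(1) by (simp add: smooth_alg.add smooth_alg_dir_deriv)

lemma mode_size_nonneg: "mode_size n \<ge> 0"
  unfolding mode_size_def by (intro add_nonneg_nonneg sum_nonneg) auto

lemma mode_size_bounds:
  "sq_norm (velocity_mode k n) \<le> mode_size n" "sq_norm (laplacian_mode k n) \<le> mode_size n"
  "sq_norm (dir_deriv (axis i 1) (velocity_mode k n)) \<le> mode_size n"
  "sq_norm (div_mode n) \<le> mode_size n" "sq_norm (dir_deriv (axis i 1) (div_mode n)) \<le> mode_size n"
proof -
  let ?A = "\<lambda>k. sq_norm (velocity_mode k n)" and ?B = "\<lambda>k. sq_norm (laplacian_mode k n)"
    and ?C = "\<lambda>k i. sq_norm (dir_deriv (axis i 1) (velocity_mode k n))"
    and ?E = "\<lambda>i. sq_norm (dir_deriv (axis i 1) (div_mode n))"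
  have "?A k \<le> (\<Sum>k\<in>UNIV. ?A k)" "?B k \<le> (\<Sum>k\<in>UNIV. ?B k)" "?E i \<le> (\<Sum>i\<in>UNIV. ?E i)"
    by (rule member_le_sum; simp)+
  moreover have "?C k i \<le> (\<Sum>k\<in>UNIV. \<Sum>i\<in>UNIV. ?C k i)"
  proof -
    have "?C k i \<le> (\<Sum>i\<in>UNIV. ?C k i)" by (rule member_le_sum) simp_all
    also have "\<dots> \<le> (\<Sum>k\<in>UNIV. \<Sum>i\<in>UNIV. ?C k i)"
      by (rule member_le_sum[of k UNIV "\<lambda>k. \<Sum>i\<in>UNIV. ?C k i"]) (auto intro!: sum_nonneg)
    finally show ?thesis .
  qed
  moreover have "0 \<le> (\<Sum>k\<in>UNIV. ?A k)" "0 \<le> (\<Sum>k\<in>UNIV. ?B k)" "0 \<le> (\<Sum>k\<in>UNIV. \<Sum>i\<in>UNIV. ?C k i)"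
    "0 \<le> (\<Sum>i\<in>UNIV. ?E i)" "0 \<le> sq_norm (div_mode n)"
    by (auto intro!: sum_nonneg)
  ultimately show "sq_norm (velocity_mode k n) \<le> mode_size n" "sq_norm (laplacian_mode k n) \<le>
      mode_size n"
    "sq_norm (dir_deriv (axis i 1) (velocity_mode k n)) \<le> mode_size n"
    "sq_norm (div_mode n) \<le> mode_size n" "sq_norm (dir_deriv (axis i 1) (div_mode n)) \<le> mode_size n"
    unfolding mode_size_def by linarith+
qed

lemma pulse_length_pos: "pulse_length n > 0"
  using mode_size_nonneg[of n] by (simp add: pulse_length_def add_pos_nonneg)

lemma pulse_length_mode_size: "pulse_length n * mode_size n \<le> (1/4) ^ Suc n"
proof -
  have "pulse_length n * mode_size n = (1/4) ^ Suc n * (mode_size n / (1 + mode_size n))"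
    by (simp add: pulse_length_def)
  also have "\<dots> \<le> (1/4) ^ Suc n * 1"
    using mode_size_nonneg[of n] by (intro mult_left_mono) auto
  finally show ?thesis by simp
qed

lemma pulse_length_le: "pulse_length n \<le> (1/4) ^ Suc n"
proof -
  have "(1/4::real) ^ Suc n / (1 + mode_size n) \<le> (1/4) ^ Suc n / 1"
    using mode_size_nonneg[of n] by (intro divide_left_mono) auto
  then show ?thesis by (simp add: pulse_length_def)
qed

interpretation pulse_train pulse_length
proof
  fix n
  show "0 < pulse_length n" by (rule pulse_length_pos)
  have "(1/4::real) ^ Suc n \<le> (1/2) ^ Suc n" by (rule power_mono) auto
  then show "pulse_length n \<le> (1/2) ^ Suc n" using pulse_length_le[of n] by linarith
qed

text \<open>The square integral of the pulse is at most a constant times the square of its length, and one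
  factor of the length already absorbs \<open>mode_size\<close>.\<close>

lemma summable_pulse:
  assumes "\<And>n. sq_norm (X n) \<le> mode_size n"
  shows "summable (\<lambda>n. (LINT t|lborel. (pulse n t)\<^sup>2) * (LINT x|lebesgue_on Omega. (X n x)\<^sup>2))"
proof (rule summable_comparison_test'[of "\<lambda>n. (LINT s|lborel. (bump s)\<^sup>2) * (1/4) ^ Suc n" 0])
  let ?I = "LINT s|lborel. (bump s)\<^sup>2"
  show "summable (\<lambda>n. ?I * (1/4) ^ Suc n)"
    by (intro summable_mult summable_Suc_iff[THEN iffD2] summable_geometric) simp
  fix n :: nat
  have le1: "pulse_length n \<le> 1"
    using pulse_length_le[of n] power_le_one[of "1/4::real" "Suc n"] by linarith
  have "(pulse_length n)\<^sup>2 / real (Suc n) * sq_norm (X n) \<le> (pulse_length n)\<^sup>2 / 1 * mode_size n"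
    using assms[of n] by (intro mult_mono frac_le) auto
  also have "\<dots> = pulse_length n * (pulse_length n * mode_size n)" by (simp add: power2_eq_square)
  also have "\<dots> \<le> 1 * (1/4) ^ Suc n"
    using le1 pulse_length_mode_size[of n] pulse_length_pos[of n] mode_size_nonneg[of n]
    by (intro mult_mono) auto
  finally have "?I * ((pulse_length n)\<^sup>2 / real (Suc n) * sq_norm (X n)) \<le> ?I * (1/4) ^ Suc n"
    by (intro mult_left_mono) auto
  then show "norm ((LINT t|lborel. (pulse n t)\<^sup>2) * (LINT x|lebesgue_on Omega. (X n x)\<^sup>2)) \<le>
      ?I * (1/4) ^ Suc n"
    unfolding pulse_square_integral sq_norm_def by (simp add: abs_mult mult_ac)
qed

lemma summable_pulse':
  assumes "\<And>n. sq_norm (X n) \<le> C / real (Suc n)"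
  shows "summable (\<lambda>n. (LINT t|lborel. (pulse' n t)\<^sup>2) * (LINT x|lebesgue_on Omega. (X n x)\<^sup>2))"
proof (rule summable_comparison_test'[of "\<lambda>n. (LINT s|lborel. (bump' s)\<^sup>2) * C *
    (1 / real (Suc n) ^ 2)" 0])
  let ?I = "LINT s|lborel. (bump' s)\<^sup>2"
  have "summable (\<lambda>n. 1 / real n ^ 2)" using inverse_power_summable[of 2] by (simp add:
      inverse_eq_divide)
  then show "summable (\<lambda>n. ?I * C * (1 / real (Suc n) ^ 2))"
    by (intro summable_mult) (subst summable_Suc_iff)
  fix n :: nat
  have "?I / real (Suc n) * sq_norm (X n) \<le> ?I / real (Suc n) * (C / real (Suc n))"
    by (intro mult_left_mono assms) auto
  then show "norm ((LINT t|lborel. (pulse' n t)\<^sup>2) * (LINT x|lebesgue_on Omega. (X n x)\<^sup>2)) \<le>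
      ?I * C * (1 / real (Suc n) ^ 2)"
    unfolding pulse'_square_integral sq_norm_def by (simp add: abs_mult power2_eq_square)
qed

lemma superpose_pulse_L2:
  assumes "\<And>n. X n \<in> smooth_alg" "\<And>n. sq_norm (X n) \<le> mode_size n"
  shows "superpose pulse X \<in> space_L2 (lebesgue_on Qcyl)"
  using assms
  by (intro superpose_L2 pulse_slabbed pulse_square_integrable smooth_alg_L2 summable_pulse
      borel_measurable_continuous_onI pulse_continuous Ck_1_continuous smooth_alg_C1) auto

lemma superpose_pulse'_L2:
  assumes "\<And>n. X n \<in> smooth_alg" "\<And>n. sq_norm (X n) \<le> C / real (Suc n)"
  shows "superpose pulse' X \<in> space_L2 (lebesgue_on Qcyl)"
  by (intro superpose_L2 pulse_slabbed pulse_square_integrable smooth_alg_L2 summable_pulse'[OF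
      assms(2)] assms(1)
      borel_measurable_continuous_onI pulse_continuous Ck_1_continuous smooth_alg_C1)

lemma pulse_C_L2_bound:
  assumes "sq_norm (X n) \<le> mode_size n"
  shows "\<bar>pulse n t\<bar> * norm_L2 (lebesgue_on Omega) (X n) \<le> (1/2) ^ Suc n"
proof -
  have "\<bar>pulse n t\<bar> * norm_L2 (lebesgue_on Omega) (X n) \<le>
      sqrt (pulse_length n) * sqrt (mode_size n)"
    using assms pulse_bound[of n t] pulse_length_pos[of n] unfolding norm_L2_def sq_norm_def
    by (intro mult_mono) auto
  also have "\<dots> \<le> sqrt ((1/4) ^ Suc n)"
    unfolding real_sqrt_mult[symmetric] by (intro real_sqrt_le_mono pulse_length_mode_size)
  also have "\<dots> = (1/2) ^ Suc n"
    by (simp add: real_sqrt_power real_sqrt_divide real_sqrt_mult)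
  finally show ?thesis .
qed

lemma distr_deriv_pulse:
  assumes "\<And>n. V n \<in> smooth_alg" "\<phi> \<in> test_functions Qcyl"
  shows "distr_deriv (e_x i) (regular_distr Qcyl (superpose pulse V)) \<phi> =
      regular_distr Qcyl (superpose pulse (\<lambda>n. dir_deriv (axis i 1) (V n))) \<phi>"
    and "distr_deriv e_t (regular_distr Qcyl (superpose pulse V)) \<phi> =
      regular_distr Qcyl (superpose pulse' V) \<phi>"
    and "distr_deriv (e_x i) (regular_distr Qcyl (superpose pulse' V)) \<phi> =
      regular_distr Qcyl (superpose pulse' (\<lambda>n. dir_deriv (axis i 1) (V n))) \<phi>"
  using distr_deriv_superpose[OF pulse_deriv pulse_continuous(2) smooth_alg_C1[OF assms(1)]
      pulse_slabbed(1,2) assms(2)]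
    distr_deriv_superpose(1)[OF pulse'_deriv pulse_continuous(3) smooth_alg_C1[OF assms(1)]
      pulse_slabbed(2,3) assms(2)] by auto

lemma superpose_pulse_W10:
  assumes "\<And>n. V n \<in> smooth_alg" "\<And>n. sq_norm (V n) \<le> mode_size n"
    "\<And>n i. sq_norm (dir_deriv (axis i 1) (V n)) \<le> mode_size n"
  shows "superpose pulse V \<in> W10_2"
proof -
  have d: "superpose pulse (\<lambda>n. dir_deriv (axis i 1) (V n)) \<in> space_L2 (lebesgue_on Qcyl)" for i
    by (intro superpose_pulse_L2 smooth_alg_dir_deriv assms)
  have "grad_in_L2 (superpose pulse V)"
    unfolding grad_in_L2_def distr_in_L2_def distr_eq_def
  proof
    fix i
    show "\<exists>w\<in>space_L2 (lebesgue_on Qcyl). \<forall>\<phi>\<in>test_functions Qcyl.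
        distr_deriv (e_x i) (regular_distr Qcyl (superpose pulse V)) \<phi> = regular_distr Qcyl w \<phi>"
      by (rule bexI[OF _ d[of i]]) (intro ballI distr_deriv_pulse(1)[of V, OF assms(1)])
  qed
  then show ?thesis using superpose_pulse_L2[OF assms(1,2)] by (simp add: W10_2_def)
qed

section \<open>The counterexample\<close>

definition velocity :: "(real ^ 2) \<times> real \<Rightarrow> real ^ 2" where
  "velocity z = (\<chi> k. superpose pulse (velocity_mode k) z)"

text \<open>Its gradient cancels the gradient part of the time derivative of the velocity.\<close>

definition pressure :: "(real ^ 2) \<times> real \<Rightarrow> real" where
  "pressure z = - superpose pulse' (\<lambda>n. Re_pow (Suc n)) z"

definition divergence :: "(real ^ 2) \<times> real \<Rightarrow> real" where
  "divergence = superpose pulse div_mode"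

definition force :: "(real ^ 2) \<times> real \<Rightarrow> real ^ 2" where
  "force z = (\<chi> k. superpose pulse' (residual_mode k) z - superpose pulse (laplacian_mode k) z)"

lemma residual_mode_eq: "velocity_mode k n x = residual_mode k n x + grad_mode k n x"
  by (simp add: velocity_mode_def residual_mode_def radial_mix_def algebra_simps)

lemma distr_deriv_pressure:
  assumes "\<phi> \<in> test_functions Qcyl"
  shows "distr_deriv (e_x k) (regular_distr Qcyl pressure) \<phi> =
      - regular_distr Qcyl (superpose pulse' (grad_mode k)) \<phi>"
proof -
  have sm: "\<And>n. Re_pow (Suc n) \<in> smooth_alg" using Re_Im_pow_smooth by blast
  have "distr_deriv (e_x k) (regular_distr Qcyl pressure) \<phi> =
      - distr_deriv (e_x k) (regular_distr Qcyl (superpose pulse' (\<lambda>n. Re_pow (Suc n)))) \<phi>"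
    by (simp add: distr_deriv_def regular_distr_def pressure_def)
  also have "\<dots> = - regular_distr Qcyl (superpose pulse' (grad_mode k)) \<phi>"
    using distr_deriv_pulse(3)[of "\<lambda>n. Re_pow (Suc n)", OF sm assms] by (simp add:
        pressure_gradient)
  finally show ?thesis .
qed

lemma momentum_eq_example: "momentum_eq velocity pressure force"
proof -
  have "distr_deriv e_t (regular_distr Qcyl (superpose pulse (velocity_mode k))) \<phi>
      - (\<Sum>j\<in>UNIV. distr_deriv (e_x j) (distr_deriv (e_x j) (regular_distr Qcyl (superpose pulse
          (velocity_mode k)))) \<phi>)
      + distr_deriv (e_x k) (regular_distr Qcyl pressure) \<phi>
      = regular_distr Qcyl (\<lambda>z. superpose pulse' (residual_mode k) z -
          superpose pulse (laplacian_mode k) z) \<phi>"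
    (is "?L = ?R") if \<phi>: "\<phi> \<in> test_functions Qcyl" for k \<phi>
  proof -
    let ?dd = "\<lambda>j n. dir_deriv (axis j 1) (dir_deriv (axis j 1) (velocity_mode k n))"
    let ?M = "lebesgue_on Qcyl"
    have sm: "\<And>j n. dir_deriv (axis j 1) (velocity_mode k n) \<in> smooth_alg" "\<And>j n. ?dd j n \<in>
        smooth_alg"
      by (intro smooth_alg_dir_deriv mode_smooth)+
    have int: "integrable ?M (\<lambda>z. superpose pulse X z *
        \<phi> z)" "integrable ?M (\<lambda>z. superpose pulse' X z * \<phi> z)"
      if "\<And>n. X n \<in> smooth_alg" for X
      by (intro superpose_test_integrable pulse_slabbed pulse_continuous Ck_1_continuous
          smooth_alg_C1 that \<phi>)+
    have second: "distr_deriv (e_x j) (distr_deriv (e_x j) (regular_distr Qcyl (superpose pulse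
        (velocity_mode k)))) \<phi>
        = regular_distr Qcyl (superpose pulse (?dd j)) \<phi>" for j
    proof -
      have "distr_deriv (e_x j) (distr_deriv (e_x j) (regular_distr Qcyl (superpose pulse
          (velocity_mode k)))) \<phi> =
          - distr_deriv (e_x j) (regular_distr Qcyl (superpose pulse (velocity_mode k)))
              (dir_deriv (e_x j) \<phi>)"
        by (simp only: distr_deriv_def)
      also have "\<dots> = - regular_distr Qcyl (superpose pulse (\<lambda>n. dir_deriv (axis j 1)
          (velocity_mode k n)))
          (dir_deriv (e_x j) \<phi>)"
        using distr_deriv_pulse(1)[of "velocity_mode k", OF mode_smooth(1) test_functionD(5)[OF \<phi>
            e_Basis(1)]] by simp
      also have "\<dots> = distr_deriv (e_x j) (regular_distr Qcyl
          (superpose pulse (\<lambda>n. dir_deriv (axis j 1) (velocity_mode k n)))) \<phi>"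
        by (simp only: distr_deriv_def)
      also have "\<dots> = regular_distr Qcyl (superpose pulse (?dd j)) \<phi>"
        by (rule distr_deriv_pulse(1)[of "\<lambda>n. dir_deriv (axis j 1) (velocity_mode k n)", OF sm(1)
            \<phi>])
      finally show ?thesis .
    qed
    have lap: "(\<Sum>j\<in>UNIV. regular_distr Qcyl (superpose pulse (?dd j)) \<phi>) =
        regular_distr Qcyl (superpose pulse (laplacian_mode k)) \<phi>"
    proof -
      have "superpose pulse (laplacian_mode k) z = (\<Sum>j\<in>UNIV. superpose pulse (?dd j) z)" for z
        unfolding laplacian_mode_def[abs_def] by (rule superpose_sum_modes[OF pulse_slabbed(1)])
      then show ?thesis unfolding regular_distr_def
        by (simp add: sum_distrib_right Bochner_Integration.integral_sum int(1)[OF sm(2)])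
    qed
    have sup: "superpose pulse' (velocity_mode k) z =
        superpose pulse' (residual_mode k) z + superpose pulse' (grad_mode k) z" for z
      using superpose_add[OF pulse_slabbed(2), of "residual_mode k" "grad_mode k" z]
      by (simp flip: residual_mode_eq)
    have "?L = regular_distr Qcyl (superpose pulse' (velocity_mode k)) \<phi>
        - regular_distr Qcyl (superpose pulse (laplacian_mode k)) \<phi>
        - regular_distr Qcyl (superpose pulse' (grad_mode k)) \<phi>"
      unfolding second lap distr_deriv_pressure[OF \<phi>]
      using distr_deriv_pulse(2)[of "velocity_mode k", OF mode_smooth(1) \<phi>] by simp
    also have "\<dots> = ?R"
      unfolding regular_distr_def sup
      using int(1)[of "laplacian_mode k"] int(2)[of "residual_mode k"] int(2)[of "grad_mode k"]
        laplacian_mode_smooth mode_smooth grad_mode_smooth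
      by (simp add: distrib_right left_diff_distrib)
    finally show ?thesis .
  qed
  then show ?thesis
    by (simp add: momentum_eq_def Let_def distr_eq_def velocity_def force_def)
qed

lemma divergence_eq_example: "divergence_eq velocity divergence"
proof -
  have "(\<Sum>k\<in>UNIV. distr_deriv (e_x k) (regular_distr Qcyl (superpose pulse (velocity_mode k))) \<phi>) =
      regular_distr Qcyl divergence \<phi>" if \<phi>: "\<phi> \<in> test_functions Qcyl" for \<phi>
  proof -
    let ?d = "\<lambda>k n. dir_deriv (axis k 1) (velocity_mode k n)"
    have int: "integrable (lebesgue_on Qcyl) (\<lambda>z. superpose pulse (?d k) z * \<phi> z)" for k
      by (intro superpose_test_integrable pulse_slabbed pulse_continuous Ck_1_continuous
          smooth_alg_C1
          smooth_alg_dir_deriv mode_smooth \<phi>)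
    have div: "divergence z = (\<Sum>k\<in>UNIV. superpose pulse (?d k) z)" for z
      unfolding divergence_def using superpose_sum_modes[OF pulse_slabbed(1), where J =
          UNIV and X = ?d and z = z]
      by (simp add: divergence_of_velocity_mode)
    have "(\<Sum>k\<in>UNIV. distr_deriv (e_x k) (regular_distr Qcyl (superpose pulse (velocity_mode k)))
        \<phi>) =
        (\<Sum>k\<in>UNIV. regular_distr Qcyl (superpose pulse (?d k)) \<phi>)"
      using distr_deriv_pulse(1)[of "velocity_mode _", OF mode_smooth(1) \<phi>] by (intro sum.cong refl)
    also have "\<dots> = regular_distr Qcyl divergence \<phi>"
      unfolding regular_distr_def div
      by (simp add: sum_distrib_right Bochner_Integration.integral_sum int)
    finally show ?thesis .
  qed
  then show ?thesis by (simp add: divergence_eq_def distr_eq_def velocity_def)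
qed

text \<open>On these subcylinders a superposition is a finite sum, hence bounded, so that uniqueness of
  regular distributions applies to it.\<close>

definition early_cylinder :: "nat \<Rightarrow> ((real ^ 2) \<times> real) set" where
  "early_cylinder M = Omega \<times> {-1<..<- ((1/2) ^ M)}"

lemma early_cylinder: "open (early_cylinder M)" "bounded (early_cylinder M)" "early_cylinder M \<subseteq>
    Qcyl" "(\<Union>M. early_cylinder M) = Qcyl"
proof -
  show "open (early_cylinder M)" by (auto simp: early_cylinder_def intro!: open_Times Omega_open)
  show "bounded (early_cylinder M)" by (auto simp: early_cylinder_def intro!: bounded_Times
      Omega_bounded)
  have neg: "- ((1/2) ^ M) < (0::real)" for M by simp
  show sub: "early_cylinder M \<subseteq> Qcyl" for M
    using neg[of M] by (auto simp: early_cylinder_def Qcyl_def Tint_def simp del: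
        neg_less_0_iff_less)
  show "(\<Union>M. early_cylinder M) = Qcyl"
  proof
    show "Qcyl \<subseteq> (\<Union>M. early_cylinder M)"
    proof
      fix z assume z: "z \<in> Qcyl"
      then have "snd z < 0" by (auto simp: Qcyl_def Tint_def)
      then obtain M where "(1/2) ^ M < - snd z" using real_arch_pow_inv[of "- snd z" "1/2"] by auto
      then have "z \<in> early_cylinder M" using z by (auto simp: early_cylinder_def Qcyl_def Tint_def)
      then show "z \<in> (\<Union>M. early_cylinder M)" by blast
    qed
  qed (use sub in blast)
qed

lemma regular_distr_subset:
  assumes "U \<subseteq> V" "U \<in> sets lebesgue" "V \<in> sets lebesgue" "\<phi> \<in> test_functions U"
  shows "regular_distr U w \<phi> = regular_distr V w \<phi>"
proof -
  have \<phi>0: "\<phi> x = 0" if "x \<notin> U" for x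
    using test_function_support[OF assms(4)] that by (metis subsetD)
  have "regular_distr U w \<phi> = (LINT x|lebesgue. indicator U x *\<^sub>R (w x * \<phi> x))"
    unfolding regular_distr_def using assms(2) by (intro integral_restrict_space) simp
  also have "\<dots> = (LINT x|lebesgue. indicator V x *\<^sub>R (w x * \<phi> x))"
    using \<phi>0 assms(1) by (intro Bochner_Integration.integral_cong refl) (auto simp: indicator_def)
  also have "\<dots> = regular_distr V w \<phi>"
    unfolding regular_distr_def using assms(3) by (intro integral_restrict_space[symmetric]) simp
  finally show ?thesis .
qed

lemma test_functions_mono: "U \<subseteq> V \<Longrightarrow> \<phi> \<in> test_functions U \<Longrightarrow> \<phi> \<in> test_functions V"
  by (auto simp: test_functions_def)

lemma space_L2_subset:
  assumes "w \<in> space_L2 (lebesgue_on V)" "U \<subseteq> V" "U \<in> sets lebesgue" "V \<in> sets lebesgue"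
  shows "w \<in> space_L2 (lebesgue_on U)"
proof -
  have m: "w \<in> borel_measurable (lebesgue_on V)" and i: "integrable (lebesgue_on V) (\<lambda>x. (w x)\<^sup>2)"
    using assms(1) by (auto simp: space_L2_def)
  have "w \<in> borel_measurable (lebesgue_on U)"
    using m assms(2) by (rule measurable_restrict_mono)
  moreover have "integrable (lebesgue_on U) (\<lambda>x. (w x)\<^sup>2)"
  proof -
    have "integrable lebesgue (\<lambda>x. indicator V x *\<^sub>R (w x)\<^sup>2)"
      using i assms(4) by (subst (asm) integrable_restrict_space) auto
    then have "integrable lebesgue (\<lambda>x. indicator U x *\<^sub>R (indicator V x *\<^sub>R (w x)\<^sup>2))"
      by (rule integrable_mult_indicator[OF assms(3)])
    also have "(\<lambda>x. indicator U x *\<^sub>R (indicator V x *\<^sub>R (w x)\<^sup>2)) =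
        (\<lambda>x. indicator U x *\<^sub>R (w x)\<^sup>2)"
      using assms(2) by (auto simp: indicator_def fun_eq_iff)
    finally show ?thesis using assms(3) by (subst integrable_restrict_space) auto
  qed
  ultimately show ?thesis by (simp add: space_L2_def)
qed

text \<open>A square-integrable gradient would agree with the classical one on every \<open>early_cylinder M\<close>,
  hence on the whole cylinder. But the square integral of the classical gradient is a series
  with constant terms.\<close>

lemma pressure_gradient_not_L2: "\<not> grad_in_L2 pressure"
proof
  assume "grad_in_L2 pressure"
  have fin: "(\<Sum>n. ennreal ((LINT t|lborel. (pulse' n t)\<^sup>2) * sq_norm (grad_mode i n))) < \<infinity>" for i
  proof -
    let ?S = "superpose pulse' (grad_mode i)"
    obtain w where w: "w \<in> space_L2 (lebesgue_on Qcyl)"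
      "\<And>\<phi>. \<phi> \<in> test_functions Qcyl \<Longrightarrow>
        distr_deriv (e_x i) (regular_distr Qcyl pressure) \<phi> = regular_distr Qcyl w \<phi>"
      using \<open>grad_in_L2 pressure\<close> unfolding grad_in_L2_def distr_in_L2_def distr_eq_def by blast
    have ci: "continuous_on UNIV (grad_mode i n)" for n
      by (rule Ck_1_continuous[OF smooth_alg_C1[OF grad_mode_smooth]])
    have [measurable]: "?S \<in> borel_measurable borel"
      by (intro superpose_measurable borel_measurable_continuous_onI pulse_continuous ci)
    have AE_early: "AE z in lebesgue. z \<in> early_cylinder M \<longrightarrow> - w z = ?S z" for M
    proof -
      have em: "early_cylinder M \<in> sets lebesgue" using early_cylinder(1) by auto
      have eq: "?S z = tensor_sum M pulse' (grad_mode i) z" if "z \<in> early_cylinder M" for z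
        using superpose_finite[OF pulse_slabbed(2), of "snd z" M "grad_mode i" "fst z"] that
        by (auto simp: early_cylinder_def tensor_sum_def)
      have "continuous_on UNIV (tensor_sum M pulse' (grad_mode i))"
        unfolding tensor_sum_def[abs_def]
        by (intro continuous_intros continuous_on_compose2[OF pulse_continuous(2)]
            continuous_on_compose2[OF ci]) auto
      then have T: "tensor_sum M pulse' (grad_mode i) \<in> space_L2 (lebesgue_on (early_cylinder M))"
        by (intro space_L2_continuous early_cylinder em)
      have "AE z in lebesgue_on (early_cylinder M). - 1 * w z = tensor_sum M pulse' (grad_mode i) z"
      proof (rule regular_distr_unique[OF early_cylinder(1,2) _ T])
        show "(\<lambda>z. - 1 * w z) \<in> space_L2 (lebesgue_on (early_cylinder M))"
          by (intro space_L2_cmult space_L2_subset[OF w(1) early_cylinder(3) em Qcyl_measurable(1)])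
        fix \<phi> assume \<phi>: "\<phi> \<in> test_functions (early_cylinder M)"
        have \<phi>Q: "\<phi> \<in> test_functions Qcyl" by (rule test_functions_mono[OF early_cylinder(3) \<phi>])
        have "regular_distr (early_cylinder M) (\<lambda>z. - 1 * w z) \<phi> = - regular_distr Qcyl w \<phi>"
          unfolding regular_distr_cmult regular_distr_subset[OF early_cylinder(3) em
              Qcyl_measurable(1) \<phi>] by simp
        also have "\<dots> = regular_distr Qcyl ?S \<phi>"
          using w(2)[OF \<phi>Q] distr_deriv_pressure[OF \<phi>Q] by simp
        also have "\<dots> = regular_distr (early_cylinder M) ?S \<phi>"
          by (rule regular_distr_subset[OF early_cylinder(3) em Qcyl_measurable(1) \<phi>, symmetric])
        also have "\<dots> = regular_distr (early_cylinder M) (tensor_sum M pulse' (grad_mode i)) \<phi>"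
          unfolding regular_distr_def by (rule Bochner_Integration.integral_cong) (auto simp: eq)
        finally show "regular_distr (early_cylinder M) (\<lambda>z. - 1 * w z) \<phi> =
            regular_distr (early_cylinder M) (tensor_sum M pulse' (grad_mode i)) \<phi>" .
      qed
      then have "AE z in lebesgue. z \<in> early_cylinder M \<longrightarrow> - w z =
          tensor_sum M pulse' (grad_mode i) z"
        using em by (simp add: AE_restrict_space_iff)
      then show ?thesis by eventually_elim (simp add: eq)
    qed
    have "AE z in lebesgue. \<forall>M. z \<in> early_cylinder M \<longrightarrow> - w z = ?S z"
      unfolding AE_all_countable using AE_early by blast
    then have AE_Q: "AE z in lebesgue. z \<in> Qcyl \<longrightarrow> (?S z)\<^sup>2 = (w z)\<^sup>2"
      by eventually_elim (use early_cylinder(4) in \<open>metis UN_iff power2_minus\<close>)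
    have "(\<Sum>n. ennreal ((LINT t|lborel. (pulse' n t)\<^sup>2) * sq_norm (grad_mode i n))) =
        (\<integral>\<^sup>+z. ennreal ((?S z)\<^sup>2) * indicator Qcyl z \<partial>lborel)"
      unfolding sq_norm_def
      by (rule nn_integral_superpose[symmetric])
        (auto intro!: pulse_slabbed borel_measurable_continuous_onI pulse_continuous ci
          pulse_square_integrable smooth_alg_L2 grad_mode_smooth)
    also have "\<dots> = (\<integral>\<^sup>+z. ennreal ((?S z)\<^sup>2) * indicator Qcyl z \<partial>lebesgue)"
      by (rule nn_integral_completion[symmetric])
    also have "\<dots> = (\<integral>\<^sup>+z. ennreal ((w z)\<^sup>2) * indicator Qcyl z \<partial>lebesgue)"
      by (rule nn_integral_cong_AE) (use AE_Q in \<open>eventually_elim, auto simp: indicator_def\<close>)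
    also have "\<dots> = (\<integral>\<^sup>+z. ennreal ((w z)\<^sup>2) \<partial>lebesgue_on Qcyl)"
      using Qcyl_measurable(1) by (simp add: nn_integral_restrict_space)
    also have "\<dots> < \<infinity>"
      using w(1) by (auto simp: space_L2_def nn_integral_eq_integral)
    finally show ?thesis .
  qed
  let ?I = "LINT s|lborel. (bump' s)\<^sup>2"
  let ?a = "\<lambda>i n. (LINT t|lborel. (pulse' n t)\<^sup>2) * sq_norm (grad_mode i n)"
  have "summable (?a i)" for i
    by (rule summable_suminf_not_top) (use fin[of i] in \<open>auto simp: less_top\<close>)
  then have "summable (\<lambda>n. ?a 1 n + ?a 2 n)" by (intro summable_add)
  moreover have "?a 1 n + ?a 2 n = ?I * pi" for n
  proof -
    have "?a 1 n + ?a 2 n = ?I / real (Suc n) * (sq_norm (grad_mode 1 n) + sq_norm (grad_mode 2 n))"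
      unfolding pulse'_square_integral by (simp only: distrib_left)
    then show ?thesis unfolding pressure_gradient_norm by (simp del: of_nat_Suc)
  qed
  ultimately have "summable (\<lambda>n::nat. ?I * pi)" by simp
  then have "?I * pi = 0" by (simp add: summable_const_iff)
  then show False using integral_bump'_square_pos by simp
qed

lemma force_L2: "(\<lambda>z. force z $ k) \<in> space_L2 (lebesgue_on Qcyl)"
proof -
  have "(\<lambda>z. superpose pulse' (residual_mode k) z -
      superpose pulse (laplacian_mode k) z) \<in> space_L2 (lebesgue_on Qcyl)"
    by (rule space_L2_diff[OF superpose_pulse'_L2[OF mode_smooth(3) residual_norm]
          superpose_pulse_L2[OF laplacian_mode_smooth mode_size_bounds(2)]])
  then show ?thesis by (simp add: force_def)
qed

text \<open>The momentum equation would give a square-integrable pressure gradient.\<close>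

lemma velocity_not_W21: "velocity \<notin> components_in W21_2"
proof
  assume "velocity \<in> components_in W21_2"
  then have W: "(\<lambda>z. velocity z $ k) \<in> W21_2" for k by (simp add: components_in_def)
  have "grad_in_L2 pressure"
    unfolding grad_in_L2_def
  proof
    fix k
    let ?v = "regular_distr Qcyl (\<lambda>z. velocity z $ k)"
    let ?L = "space_L2 (lebesgue_on Qcyl)"
    obtain wt where wt: "wt \<in> ?L" "\<And>\<phi>. \<phi> \<in> test_functions Qcyl \<Longrightarrow> distr_deriv e_t ?v \<phi> =
        regular_distr Qcyl wt \<phi>"
      using W[of k] unfolding W21_2_def distr_in_L2_def distr_eq_def by blast
    have "\<exists>w\<in>?L. \<forall>\<phi>\<in>test_functions Qcyl. distr_deriv (e_x j) (distr_deriv (e_x j) ?v) \<phi> =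
        regular_distr Qcyl w \<phi>" for j
      using W[of k] unfolding W21_2_def distr_in_L2_def distr_eq_def by blast
    then obtain w1 w2 where w: "w1 \<in> ?L" "w2 \<in> ?L"
      "\<And>\<phi>. \<phi> \<in> test_functions Qcyl \<Longrightarrow> distr_deriv (e_x 1) (distr_deriv (e_x 1) ?v) \<phi> =
          regular_distr Qcyl w1 \<phi>"
      "\<And>\<phi>. \<phi> \<in> test_functions Qcyl \<Longrightarrow> distr_deriv (e_x 2) (distr_deriv (e_x 2) ?v) \<phi> =
          regular_distr Qcyl w2 \<phi>"
      by blast
    let ?w = "\<lambda>z. (force z $ k - wt z) + (w1 z + w2 z)"
    have "?w \<in> ?L" by (intro space_L2_add space_L2_diff force_L2 wt w)
    moreover have "distr_deriv (e_x k) (regular_distr Qcyl pressure) \<phi> = regular_distr Qcyl ?w \<phi>"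
      if \<phi>: "\<phi> \<in> test_functions Qcyl" for \<phi>
    proof -
      have "distr_deriv e_t ?v \<phi> - (\<Sum>j\<in>UNIV. distr_deriv (e_x j) (distr_deriv (e_x j) ?v) \<phi>)
          + distr_deriv (e_x k) (regular_distr Qcyl pressure) \<phi> =
              regular_distr Qcyl (\<lambda>z. force z $ k) \<phi>"
        using momentum_eq_example \<phi> unfolding momentum_eq_def Let_def distr_eq_def by blast
      then have "distr_deriv (e_x k) (regular_distr Qcyl pressure) \<phi> =
          (regular_distr Qcyl (\<lambda>z. force z $ k) \<phi> - regular_distr Qcyl wt \<phi>) +
          (regular_distr Qcyl w1 \<phi> + regular_distr Qcyl w2 \<phi>)"
        unfolding sum_2 using wt(2)[OF \<phi>] w(3,4)[OF \<phi>] by linarith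
      also have "\<dots> = regular_distr Qcyl ?w \<phi>"
        by (simp add: regular_distr_add regular_distr_diff space_L2_add space_L2_diff force_L2 wt
            w \<phi> Qcyl_measurable)
      finally show ?thesis .
    qed
    ultimately show "distr_in_L2 Qcyl (distr_deriv (e_x k) (regular_distr Qcyl pressure))"
      unfolding distr_in_L2_def distr_eq_def by blast
  qed
  then show False using pressure_gradient_not_L2 by blast
qed

lemma pulse_C_L2:
  assumes "\<And>n. X n \<in> smooth_alg" "\<And>n. sq_norm (X n) \<le> mode_size n"
  shows "superpose pulse X \<in> C_L2" "superpose pulse X \<in> zero_initial_value"
proof -
  have "summable (\<lambda>n. (1/2::real) ^ Suc n)"
    by (intro summable_Suc_iff[THEN iffD2] summable_geometric) simp
  note r = superpose_C_L2_zero_initial[OF pulse_slabbed(1) pulse_continuous(1) smooth_alg_L2[OF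
      assms(1)]
      pulse_C_L2_bound[of X, OF assms(2)] this]
  then show "superpose pulse X \<in> C_L2" "superpose pulse X \<in> zero_initial_value" by auto
qed

lemma pulse_dt:
  assumes "\<And>n. X n \<in> smooth_alg" "\<And>n. W n \<in> smooth_alg" "\<And>n x. X n x =
      2 * W n x + dir_deriv x (W n) x"
    "\<And>n. sq_norm (W n) \<le> C / real (Suc n)"
  shows "superpose pulse X \<in> dt_in_L2_W_minus1"
  by (rule superpose_dt_in_L2_W_minus1[where W =
      W, OF pulse_deriv pulse_continuous(2) pulse_slabbed(1,2)
      smooth_alg_C1[OF assms(1)] smooth_alg_C1[OF assms(2)] assms(3) pulse_square_integrable(2)
      summable_pulse'[of W, OF assms(4)]])

lemma divergence_mean_zero: "(LINT x|lebesgue_on Omega. divergence (x, t)) = 0"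
  using pulse_slabbed(1)
proof (cases rule: superpose_cases[where t = t])
  case 1
  then show ?thesis by (simp add: divergence_def)
next
  case (2 n)
  then show ?thesis by (simp add: divergence_def integral_div_mode)
qed

theorem theorem1p2:
  "\<exists>(f :: (real ^ 2) \<times> real \<Rightarrow> real ^ 2) (g :: (real ^ 2) \<times> real \<Rightarrow> real).
     f \<in> components_in (space_L2 (lebesgue_on Qcyl)) \<and>
     g \<in> W10_2 \<and>
     g \<in> dt_in_L2_W_minus1 \<and>
     (AE t in lebesgue_on Tint. (LINT x|lebesgue_on Omega. g (x, t)) = 0) \<and>
     g \<in> zero_initial_value \<and>
     g \<in> zero_lateral_trace \<and>
     (\<exists>(v :: (real ^ 2) \<times> real \<Rightarrow> real ^ 2) (p :: (real ^ 2) \<times> real \<Rightarrow> real).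
        v \<in> components_in C_L2 \<and>
        v \<in> components_in W10_2 \<and>
        p \<in> space_L2 (lebesgue_on Qcyl) \<and>
        v \<in> components_in dt_in_L2_W_minus1 \<and>
        momentum_eq v p f \<and>
        divergence_eq v g \<and>
        v \<in> components_in zero_initial_value \<and>
        v \<in> components_in zero_lateral_trace \<and>
        v \<notin> components_in W21_2 \<and>
        \<not> grad_in_L2 p)"
proof (intro exI conjI)
  show "force \<in> components_in (space_L2 (lebesgue_on Qcyl))"
    by (simp add: components_in_def force_L2)
  show "divergence \<in> W10_2" unfolding divergence_def
    by (intro superpose_pulse_W10 mode_smooth mode_size_bounds)
  show "divergence \<in> dt_in_L2_W_minus1" unfolding divergence_def
    by (rule pulse_dt[OF mode_smooth(4,5) div_radial_divergence div_potential_norm])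
  show "AE t in lebesgue_on Tint. (LINT x|lebesgue_on Omega. divergence (x, t)) = 0"
    by (simp add: divergence_mean_zero)
  show "divergence \<in> zero_initial_value" unfolding divergence_def
    by (intro pulse_C_L2 mode_smooth mode_size_bounds)
  show "divergence \<in> zero_lateral_trace" unfolding divergence_def
    by (intro superpose_zero_lateral_trace pulse_slabbed smooth_alg_C1 mode_smooth mode_boundary)
  show "velocity \<in> components_in C_L2" "velocity \<in> components_in zero_initial_value"
    using pulse_C_L2[OF mode_smooth(1) mode_size_bounds(1)] by (simp_all add: components_in_def velocity_def)
  show "velocity \<in> components_in W10_2"
    using superpose_pulse_W10[OF mode_smooth(1) mode_size_bounds(1) mode_size_bounds(3)]
    by (simp add: components_in_def velocity_def)
  have "superpose pulse' (\<lambda>n. Re_pow (Suc n)) \<in> space_L2 (lebesgue_on Qcyl)"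
    by (rule superpose_pulse'_L2[OF _ pressure_norm]) (use Re_Im_pow_smooth in blast)
  from space_L2_cmult[OF this, of "- 1"] show "pressure \<in> space_L2 (lebesgue_on Qcyl)"
    by (simp add: pressure_def[abs_def])
  show "velocity \<in> components_in dt_in_L2_W_minus1"
    using pulse_dt[OF mode_smooth(1,2) velocity_radial_divergence velocity_potential_norm]
    by (simp add: components_in_def velocity_def)
  show "momentum_eq velocity pressure force" by (rule momentum_eq_example)
  show "divergence_eq velocity divergence" by (rule divergence_eq_example)
  have "superpose pulse (velocity_mode k) \<in> zero_lateral_trace" for k
    by (intro superpose_zero_lateral_trace pulse_slabbed smooth_alg_C1 mode_smooth mode_boundary)
  then show "velocity \<in> components_in zero_lateral_trace"
    by (simp add: components_in_def velocity_def)
  show "velocity \<notin> components_in W21_2" by (rule velocity_not_W21)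
  show "\<not> grad_in_L2 pressure" by (rule pressure_gradient_not_L2)
qed

end
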